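(* Let $c>0$ and $\alpha>0$ be constants, let $d\ge 3$, and let $\mathcal{I}=\{v_i\}_{i=1}^m$ be an instance of the $\mathsf{KS}_2(c)$ problem, i.e. $v_1,\dots,v_m\in\mathbb{R}^d$ with $\|v_i\|^2\le\alpha$ for all $i\in[m]$ and $\sum_{i=1}^m\langle v_i,x\rangle^2=1$ for every unit vector $x\in\mathbb{R}^d$. There is a randomised algorithm \textsc{Randomised-KS}$(\mathcal{I},c,\epsilon)$ such that for any such instance and any $\epsilon\in(0,1)$ the following hold: \begin{itemize} \item if there exists a set $S\subset\mathcal{I}$ such that $\frac12-c\sqrt{\alpha}\le\sum_{v\in S}\langle v,x\rangle^2\le\frac12+c\sqrt{\alpha}$ for all unit vectors $x\in\mathbb{R}^d$, then with probability at least $1-2/d$ the algorithm returns a subset $S'\subset\mathcal{I}$ satisfying \[(1-\epsilon)\Big(\tfrac12-c\sqrt{\alpha}\Big)\le\sum_{v\in S'}\langle v,x\rangle^2\le(1+\epsilon)\Big(\tfrac12+c\sqrt{\alpha}\Big)\quad(\ast)\] for all unit vectors $x\in\mathbb{R}^d$; \item if there is no set $S\subset\mathcal{I}$ satisfying $(\ast)$ for all unit vectors $x\in\mathbb{R}^d$, then with probability $1$ the algorithm reports that no such set exists. \end{itemize} The algorithm has running time $O\!\left(\binom{m}{n}\cdot\mathrm{poly}(m,d)\right)$, where \[n=O\!\left(\frac{d}{\epsilon^2}\log(d)\max\Big(\log\Big(\frac{1}{c\sqrt{\alpha}}\Big),\log\Big(\frac{1}{(1/2)-c\sqrt{\alp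ha}}\Big)\Big)\right).\]
   Context: The $\mathsf{KS}_2(c)$ problem: given vectors $v_1,\dots,v_m\in\mathbb{R}^d$ with $\|v_i\|^2\le\alpha$ for all $i$ and $\sum_{i=1}^m\langle v_i,x\rangle^2=1$ for every unit $x\in\mathbb{R}^d$, find $S\subset[m]$ such that $\big|\sum_{i\in S}\langle v_i,x\rangle^2-\frac12\big|\le c\sqrt{\alpha}$ for all unit $x\in\mathbb{R}^d$, or report that no such $S$ exists. *)

theory Defs
  imports "HOL-Probability.SPMF" "Jordan_Normal_Form.Matrix"
begin

section \<open>The restricted Kadison--Singer problem\<close>

definition unit_vecs :: "nat \<Rightarrow> real Matrix.vec set" where
  "unit_vecs d = {x \<in> carrier_vec d. scalar_prod x x = 1}"

definition ks_instance :: "real \<Rightarrow> nat \<Rightarrow> real Matrix.vec list \<Rightarrow> bool" where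
  "ks_instance \<alpha> d vs \<longleftrightarrow>
     (\<forall>v\<in>set vs. v \<in> carrier_vec d \<and> scalar_prod v v \<le> \<alpha>) \<and>
     (\<forall>x\<in>unit_vecs d. (\<Sum>i<length vs. (scalar_prod (vs ! i) x)\<^sup>2) = 1)"

text \<open>Subsets of an instance are sets of indices, so repeated vectors are kept apart.\<close>

definition ks_between ::
    "nat \<Rightarrow> real Matrix.vec list \<Rightarrow> real \<Rightarrow> real \<Rightarrow> nat set \<Rightarrow> bool" where
  "ks_between d vs l u S \<longleftrightarrow>
     S \<subseteq> {..<length vs} \<and>
     (\<forall>x\<in>unit_vecs d. l \<le> (\<Sum>i\<in>S. (scalar_prod (vs ! i) x)\<^sup>2) \<and>
                       (\<Sum>i\<in>S. (scalar_prod (vs ! i) x)\<^sup>2) \<le> u)"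


section \<open>Randomised real RAM\<close>

text \<open>
  Algorithms are programs of a random access machine with two unbounded memories, one of naturals
  (used for control and for addresses) and one of reals, both indirectly addressed. Every
  elementary operation has unit cost. To keep the unit-cost measure honest, naturals only have
  addition and truncated subtraction, there is no conversion from reals to naturals, and the only
  constants in a program are natural numbers. Randomness is a Bernoulli trial whose success
  probability is the value of a real expression.
\<close>

datatype nexp =
    NConst nat
  | NLoad nexp
  | NAdd nexp nexp
  | NSub nexp nexp

datatype rexp =
    ROfNat nexp
  | RLoad nexp
  | RAdd rexp rexp
  | RSub rexp rexp
  | RMul rexp rexp
  | RDiv rexp rexp
  | RSqrt rexp

datatype bexp =
    NLess nexp nexp
  | RLess rexp rexp
  | BNot bexp
  | BAnd bexp bexp

datatype com =
    NStore nexp nexp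
  | RStore nexp rexp
  | Flip nexp rexp
  | Seq com com
  | Cond bexp com com
  | While bexp com

record ram_state =
  nmem :: "nat \<Rightarrow> nat"
  rmem :: "nat \<Rightarrow> real"
  clock :: nat

primrec nval :: "nexp \<Rightarrow> ram_state \<Rightarrow> nat" where
  "nval (NConst n) s = n"
| "nval (NLoad a) s = nmem s (nval a s)"
| "nval (NAdd a b) s = nval a s + nval b s"
| "nval (NSub a b) s = nval a s - nval b s"

primrec rval :: "rexp \<Rightarrow> ram_state \<Rightarrow> real" where
  "rval (ROfNat a) s = real (nval a s)"
| "rval (RLoad a) s = rmem s (nval a s)"
| "rval (RAdd a b) s = rval a s + rval b s"
| "rval (RSub a b) s = rval a s - rval b s"
| "rval (RMul a b) s = rval a s * rval b s"
| "rval (RDiv a b) s = rval a s / rval b s"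
| "rval (RSqrt a) s = sqrt (rval a s)"

primrec bval :: "bexp \<Rightarrow> ram_state \<Rightarrow> bool" where
  "bval (NLess a b) s \<longleftrightarrow> nval a s < nval b s"
| "bval (RLess a b) s \<longleftrightarrow> rval a s < rval b s"
| "bval (BNot b) s \<longleftrightarrow> \<not> bval b s"
| "bval (BAnd a b) s \<longleftrightarrow> bval a s \<and> bval b s"

primrec ncost :: "nexp \<Rightarrow> nat" where
  "ncost (NConst n) = 1"
| "ncost (NLoad a) = ncost a + 1"
| "ncost (NAdd a b) = ncost a + ncost b + 1"
| "ncost (NSub a b) = ncost a + ncost b + 1"

primrec rcost :: "rexp \<Rightarrow> nat" where
  "rcost (ROfNat a) = ncost a + 1"
| "rcost (RLoad a) = ncost a + 1"
| "rcost (RAdd a b) = rcost a + rcost b + 1"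
| "rcost (RSub a b) = rcost a + rcost b + 1"
| "rcost (RMul a b) = rcost a + rcost b + 1"
| "rcost (RDiv a b) = rcost a + rcost b + 1"
| "rcost (RSqrt a) = rcost a + 1"

primrec bcost :: "bexp \<Rightarrow> nat" where
  "bcost (NLess a b) = ncost a + ncost b + 1"
| "bcost (RLess a b) = rcost a + rcost b + 1"
| "bcost (BNot b) = bcost b + 1"
| "bcost (BAnd a b) = bcost a + bcost b + 1"

definition tick :: "nat \<Rightarrow> ram_state \<Rightarrow> ram_state" where
  "tick t s = s\<lparr>clock := clock s + t\<rparr>"

definition nwrite :: "nat \<Rightarrow> nat \<Rightarrow> ram_state \<Rightarrow> ram_state" where
  "nwrite a x s = s\<lparr>nmem := (nmem s)(a := x)\<rparr>"

definition rwrite :: "nat \<Rightarrow> real \<Rightarrow> ram_state \<Rightarrow> ram_state" where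
  "rwrite a x s = s\<lparr>rmem := (rmem s)(a := x)\<rparr>"

text \<open>
  Divergence is the missing mass of the sub-probability distribution. Values of the success
  probability outside the unit interval are clipped by \<^const>\<open>bernoulli_pmf\<close>.
\<close>

partial_function (spmf) while_loop ::
    "bexp \<Rightarrow> (ram_state \<Rightarrow> ram_state spmf) \<Rightarrow> ram_state \<Rightarrow> ram_state spmf" where
  "while_loop b body s =
     (if bval b s
      then bind_spmf (body (tick (bcost b + 1) s)) (while_loop b body)
      else return_spmf (tick (bcost b + 1) s))"

primrec run :: "com \<Rightarrow> ram_state \<Rightarrow> ram_state spmf" where
  "run (NStore a e) s =
     return_spmf (tick (ncost a + ncost e + 1) (nwrite (nval a s) (nval e s) s))"
| "run (RStore a e) s =
     return_spmf (tick (ncost a + rcost e + 1) (rwrite (nval a s) (rval e s) s))"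
| "run (Flip a e) s =
     map_spmf (\<lambda>b. tick (ncost a + rcost e + 1) (nwrite (nval a s) (of_bool b) s))
       (spmf_of_pmf (bernoulli_pmf (rval e s)))"
| "run (Seq p q) s = bind_spmf (run p s) (run q)"
| "run (Cond b p q) s =
     (if bval b s then run p (tick (bcost b + 1) s) else run q (tick (bcost b + 1) s))"
| "run (While b p) s = while_loop b (run p) s"

text \<open>
  Input layout: natural cells 0 and 1 hold \<open>m\<close> and \<open>d\<close>; real cells 0, 1, 2 hold \<open>c\<close>, \<open>\<alpha>\<close>, \<open>\<epsilon>\<close>,
  followed by the \<open>m * d\<close> coordinates, one vector after the other; all other cells are 0.
\<close>

definition ks_input :: "real \<Rightarrow> real \<Rightarrow> real \<Rightarrow> nat \<Rightarrow> real Matrix.vec list \<Rightarrow> ram_state" where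
  "ks_input c \<alpha> \<epsilon> d vs =
     \<lparr>nmem = (\<lambda>a. if a = 0 then length vs else if a = 1 then d else 0),
      rmem = (\<lambda>a. if a = 0 then c else if a = 1 then \<alpha> else if a = 2 then \<epsilon>
                  else if a < 3 + length vs * d
                  then vec_index (vs ! ((a - 3) div d)) ((a - 3) mod d)
                  else 0),
      clock = 0\<rparr>"

text \<open>
  Output layout: natural cell 0 is 0 for the report that no set exists; otherwise the returned set
  is given by its characteristic function in the cells \<open>1, \<dots>, m\<close>.
\<close>

definition ks_output :: "nat \<Rightarrow> ram_state \<Rightarrow> nat set option" where
  "ks_output m s =
     (if nmem s 0 = 0 then None else Some {i. i < m \<and> nmem s (Suc i) \<noteq> 0})"

definition randomised_ks :: "com \<Rightarrow> real \<Rightarrow> real \<Rightarrow> real \<Rightarrow> nat \<Rightarrow> real Matrix.vec list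
    \<Rightarrow> ram_state spmf" where
  "randomised_ks P c \<alpha> \<epsilon> d vs = run P (ks_input c \<alpha> \<epsilon> d vs)"

end

theory Submission
  imports Defs "Jordan_Normal_Form.Determinant" "HOL-Library.Nat_Bijection"
begin

text \<open>
  Write \<open>A(S)\<close> for the sum of \<open>v v\<^sup>T\<close> over the vectors of \<open>S\<close>, and let \<open>\<rho> = 1/2 - c sqrt \<alpha>\<close>. If
  \<open>\<rho> \<le> 0\<close>, every set is a solution. Otherwise it suffices to find a two-colouring of the vectors
  such that both colour classes have \<open>A > (1 - \<epsilon>) \<rho>\<close>, and this can be done without randomness.

  Let \<open>S\<close> be a colour class of a good colouring and \<open>\<delta> = \<epsilon>/4\<close>. Scan the vectors and keep, for each
  colour, a sketch \<open>H\<close> of the vectors of that colour, together with a decoded class \<open>R\<close> whose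
  computation needs only the vectors stored in the sketch. The matrices
  \<open>U = \<delta> \<rho> I + A(R) - (1 - \<delta>) H\<close> and \<open>V = \<delta> \<rho> I + (1 + \<delta>) H - A(S)\<close> are kept positive definite.
  A new vector \<open>v\<close> with \<open>s = v\<^sup>T U\<^sup>-\<^sup>1 v\<close> and \<open>z = v\<^sup>T V\<^sup>-\<^sup>1 v\<close> is not stored if \<open>(1 + s) (1 - z) \<ge> 1\<close>; the
  decoder then gives it to the colour with the larger \<open>s\<close>, and the product of the four determinants
  does not decrease. Otherwise \<open>v\<close> is stored with the weight \<open>max 1 (\<delta>/s)\<close>, and the product grows by a
  factor of at least \<open>1 + \<delta>\<^sup>2\<close>. The four matrices add up to \<open>2 \<delta> (H\<^sub>1 + H\<^sub>2) + 4 \<delta> \<rho> I\<close>, which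
  bounds the product, so at most \<open>O(d log(1/\<rho>) / \<epsilon>\<^sup>2)\<close> vectors are stored. At the end \<open>U > 0\<close> and
  \<open>V > 0\<close> give \<open>A(R) > (1 - 4 \<delta>) \<rho>\<close>.

  The algorithm enumerates all possible sets of stored vectors with their colours, decodes each of
  them and tests the result. If the bound on the number of stored vectors is not small compared
  with \<open>m\<close>, it enumerates all colourings instead. Inverse matrices are never formed: only the
  numbers \<open>v\<^sub>j\<^sup>T U\<^sup>-\<^sup>1 v\<^sub>l\<close> are needed, and a rank-one update of \<open>U\<close> is a rank-one update of them.
\<close>

unbundle no inner_syntax
unbundle no vec_syntax

section \<open>Determinants and rank-one updates\<close>

text \<open>The obstacle is that a spectral sketch of \<open>S\<close> carries real weights and that
  \<open>S\<close> may be large, while only about \<open>m choose n\<close> candidates can be tried.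
  So weights must be recomputable from the positions and colours of the stored vectors. This is why
  there are two barriers: \<open>U\<close> involves only what the decoder knows, \<open>V\<close>
  involves \<open>S\<close> and is known to the encoder alone. Weights and default colours may
  depend on \<open>s\<close> only; the decision to store may also look at \<open>z\<close>. A vector
  left out may get the wrong colour: the growth of \<open>det U\<close> pays for the loss in
  \<open>det V\<close>, so only the four determinants together are controlled. Lower bounds for both
  classes suffice, since the classes add up to I. The choice \<delta> = \<epsilon>/4 comes from (1 -
  \<delta>)^2 / (1 + \<delta>) - \<delta> \<ge> 1 - 4 \<delta>. If at most h vectors are stored,
  coloured positions cost a factor 3^h over \<open>m choose h\<close>, which
  \<open>m choose (2 * h)\<close> absorbs as long as 8 h < m. Beyond that, m / 2 \<le> 4 h, and all
  2^m colourings, at most m + 1 times the central binomial coefficient, are affordable.\<close>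

definition outer :: "real Matrix.vec \<Rightarrow> real Matrix.vec \<Rightarrow> real mat" where
  "outer v w = mat (dim_vec v) (dim_vec w) (\<lambda>(r, s). v $ r * w $ s)"

lemma outer_carrier [simp]:
  "v \<in> carrier_vec n \<Longrightarrow> w \<in> carrier_vec k \<Longrightarrow> outer v w \<in> carrier_mat n k"
  by (auto simp: outer_def)

text \<open>The bordered matrix with rows (1, -v^T) and (y, I) factors in two ways into block
  triangular matrices; comparing the determinants of the two factorisations gives the
  identity.\<close>

lemma det_one_plus_outer:
  assumes v: "v \<in> carrier_vec n" and y: "y \<in> carrier_vec n"
  shows "det (1\<^sub>m n + outer y v) = 1 + v \<bullet> y"
proof -
  let ?e = "1\<^sub>m 1 :: real mat"
  let ?Y = "outer y (vec 1 (\<lambda>_. 1))" and ?V = "outer (vec 1 (\<lambda>_. - 1)) v"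
  have Y: "?Y \<in> carrier_mat n 1" and V: "?V \<in> carrier_mat 1 n"
    using v y by auto
  have o: "outer y v \<in> carrier_mat n n" using v y by simp
  have 1: "four_block_mat ?e (0\<^sub>m 1 n) ?Y (1\<^sub>m n) * four_block_mat ?e ?V (0\<^sub>m n 1) (1\<^sub>m n + outer y v)
     = four_block_mat ?e ?V ?Y (1\<^sub>m n)"
    apply (subst mult_four_block_mat[of _ 1 1 _ n _ n _ _ 1 _ n])
    using Y V o v y
    by (auto intro!: arg_cong2[where f = "four_block_mat ?e ?V"] eq_matI
        simp: outer_def scalar_prod_def)
  have 2: "four_block_mat (mat 1 1 (\<lambda>_. 1 + v \<bullet> y)) ?V (0\<^sub>m n 1) (1\<^sub>m n)
      * four_block_mat ?e (0\<^sub>m 1 n) ?Y (1\<^sub>m n)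
     = four_block_mat ?e ?V ?Y (1\<^sub>m n)"
  proof -
    have "mat 1 1 (\<lambda>_. 1 + v \<bullet> y) * ?e + ?V * ?Y = ?e"
      using v y by (intro eq_matI) (auto simp: outer_def scalar_prod_def sum_negf)
    moreover have "?V * 1\<^sub>m n = ?V" "1\<^sub>m n * ?Y = ?Y" using V Y by auto
    ultimately show ?thesis
      apply (subst mult_four_block_mat[of _ 1 1 _ n _ n _ _ 1 _ n])
      using Y V by auto
  qed
  have c1: "four_block_mat ?e (0\<^sub>m 1 n) ?Y (1\<^sub>m n) \<in> carrier_mat (1 + n) (1 + n)"
    and c2: "four_block_mat ?e ?V (0\<^sub>m n 1) (1\<^sub>m n + outer y v) \<in> carrier_mat (1 + n) (1 + n)"
    and c3: "four_block_mat (mat 1 1 (\<lambda>_. 1 + v \<bullet> y)) ?V (0\<^sub>m n 1) (1\<^sub>m n) \<in> carrier_mat (1 + n) (1 + n)"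
    using Y V o by (auto intro!: four_block_carrier_mat)
  have d1: "det (four_block_mat ?e (0\<^sub>m 1 n) ?Y (1\<^sub>m n)) = 1"
    by (subst det_four_block_mat_upper_right_zero[of _ 1 _ n]) (use Y in auto)
  have d2: "det (four_block_mat ?e ?V (0\<^sub>m n 1) (1\<^sub>m n + outer y v)) = det (1\<^sub>m n + outer y v)"
    by (subst det_four_block_mat_lower_left_zero[of _ 1 _ n]) (use V o in auto)
  have d3: "det (four_block_mat (mat 1 1 (\<lambda>_. 1 + v \<bullet> y)) ?V (0\<^sub>m n 1) (1\<^sub>m n)) = 1 + v \<bullet> y"
    by (subst det_four_block_mat_lower_left_zero[of _ 1 _ n]) (use V in \<open>auto simp: det_single\<close>)
  show ?thesis
    using trans[OF arg_cong[OF 1, of det] arg_cong[OF 2, of det, symmetric]]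
    unfolding det_mult[OF c1 c2] det_mult[OF c3 c1] d1 d2 d3 by simp
qed

section \<open>Positive definite matrices: determinant against trace\<close>

definition mat_trace :: "real mat \<Rightarrow> real" where
  "mat_trace U = (\<Sum>i<dim_row U. U $$ (i, i))"

definition pos_def :: "nat \<Rightarrow> real mat \<Rightarrow> bool" where
  "pos_def n U \<longleftrightarrow> U \<in> carrier_mat n n \<and> (\<forall>i<n. \<forall>j<n. U $$ (i, j) = U $$ (j, i)) \<and>
     (\<forall>x\<in>carrier_vec n. x \<noteq> 0\<^sub>v n \<longrightarrow> x \<bullet> (U *\<^sub>v x) > 0)"

lemma quad_form_sum:
  assumes "U \<in> carrier_mat n n" "x \<in> carrier_vec n"
  shows "x \<bullet> (U *\<^sub>v x) = (\<Sum>i<n. \<Sum>j<n. x $ i * U $$ (i, j) * x $ j)"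
  using assms by (simp add: scalar_prod_def sum_distrib_left mult.assoc atLeast0LessThan)

text \<open>Induction on the dimension: passing to the Schur complement of the first diagonal entry
  \<open>a\<close> divides the determinant by \<open>a\<close> and decreases the trace by at least \<open>a\<close>.\<close>

lemma pos_def_det_le_exp_trace:
  "pos_def n U \<Longrightarrow> 0 < det U \<and> det U \<le> exp (mat_trace U - n)"
proof (induction n arbitrary: U)
  case 0
  then show ?case by (auto simp: pos_def_def mat_trace_def det_dim_zero)
next
  case (Suc n)
  let ?a = "U $$ (0, 0)"
  let ?S = "mat n n (\<lambda>(i, j). U $$ (Suc i, Suc j) - U $$ (Suc i, 0) * U $$ (0, Suc j) / ?a)"
  have U: "U \<in> carrier_mat (Suc n) (Suc n)"
    and sym: "\<And>i j. i < Suc n \<Longrightarrow> j < Suc n \<Longrightarrow> U $$ (i, j) = U $$ (j, i)"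
    and pd: "\<And>x. x \<in> carrier_vec (Suc n) \<Longrightarrow> x \<noteq> 0\<^sub>v (Suc n) \<Longrightarrow> x \<bullet> (U *\<^sub>v x) > 0"
    using Suc.prems by (auto simp: pos_def_def)
  have a: "?a > 0"
  proof -
    have "unit_vec (Suc n) 0 \<bullet> (U *\<^sub>v unit_vec (Suc n) 0) > 0"
      by (rule pd) (auto simp: unit_vec_def zero_vec_def vec_eq_iff)
    then show ?thesis using U by (simp add: scalar_prod_left_unit[of _ "Suc n"] scalar_prod_right_unit[of _ "Suc n"])
  qed
  have S: "?S \<in> carrier_mat n n" by simp
  have "pos_def n ?S"
    unfolding pos_def_def
  proof (intro conjI ballI impI allI)
    show "?S \<in> carrier_mat n n" by (rule S)
    show "?S $$ (i, j) = ?S $$ (j, i)" if "i < n" "j < n" for i j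
      using that sym[of "Suc i" "Suc j"] sym[of "Suc i" 0] sym[of "Suc j" 0] by simp
    fix x :: "real Matrix.vec" assume x: "x \<in> carrier_vec n" "x \<noteq> 0\<^sub>v n"
    define b where "b = (\<Sum>j<n. U $$ (0, Suc j) * x $ j)"
    \<comment> \<open>This first coordinate minimises the form of \<open>U\<close> over all vectors
      with tail \<open>x\<close>; the minimum is the form of the Schur complement at
      \<open>x\<close>.\<close>
    define c where "c = - b / ?a"
    have b': "(\<Sum>i<n. x $ i * U $$ (Suc i, 0)) = b"
      unfolding b_def using sym by (intro sum.cong) auto
    let ?z = "vCons c x"
    have z: "?z \<in> carrier_vec (Suc n)" using x by auto
    have "?z \<noteq> 0\<^sub>v (Suc n)" using x by (auto simp: zero_vec_Suc)
    from pd[OF z this] have "0 < ?z \<bullet> (U *\<^sub>v ?z)" .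
    also have "\<dots> = (\<Sum>i<Suc n. \<Sum>j<Suc n. ?z $ i * U $$ (i, j) * ?z $ j)"
      by (rule quad_form_sum[OF U z])
    also have "\<dots> = c * ?a * c + c * b + b * c + (\<Sum>i<n. \<Sum>j<n. x $ i * U $$ (Suc i, Suc j) * x $ j)"
    proof -
      have "(\<Sum>i<n. x $ i * U $$ (Suc i, 0) * c) = b * c"
        by (simp add: b'[symmetric] sum_distrib_right)
      moreover have "(\<Sum>j<n. c * U $$ (0, Suc j) * x $ j) = c * b"
        by (simp add: b_def sum_distrib_left mult.assoc)
      ultimately show ?thesis
        by (simp add: sum.lessThan_Suc_shift sum.distrib del: sum.lessThan_Suc)
    qed
    also have "\<dots> = (\<Sum>i<n. \<Sum>j<n. x $ i * U $$ (Suc i, Suc j) * x $ j) - b * b / ?a"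
      using a by (simp add: c_def)
    also have "b * b / ?a = (\<Sum>i<n. \<Sum>j<n. x $ i * (U $$ (Suc i, 0) * U $$ (0, Suc j) / ?a) * x $ j)"
    proof -
      have "b * b = (\<Sum>i<n. x $ i * U $$ (Suc i, 0)) * (\<Sum>j<n. U $$ (0, Suc j) * x $ j)"
        unfolding b' b_def ..
      also have "\<dots> = (\<Sum>i<n. \<Sum>j<n. x $ i * U $$ (Suc i, 0) * (U $$ (0, Suc j) * x $ j))"
        by (rule sum_product)
      finally have "b * b / ?a = (\<Sum>i<n. \<Sum>j<n. x $ i * U $$ (Suc i, 0) * (U $$ (0, Suc j) * x $ j) / ?a)"
        by (simp only: sum_divide_distrib)
      then show ?thesis by (simp add: mult.assoc)
    qed
    also have "(\<Sum>i<n. \<Sum>j<n. x $ i * U $$ (Suc i, Suc j) * x $ j)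
        - (\<Sum>i<n. \<Sum>j<n. x $ i * (U $$ (Suc i, 0) * U $$ (0, Suc j) / ?a) * x $ j) = x \<bullet> (?S *\<^sub>v x)"
      unfolding quad_form_sum[OF S x(1)] sum_subtractf[symmetric]
      by (intro sum.cong) (auto simp: algebra_simps)
    finally show "0 < x \<bullet> (?S *\<^sub>v x)" .
  qed
  from Suc.IH[OF this] have IH: "0 < det ?S" "det ?S \<le> exp (mat_trace ?S - n)" by auto
  let ?A = "mat 1 1 (\<lambda>_. ?a)" and ?B = "mat 1 n (\<lambda>(i, j). U $$ (0, Suc j))"
  let ?C = "mat n 1 (\<lambda>(i, j). U $$ (Suc i, 0) / ?a)"
  \<comment> \<open>Block LU factorisation: elimination of the first column leaves \<open>?a\<close>
    and the Schur complement on the diagonal.\<close>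
  have Ueq: "four_block_mat (1\<^sub>m 1) (0\<^sub>m 1 n) ?C (1\<^sub>m n) * four_block_mat ?A ?B (0\<^sub>m n 1) ?S = U"
    apply (subst mult_four_block_mat[of _ 1 1 _ n _ n _ _ 1 _ n])
    using U a by (auto intro!: eq_matI simp: scalar_prod_def)
  have "det U = det (four_block_mat (1\<^sub>m 1) (0\<^sub>m 1 n) ?C (1\<^sub>m n)) * det (four_block_mat ?A ?B (0\<^sub>m n 1) ?S)"
    by (rule trans[OF arg_cong[OF Ueq[symmetric], of det] det_mult[of _ "1 + n"]])
      (auto intro!: four_block_carrier_mat)
  also have "det (four_block_mat (1\<^sub>m 1) (0\<^sub>m 1 n) ?C (1\<^sub>m n)) = 1"
    by (subst det_four_block_mat_upper_right_zero[of _ 1 _ n]) auto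
  also have "det (four_block_mat ?A ?B (0\<^sub>m n 1) ?S) = ?a * det ?S"
    by (subst det_four_block_mat_lower_left_zero[of _ 1 _ n]) (auto simp: det_single)
  finally have det: "det U = ?a * det ?S" by simp
  have "mat_trace ?S \<le> (\<Sum>i<n. U $$ (Suc i, Suc i))"
    unfolding mat_trace_def using a sym by (auto intro!: sum_mono)
  also have "\<dots> = mat_trace U - ?a"
    using U by (simp add: mat_trace_def sum.lessThan_Suc_shift del: sum.lessThan_Suc)
  finally have tr: "mat_trace ?S - n \<le> mat_trace U - ?a - n" by simp
  \<comment> \<open>Turns the factor \<open>?a\<close> of the determinant into an exponential that
    matches the drop of the trace.\<close>
  have "?a \<le> exp (?a - 1)" using exp_ge_add_one_self[of "?a - 1"] by simp
  then have "det U \<le> exp (?a - 1) * exp (mat_trace ?S - n)"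
    unfolding det using IH a by (intro mult_mono) auto
  also have "\<dots> \<le> exp (mat_trace U - Suc n)"
    using tr by (simp add: exp_add[symmetric])
  finally show ?case using det a IH by simp
qed

text \<open>Sherman--Morrison for the numbers \<open>v_j^T M^-1 v_l\<close> when
  \<open>c v_i v_i^T\<close> is added to \<open>M\<close>. The product uses column \<open>i\<close>
  twice, which the symmetry of the kernel permits, so that a program has to save only this column
  before it overwrites the matrix.\<close>

definition rank_one_update :: "(nat \<Rightarrow> nat \<Rightarrow> real) \<Rightarrow> nat \<Rightarrow> real \<Rightarrow> nat \<Rightarrow> nat \<Rightarrow> real" where
  "rank_one_update K i c = (\<lambda>j l. K j l - c / (1 + c * K i i) * K j i * K l i)"

lemma rank_one_update_zero [simp]: "rank_one_update K i 0 = K"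
  by (simp add: rank_one_update_def)

section \<open>Weighted sums of outer products and their kernels\<close>

locale vectors =
  fixes d m :: nat and v :: "nat \<Rightarrow> real Matrix.vec"
  assumes v_carrier: "\<And>i. i < m \<Longrightarrow> v i \<in> carrier_vec d"
begin

definition wmat :: "real \<Rightarrow> nat \<Rightarrow> (nat \<Rightarrow> real) \<Rightarrow> real mat" where
  "wmat a n f = mat d d (\<lambda>(r, s). (if r = s then a else 0) + (\<Sum>i<n. f i * v i $ r * v i $ s))"

text \<open>If \<open>admissible a n f\<close>, then \<open>kern a f n j l\<close> is \<open>v\<^sub>j\<^sup>T M\<^sup>-\<^sup>1 v\<^sub>l\<close> for \<open>M = wmat a n f\<close>, and \<open>gain a n f\<close>
  is \<open>det M / a ^ d\<close>.\<close>

primrec kern :: "real \<Rightarrow> (nat \<Rightarrow> real) \<Rightarrow> nat \<Rightarrow> nat \<Rightarrow> nat \<Rightarrow> real" where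
  "kern a f 0 = (\<lambda>j l. v j \<bullet> v l / a)"
| "kern a f (Suc n) = rank_one_update (kern a f n) n (f n)"

text \<open>Each factor is the ratio of two consecutive determinants, so its positivity carries
  positive definiteness from one prefix to the next. The condition speaks of kernels only, hence of
  numbers that are computed without matrices.\<close>

definition admissible :: "real \<Rightarrow> nat \<Rightarrow> (nat \<Rightarrow> real) \<Rightarrow> bool" where
  "admissible a n f \<longleftrightarrow> (\<forall>i<n. 1 + f i * kern a f i i i > 0)"

definition gain :: "real \<Rightarrow> nat \<Rightarrow> (nat \<Rightarrow> real) \<Rightarrow> real" where
  "gain a n f = (\<Prod>i<n. 1 + f i * kern a f i i i)"

lemma wmat_carrier [simp]: "wmat a n f \<in> carrier_mat d d"
  by (simp add: wmat_def)

lemma wmat_Suc: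
  assumes "n < m"
  shows "wmat a (Suc n) f = wmat a n f + f n \<cdot>\<^sub>m outer (v n) (v n)"
  using v_carrier[OF assms] by (intro eq_matI) (auto simp: wmat_def outer_def)

lemma wmat_mult_vec:
  assumes "n \<le> m" "x \<in> carrier_vec d" "r < d"
  shows "(wmat a n f *\<^sub>v x) $ r = a * x $ r + (\<Sum>i<n. f i * (v i \<bullet> x) * v i $ r)"
proof -
  have "(wmat a n f *\<^sub>v x) $ r
      = (\<Sum>s<d. (if s = r then a * x $ s else 0) + (\<Sum>i<n. f i * v i $ r * v i $ s * x $ s))"
    using assms by (auto simp: wmat_def scalar_prod_def atLeast0LessThan distrib_right
        sum_distrib_right intro!: sum.cong)
  also have "\<dots> = a * x $ r + (\<Sum>i<n. \<Sum>s<d. f i * v i $ r * v i $ s * x $ s)"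
    using assms by (simp add: sum.distrib sum.swap[of _ "{..<n}"])
  also have "(\<Sum>i<n. \<Sum>s<d. f i * v i $ r * v i $ s * x $ s) = (\<Sum>i<n. f i * (v i \<bullet> x) * v i $ r)"
    using assms by (intro sum.cong) (auto simp: scalar_prod_def atLeast0LessThan sum_distrib_left
        sum_distrib_right mult_ac)
  finally show ?thesis .
qed

lemma wmat_quad_form:
  assumes "n \<le> m" "x \<in> carrier_vec d"
  shows "x \<bullet> (wmat a n f *\<^sub>v x) = a * (x \<bullet> x) + (\<Sum>i<n. f i * (v i \<bullet> x)\<^sup>2)"
proof -
  have "x \<bullet> (wmat a n f *\<^sub>v x) = (\<Sum>r<d. x $ r * (a * x $ r + (\<Sum>i<n. f i * (v i \<bullet> x) * v i $ r)))"
    using assms carrier_matD[OF wmat_carrier]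
    by (auto simp add: scalar_prod_def[of x] atLeast0LessThan wmat_mult_vec[OF assms]
        simp del: index_mult_mat_vec intro!: sum.cong)
  also have "\<dots> = a * (x \<bullet> x) + (\<Sum>r<d. \<Sum>i<n. f i * (v i \<bullet> x) * (v i $ r * x $ r))"
    using assms by (simp add: scalar_prod_def[of x x] atLeast0LessThan distrib_left sum.distrib
        sum_distrib_left mult_ac)
  also have "(\<Sum>r<d. \<Sum>i<n. f i * (v i \<bullet> x) * (v i $ r * x $ r)) = (\<Sum>i<n. f i * (v i \<bullet> x) * (v i \<bullet> x))"
    using assms by (subst sum.swap) (simp add: scalar_prod_def[of "v _" x] atLeast0LessThan sum_distrib_left)
  finally show ?thesis by (simp add: power2_eq_square mult.assoc)
qed

lemma wmat_trace:
  assumes "n \<le> m"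
  shows "mat_trace (wmat a n f) = a * d + (\<Sum>i<n. f i * (v i \<bullet> v i))"
proof -
  have "mat_trace (wmat a n f) = a * d + (\<Sum>r<d. \<Sum>i<n. f i * v i $ r * v i $ r)"
    by (simp add: mat_trace_def wmat_def sum.distrib)
  also have "(\<Sum>r<d. \<Sum>i<n. f i * v i $ r * v i $ r) = (\<Sum>i<n. f i * (v i \<bullet> v i))"
    using assms v_carrier[THEN carrier_vecD] by (subst sum.swap)
      (auto intro!: sum.cong simp: scalar_prod_def atLeast0LessThan sum_distrib_left mult.assoc)
  finally show ?thesis .
qed

lemma wmat_sym:
  assumes "x \<in> carrier_vec d" "y \<in> carrier_vec d"
  shows "(wmat a n f *\<^sub>v x) \<bullet> y = x \<bullet> (wmat a n f *\<^sub>v y)"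
proof -
  have t: "transpose_mat (wmat a n f) = wmat a n f"
    by (intro eq_matI) (auto simp: wmat_def mult_ac)
  have "x \<bullet> (wmat a n f *\<^sub>v y) = (transpose_mat (wmat a n f) *\<^sub>v x) \<bullet> y"
    using transpose_vec_mult_scalar[of "wmat a n f" d d y x] assms by simp
  then show ?thesis by (simp add: t)
qed

text \<open>\<open>y l\<close> plays the part of the inverse of \<open>U\<close> applied to
  \<open>v l\<close>. Existence of these solutions is carried through the updates in place of
  invertibility.\<close>

definition solves :: "real mat \<Rightarrow> (nat \<Rightarrow> nat \<Rightarrow> real) \<Rightarrow> (nat \<Rightarrow> real Matrix.vec) \<Rightarrow> bool" where
  "solves U K y \<longleftrightarrow> (\<forall>l<m. y l \<in> carrier_vec d \<and> U *\<^sub>v y l = v l \<and> (\<forall>j<m. K j l = v j \<bullet> y l))"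

lemma solves_sym:
  assumes "solves (wmat a n f) K y" "j < m" "l < m"
  shows "K j l = K l j"
  using assms wmat_sym[of "y j" "y l" a n f]
  by (simp add: solves_def) (metis comm_scalar_prod v_carrier)

text \<open>Sherman--Morrison for the solutions \<open>y\<close>, and the matrix determinant lemma.\<close>

lemma wmat_step:
  assumes n: "n < m" and sol: "solves (wmat a n f) K y" and pd: "pos_def d (wmat a n f)"
    and c: "1 + f n * K n n > 0"
  shows "\<exists>y'. solves (wmat a (Suc n) f) (rank_one_update K n (f n)) y'"
    and "pos_def d (wmat a (Suc n) f)"
    and "det (wmat a (Suc n) f) = det (wmat a n f) * (1 + f n * K n n)"
proof -
  let ?U = "wmat a n f" and ?U' = "wmat a (Suc n) f"
  define c where "c = f n"
  define g where "g = c / (1 + c * K n n)"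
  \<comment> \<open>This is, up to the factor \<open>K n l\<close>, the coefficient of
    \<open>v n\<close> in the residual of the new solution \<open>y' l\<close>.\<close>
  have g: "c - g - c * g * K n n = 0"
    using c unfolding g_def c_def by (simp add: field_simps)
  have vn: "v n \<in> carrier_vec d" using v_carrier n by simp
  have y: "\<And>l. l < m \<Longrightarrow> y l \<in> carrier_vec d" and Uy: "\<And>l. l < m \<Longrightarrow> ?U *\<^sub>v y l = v l"
    and K: "\<And>j l. j < m \<Longrightarrow> l < m \<Longrightarrow> K j l = v j \<bullet> y l"
    using sol by (auto simp: solves_def)
  have U'x: "(?U' *\<^sub>v x) $ r = (?U *\<^sub>v x) $ r + c * (v n \<bullet> x) * v n $ r"
    if "x \<in> carrier_vec d" "r < d" for x r
    using that n by (simp add: wmat_mult_vec c_def)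
  define y' where "y' l = y l - (g * K n l) \<cdot>\<^sub>v y n" for l
  have "solves ?U' (rank_one_update K n (f n)) y'"
    unfolding solves_def
  proof (intro allI impI conjI)
    fix l assume l: "l < m"
    show y'l: "y' l \<in> carrier_vec d" using y l n by (simp add: y'_def)
    have vy: "v j \<bullet> y' l = K j l - g * K n l * K j n" if "j < m" for j
      using that l n y[OF l] y[OF n] v_carrier[OF that] by (simp add: y'_def scalar_prod_minus_distrib[of _ d] K)
    show "rank_one_update K n (f n) j l = v j \<bullet> y' l" if "j < m" for j
      using that l n solves_sym[OF sol n l] by (simp add: vy rank_one_update_def g_def c_def mult_ac)
    have Uy': "(?U *\<^sub>v y' l) $ r = v l $ r - g * K n l * v n $ r" if r: "r < d" for r
    proof -
      have "?U *\<^sub>v y' l = ?U *\<^sub>v y l - (g * K n l) \<cdot>\<^sub>v (?U *\<^sub>v y n)"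
        unfolding y'_def using y[OF l] y[OF n]
        by (simp add: mult_minus_distrib_mat_vec[of _ d d] mult_mat_vec[of _ d d])
      then show ?thesis using Uy[OF l] Uy[OF n] r v_carrier[OF l] vn by simp
    qed
    show "?U' *\<^sub>v y' l = v l"
    proof (rule eq_vecI)
      fix r assume "r < dim_vec (v l)"
      then have r: "r < d" using v_carrier[OF l] by simp
      have "(?U' *\<^sub>v y' l) $ r = v l $ r + K n l * (c - g - c * g * K n n) * v n $ r"
        unfolding U'x[OF y'l r] Uy'[OF r] vy[OF n] by (simp add: algebra_simps)
      then show "(?U' *\<^sub>v y' l) $ r = v l $ r" by (simp add: g)
    qed (use v_carrier[OF l] carrier_matD[OF wmat_carrier] in simp)
  qed
  then show "\<exists>y'. solves ?U' (rank_one_update K n (f n)) y'" by (rule exI[of _ y'])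
  have s0: "K n n \<ge> 0"
  proof (cases "y n = 0\<^sub>v d")
    case True
    then show ?thesis using K[OF n n] vn by simp
  next
    case False
    then have "y n \<bullet> (?U *\<^sub>v y n) > 0" using pd y[OF n] by (simp add: pos_def_def)
    then show ?thesis using Uy[OF n] K[OF n n] comm_scalar_prod[OF vn y[OF n]] by simp
  qed
  show "pos_def d ?U'"
    unfolding pos_def_def
  proof (intro conjI ballI impI allI)
    show "?U' $$ (i, j) = ?U' $$ (j, i)" if "i < d" "j < d" for i j
      using that by (auto simp: wmat_def mult_ac)
    fix x :: "real Matrix.vec" assume x: "x \<in> carrier_vec d" "x \<noteq> 0\<^sub>v d"
    define q where "q = x \<bullet> (?U *\<^sub>v x)"
    define b where "b = v n \<bullet> x"
    have q: "q > 0" using pd x by (simp add: pos_def_def q_def)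
    have qq: "x \<bullet> (?U' *\<^sub>v x) = q + c * b\<^sup>2"
      using x n by (simp add: q_def b_def c_def wmat_quad_form)
    \<comment> \<open>Cauchy--Schwarz for \<open>U\<close> and its inverse: the form of
      \<open>U\<close> at \<open>x - t y_n\<close> is nonnegative for every
      \<open>t\<close>.\<close>
    have cs: "b\<^sup>2 \<le> K n n * q"
    proof -
      have psd: "0 \<le> z \<bullet> (?U *\<^sub>v z)" if "z \<in> carrier_vec d" for z
        using pd that mult_mat_vec_carrier[OF wmat_carrier that, of a n f]
        by (cases "z = 0\<^sub>v d") (auto simp: pos_def_def less_imp_le)
      have e: "0 \<le> q - 2 * t * b + t\<^sup>2 * K n n" for t
      proof -
        let ?z = "x - t \<cdot>\<^sub>v y n"
        have z: "?z \<in> carrier_vec d" using x y[OF n] by simp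
        have "?U *\<^sub>v ?z = ?U *\<^sub>v x - t \<cdot>\<^sub>v v n"
          using x y[OF n] Uy[OF n] by (simp add: mult_minus_distrib_mat_vec[of _ d d] mult_mat_vec[of _ d d])
        then have "?z \<bullet> (?U *\<^sub>v ?z) = ?z \<bullet> (?U *\<^sub>v x) - t * (?z \<bullet> v n)"
          using z x vn by (simp add: scalar_prod_minus_distrib[of _ d] mult_mat_vec_carrier[of _ d d])
        also have "?z \<bullet> (?U *\<^sub>v x) = q - t * (y n \<bullet> (?U *\<^sub>v x))"
          using x y[OF n] by (simp add: minus_scalar_prod_distrib[of _ d] mult_mat_vec_carrier[of _ d d] q_def)
        also have "y n \<bullet> (?U *\<^sub>v x) = b"
          using wmat_sym[of "y n" x a n f] x y[OF n] Uy[OF n] by (simp add: b_def)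
        also have "?z \<bullet> v n = b - t * K n n"
          using x y[OF n] vn K[OF n n] by (simp add: scalar_prod_minus_distrib[of _ d] b_def comm_scalar_prod[of _ d "v n"])
        finally show ?thesis using psd[OF z] by (simp add: power2_eq_square algebra_simps)
      qed
      show ?thesis
      proof (cases "K n n = 0")
        case True
        have "b = 0"
        proof (rule ccontr)
          assume "b \<noteq> 0"
          then show False using e[of "q / b"] True q by simp
        qed
        then show ?thesis using True by simp
      next
        case False
        then have "K n n > 0" using s0 by simp
        then show ?thesis using e[of "b / K n n"] by (simp add: field_simps power2_eq_square)
      qed
    qed
    show "0 < x \<bullet> (?U' *\<^sub>v x)"
    proof (cases "c \<ge> 0")
      case True
      then show ?thesis using q by (simp add: qq add_pos_nonneg)
    next
      case False
      then have "q + c * b\<^sup>2 \<ge> q + c * (K n n * q)" using cs by simp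
      also have "q + c * (K n n * q) = q * (1 + c * K n n)" by (simp add: algebra_simps)
      finally show ?thesis using mult_pos_pos[OF q c] by (simp add: qq c_def)
    qed
  qed simp
  \<comment> \<open>\<open>U\<close> can be pulled out because it maps \<open>y n\<close> to
    \<open>v n\<close>; a rank-one change of the identity remains.\<close>
  have "?U' = ?U * (1\<^sub>m d + outer (c \<cdot>\<^sub>v y n) (v n))"
  proof -
    have o: "outer (c \<cdot>\<^sub>v y n) (v n) \<in> carrier_mat d d" using y[OF n] vn by simp
    have "?U * outer (c \<cdot>\<^sub>v y n) (v n) = outer (c \<cdot>\<^sub>v (?U *\<^sub>v y n)) (v n)"
      using y[OF n] vn by (intro eq_matI)
        (auto simp: outer_def scalar_prod_def wmat_def sum_distrib_left sum_distrib_right mult_ac)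
    also have "\<dots> = c \<cdot>\<^sub>m outer (v n) (v n)"
      using Uy[OF n] by (intro eq_matI) (auto simp: outer_def)
    finally show ?thesis
      using mult_add_distrib_mat[OF wmat_carrier[of a n f] one_carrier_mat o]
        right_mult_one_mat[OF wmat_carrier[of a n f]] by (simp add: wmat_Suc[OF n] c_def)
  qed
  then have "det ?U' = det ?U * det (1\<^sub>m d + outer (c \<cdot>\<^sub>v y n) (v n))"
    using y[OF n] vn by (simp add: det_mult[of _ d])
  also have "det (1\<^sub>m d + outer (c \<cdot>\<^sub>v y n) (v n)) = 1 + c * K n n"
    using y[OF n] vn K[OF n n] by (subst det_one_plus_outer) auto
  finally show "det ?U' = det ?U * (1 + f n * K n n)" by (simp add: c_def)
qed

text \<open>Induction from the matrix \<open>a I\<close>, one rank-one update at a time. This is the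
  link between the scalars that the decoder computes and the matrices that they stand for.\<close>

lemma kern_correct:
  assumes a: "a > 0" and "n \<le> m" "admissible a n f"
  shows "(\<exists>y. solves (wmat a n f) (kern a f n) y) \<and> pos_def d (wmat a n f)
    \<and> det (wmat a n f) = a ^ d * gain a n f"
  using assms(2,3)
proof (induction n)
  case 0
  have w: "wmat a 0 f = a \<cdot>\<^sub>m 1\<^sub>m d" by (intro eq_matI) (auto simp: wmat_def)
  have 1: "solves (wmat a 0 f) (kern a f 0) (\<lambda>l. (1 / a) \<cdot>\<^sub>v v l)"
    unfolding solves_def
  proof (intro allI impI conjI)
    fix l assume "l < m"
    then have vl: "v l \<in> carrier_vec d" by (rule v_carrier)
    then show "(1 / a) \<cdot>\<^sub>v v l \<in> carrier_vec d" by simp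
    show "wmat a 0 f *\<^sub>v ((1 / a) \<cdot>\<^sub>v v l) = v l"
      using vl a by (intro eq_vecI) (auto simp: wmat_mult_vec carrier_matD[OF wmat_carrier] simp del: index_mult_mat_vec)
    show "kern a f 0 j l = v j \<bullet> ((1 / a) \<cdot>\<^sub>v v l)" if "j < m" for j
      using vl v_carrier[OF that] by simp
  qed
  have 2: "pos_def d (wmat a 0 f)"
    unfolding pos_def_def
  proof (intro conjI ballI impI allI)
    show "wmat a 0 f $$ (i, j) = wmat a 0 f $$ (j, i)" if "i < d" "j < d" for i j
      using that by (simp add: wmat_def)
    fix x :: "real Matrix.vec" assume x: "x \<in> carrier_vec d" "x \<noteq> 0\<^sub>v d"
    have "x \<bullet> x > 0"
    proof -
      from x obtain r where r: "r < d" "x $ r \<noteq> 0" by (metis carrier_vecD eq_vecI index_zero_vec)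
      then have "0 < (\<Sum>s<d. x $ s * x $ s)"
        by (intro sum_pos2[of _ r]) (auto simp: zero_less_mult_iff)
      then show ?thesis using x by (simp add: scalar_prod_def atLeast0LessThan)
    qed
    then show "0 < x \<bullet> (wmat a 0 f *\<^sub>v x)" using x a by (simp add: wmat_quad_form)
  qed simp
  show ?case using 1 2 by (auto simp: w gain_def)
next
  case (Suc n)
  then have n: "n < m" and adm: "admissible a n f" and c: "1 + f n * kern a f n n n > 0"
    by (auto simp: admissible_def)
  from Suc.IH adm n obtain y where
    y: "solves (wmat a n f) (kern a f n) y" "pos_def d (wmat a n f)" "det (wmat a n f) = a ^ d * gain a n f"
    by auto
  show ?case
    using wmat_step[OF n y(1,2) c] y(3) by (simp add: gain_def)
qed

lemma kern_nonneg:
  assumes "a > 0" "i < m" "n \<le> m" "admissible a n f"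
  shows "kern a f n i i \<ge> 0"
proof -
  obtain y where y: "solves (wmat a n f) (kern a f n) y" "pos_def d (wmat a n f)"
    using kern_correct assms by blast
  then have *: "y i \<in> carrier_vec d" "wmat a n f *\<^sub>v y i = v i" "kern a f n i i = v i \<bullet> y i"
    using assms by (auto simp: solves_def)
  then show ?thesis
    using y(2) v_carrier[OF assms(2)] comm_scalar_prod[OF v_carrier[OF assms(2)] *(1)]
    by (cases "y i = 0\<^sub>v d") (auto simp: pos_def_def less_imp_le)
qed

text \<open>A vanishing diagonal entry of the kernel of a positive definite matrix forces
  \<open>y i = 0\<close> and thus \<open>v i = 0\<close>, so the entry vanishes for every other such
  matrix. The encoder needs this to rule out storing a vector with s = 0.\<close>

lemma kern_eq_0:
  assumes "a > 0" "i < m" "n \<le> m" "admissible a n f" "admissible b k g" "b > 0" "k \<le> m"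
    and "kern a f n i i = 0"
  shows "kern b g k i i = 0"
proof -
  obtain y where y: "solves (wmat a n f) (kern a f n) y" "pos_def d (wmat a n f)"
    using kern_correct assms by blast
  then have *: "y i \<in> carrier_vec d" "wmat a n f *\<^sub>v y i = v i" "kern a f n i i = v i \<bullet> y i"
    using assms by (auto simp: solves_def)
  have "y i = 0\<^sub>v d"
    using y(2) * comm_scalar_prod[OF v_carrier[OF assms(2)] *(1)] assms by (auto simp: pos_def_def)
  then have "v i = 0\<^sub>v d"
    using *(2) carrier_matD[OF wmat_carrier[of a n f]] by (intro eq_vecI) (auto simp flip: *(2))
  obtain z where z: "solves (wmat b k g) (kern b g k) z"
    using kern_correct assms by blast
  then have "kern b g k i i = v i \<bullet> z i" "z i \<in> carrier_vec d" using assms by (auto simp: solves_def)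
  then show ?thesis using \<open>v i = 0\<^sub>v d\<close> by simp
qed

lemma admissible_quad_form_pos:
  assumes "a > 0" "n \<le> m" "admissible a n f" "x \<in> carrier_vec d" "x \<noteq> 0\<^sub>v d"
  shows "a * (x \<bullet> x) + (\<Sum>i<n. f i * (v i \<bullet> x)\<^sup>2) > 0"
  using kern_correct[OF assms(1-3)] assms by (auto simp: pos_def_def wmat_quad_form)

text \<open>The diagonal entries are values of the form at unit vectors. Applied to
  \<open>U\<close>, the inequality bounds the total weight of the sketch from above.\<close>

lemma admissible_trace_pos:
  assumes "a > 0" "n \<le> m" "admissible a n f"
  shows "a * d + (\<Sum>i<n. f i * (v i \<bullet> v i)) \<ge> 0"
proof -
  have pd: "pos_def d (wmat a n f)" using kern_correct assms by blast
  have "wmat a n f $$ (r, r) \<ge> 0" if r: "r < d" for r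
  proof -
    have "wmat a n f $$ (r, r) = a * (unit_vec d r \<bullet> unit_vec d r) + (\<Sum>i<n. f i * (v i \<bullet> unit_vec d r)\<^sup>2)"
      using r assms(2) v_carrier by (auto simp: wmat_def power2_eq_square scalar_prod_right_unit mult_ac
          intro!: sum.cong)
    then show ?thesis
      using admissible_quad_form_pos[OF assms, of "unit_vec d r"] r by simp
  qed
  then have "mat_trace (wmat a n f) \<ge> 0"
    unfolding mat_trace_def by (intro sum_nonneg) (auto simp: carrier_matD[OF wmat_carrier])
  then show ?thesis using assms by (simp add: wmat_trace)
qed

lemma smult_mat_mult_vec:
  assumes "x \<in> carrier_vec d"
  shows "x \<bullet> ((c \<cdot>\<^sub>m wmat a n f) *\<^sub>v x) = c * (x \<bullet> (wmat a n f *\<^sub>v x))"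
  using assms by (subst (1 2) quad_form_sum[of _ d]) (auto simp: sum_distrib_left mult_ac carrier_matD[OF wmat_carrier])

text \<open>The exponential trace bound for \<open>M / t\<close>. The scale \<open>t\<close> stays
  free: with one \<open>t\<close> for several matrices the exponents add up, and only the sum of the
  traces matters.\<close>

lemma gain_le:
  assumes "a > 0" "n \<le> m" "admissible a n f" "t > 0"
  shows "a ^ d * gain a n f \<le> t ^ d * exp ((a * d + (\<Sum>i<n. f i * (v i \<bullet> v i))) / t - d)"
proof -
  let ?U = "wmat a n f" and ?T = "(1 / t) \<cdot>\<^sub>m wmat a n f"
  have pd: "pos_def d ?U" and det: "det ?U = a ^ d * gain a n f"
    using kern_correct assms by blast+
  have "pos_def d ?T"
    using pd assms(4) by (auto simp: pos_def_def smult_mat_mult_vec carrier_matD[OF wmat_carrier])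
  then have "det ?T \<le> exp (mat_trace ?T - d)" using pos_def_det_le_exp_trace by blast
  moreover have "mat_trace ?T = mat_trace ?U / t"
    by (simp add: mat_trace_def sum_divide_distrib carrier_matD[OF wmat_carrier])
  moreover have "det ?T = det ?U / t ^ d"
    by (simp add: carrier_matD[OF wmat_carrier] power_one_over)
  ultimately show ?thesis
    using assms by (simp add: wmat_trace det field_simps carrier_matD[OF wmat_carrier])
qed

text \<open>Converse of the pivot condition: with s the kernel entry, the form of
  \<open>M - v v^T\<close> at the solution \<open>y n\<close> equals s - s^2, and its positivity
  gives s < 1.\<close>

lemma kern_less_one:
  assumes "a > 0" "n < m" "admissible a n f"
    and pos: "\<And>x. x \<in> carrier_vec d \<Longrightarrow> x \<noteq> 0\<^sub>v d \<Longrightarrow> a * (x \<bullet> x) + (\<Sum>i<n. f i * (v i \<bullet> x)\<^sup>2) - (v n \<bullet> x)\<^sup>2 > 0"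
  shows "kern a f n n n < 1"
proof -
  obtain y where y: "solves (wmat a n f) (kern a f n) y"
    using kern_correct assms by fastforce
  then have *: "y n \<in> carrier_vec d" "wmat a n f *\<^sub>v y n = v n" "kern a f n n n = v n \<bullet> y n"
    using assms by (auto simp: solves_def)
  show ?thesis
  proof (cases "y n = 0\<^sub>v d")
    case True
    then show ?thesis using * v_carrier[OF assms(2)] by simp
  next
    case False
    let ?s = "kern a f n n n"
    have "a * (y n \<bullet> y n) + (\<Sum>i<n. f i * (v i \<bullet> y n)\<^sup>2) = ?s"
      using wmat_quad_form[of n "y n" a f] * assms(2) comm_scalar_prod[OF v_carrier[OF assms(2)] *(1)] by simp
    then have "?s - ?s\<^sup>2 > 0" using pos[OF *(1) False] *(3) by simp
    then have "?s * (1 - ?s) > 0" by (simp add: power2_eq_square algebra_simps)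
    moreover have "?s \<ge> 0" using kern_nonneg assms by simp
    ultimately show ?thesis by (simp add: zero_less_mult_iff)
  qed
qed

end

section \<open>Decoding and encoding\<close>

text \<open>A stored vector must be felt by \<open>U\<close>: if \<open>s\<close> is small, its
  weight is raised until weight times \<open>s\<close> equals \<delta>. The weight depends on
  \<open>s\<close> only, so the decoder can recompute it. At \<open>s = 0\<close> the division
  yields weight 0; the encoder never stores such a vector.\<close>

definition head_weight :: "real \<Rightarrow> real \<Rightarrow> real" where
  "head_weight \<delta> s = (if s < \<delta> then \<delta> / s else 1)"

text \<open>The hypothesis on \<open>z\<close> says z > s / (1 + s). For s < \<delta> the weight
  gives \<open>w * s = \<delta>\<close>; replacing z by s / (1 + s), and then 1 + s by 1 in the
  denominator, bounds the product from below by (1 - \<delta> + \<delta>^2) (1 + \<delta> +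
  \<delta>^2) = 1 + \<delta>^2 + \<delta>^4. For s \<ge> \<delta> the factors are 1 + \<delta> s and
  1 + \<delta> z, and the first one suffices.\<close>

lemma head_gain:
  assumes "0 < \<delta>" "\<delta> < 1" "0 < s" and z: "(1 + s) * (1 - z) < 1"
  defines "w \<equiv> head_weight \<delta> s"
  shows "w \<ge> 1" "1 + (1 - (1 - \<delta>) * w) * s > 0"
    "(1 + (1 - (1 - \<delta>) * w) * s) * (1 + ((1 + \<delta>) * w - 1) * z) \<ge> 1 + \<delta>\<^sup>2"
proof -
  have zs: "s / (1 + s) < z" using assms(3) z by (simp add: field_simps)
  then have z0: "z > 0" using assms(3) by (smt (verit) divide_pos_pos)
  show w: "w \<ge> 1"
    using assms(1-3) by (auto simp: w_def head_weight_def)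
  have wd: "(1 + \<delta>) * w - 1 \<ge> 0"
    using w assms(1) mult_mono[of 1 "1 + \<delta>" 1 w] by simp
  show p: "1 + (1 - (1 - \<delta>) * w) * s > 0"
  proof (cases "s < \<delta>")
    case True
    then have "(1 - (1 - \<delta>) * w) * s = s - (1 - \<delta>) * \<delta>"
      using assms by (simp add: head_weight_def field_simps)
    moreover have "(1 - \<delta>) * \<delta> < 1" using mult_strict_mono[of "1 - \<delta>" 1 \<delta> 1] assms by simp
    ultimately show ?thesis using assms(3) by simp
  next
    case False
    then show ?thesis using assms by (simp add: head_weight_def add_pos_pos)
  qed
  show "(1 + (1 - (1 - \<delta>) * w) * s) * (1 + ((1 + \<delta>) * w - 1) * z) \<ge> 1 + \<delta>\<^sup>2"
  proof (cases "s < \<delta>")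
    case True
    have ws: "w * s = \<delta>" using True assms(3) by (simp add: w_def head_weight_def)
    have "(1 + (1 - (1 - \<delta>) * w) * s) * (1 + ((1 + \<delta>) * w - 1) * (s / (1 + s)))
      \<le> (1 + (1 - (1 - \<delta>) * w) * s) * (1 + ((1 + \<delta>) * w - 1) * z)"
      using p zs wd by (intro mult_left_mono add_left_mono) auto
    moreover have "(1 + (1 - (1 - \<delta>) * w) * s) * (1 + ((1 + \<delta>) * w - 1) * (s / (1 + s)))
      = (1 - (1 - \<delta>) * (w * s) / (1 + s)) * (1 + (1 + \<delta>) * (w * s))"
      using assms(3) by (simp add: field_simps)
    moreover have "(1 - (1 - \<delta>) * \<delta> / (1 + s)) * (1 + (1 + \<delta>) * \<delta>)
      \<ge> (1 - (1 - \<delta>) * \<delta>) * (1 + (1 + \<delta>) * \<delta>)"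
      using assms(1-3) divide_left_mono[of 1 "1 + s" "(1 - \<delta>) * \<delta>"]
      by (intro mult_right_mono) auto
    moreover have "(1 - (1 - \<delta>) * \<delta>) * (1 + (1 + \<delta>) * \<delta>) = 1 + \<delta>\<^sup>2 + \<delta>\<^sup>2 * \<delta>\<^sup>2"
      by (simp add: power2_eq_square algebra_simps)
    ultimately show ?thesis unfolding ws by (smt (verit) zero_le_power2 mult_nonneg_nonneg)
  next
    case False
    then have w1: "w = 1" by (simp add: w_def head_weight_def)
    have "1 + \<delta>\<^sup>2 \<le> 1 + \<delta> * s" using False assms(1) by (simp add: power2_eq_square)
    also have "\<dots> \<le> (1 + \<delta> * s) * (1 + \<delta> * z)"
      using assms(1,3) z0 mult_left_mono[of 1 "1 + \<delta> * z" "1 + \<delta> * s"] by simp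
    finally show ?thesis by (simp add: w1)
  qed
qed

text \<open>The symbol \<open>b i\<close> is \<open>0\<close> if the vector \<open>v\<^sub>i\<close> is not stored, and \<open>a + 1\<close> if it is stored for the
  side \<open>a < 2\<close>. The kernels \<open>K a\<close> belong to the matrices \<open>U\<close> of the two sides; the kernels \<open>K (a + 2)\<close>
  belong to \<open>\<mu> I - A(R)\<close> and serve to test the decoded set.\<close>

definition dec_side :: "(nat \<Rightarrow> nat) \<Rightarrow> nat \<Rightarrow> (nat \<Rightarrow> nat \<Rightarrow> nat \<Rightarrow> real) \<Rightarrow> nat" where
  "dec_side b i K =
     (if b i = 1 then 0 else if b i = 2 then 1 else if K 0 i i < K 1 i i then 1 else 0)"

text \<open>The coefficient with which the vector enters \<open>U\<close>: 1 through the decoded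
  class, and minus (1 - \<delta>) times its weight through the sketch if it is stored.\<close>

definition dec_coeff :: "real \<Rightarrow> (nat \<Rightarrow> nat) \<Rightarrow> nat \<Rightarrow> (nat \<Rightarrow> nat \<Rightarrow> nat \<Rightarrow> real) \<Rightarrow> real" where
  "dec_coeff \<delta> b i K =
     (if b i = 0 then 1 else 1 - (1 - \<delta>) * head_weight \<delta> (K (dec_side b i K) i i))"

definition dec_step :: "real \<Rightarrow> (nat \<Rightarrow> nat) \<Rightarrow> nat \<Rightarrow> (nat \<Rightarrow> nat \<Rightarrow> nat \<Rightarrow> real)
    \<Rightarrow> nat \<Rightarrow> nat \<Rightarrow> nat \<Rightarrow> real" where
  "dec_step \<delta> b i K = (\<lambda>k. if k = dec_side b i K then rank_one_update (K k) i (dec_coeff \<delta> b i K)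
     else if k = dec_side b i K + 2 then rank_one_update (K k) i (- 1) else K k)"

primrec dec :: "real \<Rightarrow> (nat \<Rightarrow> nat \<Rightarrow> nat \<Rightarrow> real) \<Rightarrow> (nat \<Rightarrow> nat) \<Rightarrow> nat
    \<Rightarrow> nat \<Rightarrow> nat \<Rightarrow> nat \<Rightarrow> real" where
  "dec \<delta> K b 0 = K"
| "dec \<delta> K b (Suc n) = dec_step \<delta> b n (dec \<delta> K b n)"

lemma dec_side_less: "dec_side b i K < 2"
  by (simp add: dec_side_def)

text \<open>Causality: the state before vector \<open>n\<close> depends on the earlier symbols only.
  The encoder may therefore inspect this state before it chooses the symbol of
  \<open>n\<close>.\<close>

lemma dec_cong:
  "(\<And>i. i < n \<Longrightarrow> b i = b' i) \<Longrightarrow> dec \<delta> K b n = dec \<delta> K b' n"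
proof (induction n)
  case (Suc n)
  then have "dec \<delta> K b n = dec \<delta> K b' n" "b n = b' n" by auto
  moreover from this(2) have "dec_side b n = dec_side b' n" "dec_coeff \<delta> b n = dec_coeff \<delta> b' n"
    by (auto simp: dec_side_def dec_coeff_def fun_eq_iff)
  ultimately show ?case by (simp add: dec_step_def cong: if_cong)
qed simp

context vectors
begin

lemma kern_cong: "(\<And>i. i < n \<Longrightarrow> f i = g i) \<Longrightarrow> kern a f n = kern a g n"
  by (induction n) auto

lemma gain_cong: "(\<And>i. i < n \<Longrightarrow> f i = g i) \<Longrightarrow> gain a n f = gain a n g"
  by (induction n) (auto simp: gain_def kern_cong[of _ f g])

lemma gain_Suc: "gain a (Suc n) f = gain a n f * (1 + f n * kern a f n n n)"
  by (simp add: gain_def)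

lemma gain_pos: "admissible a n f \<Longrightarrow> gain a n f > 0"
  by (auto simp: gain_def admissible_def intro!: prod_pos)

lemma admissible_Suc: "admissible a (Suc n) f \<longleftrightarrow> admissible a n f \<and> 1 + f n * kern a f n n n > 0"
  by (auto simp: admissible_def less_Suc_eq)

lemma admissible_cong: "(\<And>i. i < n \<Longrightarrow> f i = g i) \<Longrightarrow> admissible a n f \<longleftrightarrow> admissible a n g"
proof (induction n)
  case (Suc n)
  then show ?case using kern_cong[of n f g a] by (simp add: admissible_Suc)
qed (simp add: admissible_def)

end

section \<open>Encoder and decoder for a tight family of vectors\<close>

locale ks = vectors +
  fixes \<rho> \<epsilon> :: real
  assumes tight: "\<And>x. x \<in> carrier_vec d \<Longrightarrow> (\<Sum>i<m. (v i \<bullet> x)\<^sup>2) = x \<bullet> x"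
    and lam: "0 < \<rho>" "\<rho> \<le> 1 / 2" and eps: "0 < \<epsilon>" "\<epsilon> < 1"
begin

definition \<delta> :: real where "\<delta> = \<epsilon> / 4"

text \<open>The classes add up to the identity, so the lower bound (1 - \<epsilon>) \<rho> for one
  class is the upper bound \<mu> for the other. Upper bounds are what the kernels
  \<open>K (a + 2)\<close> can test while the vectors arrive.\<close>

definition \<mu> :: real where "\<mu> = 1 - (1 - \<epsilon>) * \<rho>"

definition init :: "nat \<Rightarrow> nat \<Rightarrow> nat \<Rightarrow> real" where
  "init k j l = v j \<bullet> v l / (if k < 2 then \<delta> * \<rho> else \<mu>)"

definition decode :: "(nat \<Rightarrow> nat) \<Rightarrow> nat \<Rightarrow> nat \<Rightarrow> nat \<Rightarrow> nat \<Rightarrow> real" where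
  "decode = dec \<delta> init"

definition side :: "(nat \<Rightarrow> nat) \<Rightarrow> nat \<Rightarrow> nat" where
  "side b i = dec_side b i (decode b i)"

definition accepted :: "(nat \<Rightarrow> nat) \<Rightarrow> bool" where
  "accepted b \<longleftrightarrow> (\<forall>i<m. decode b i (side b i + 2) i i < 1)"

definition dcoeff :: "(nat \<Rightarrow> nat) \<Rightarrow> nat \<Rightarrow> nat \<Rightarrow> real" where
  "dcoeff b a i = (if side b i = a then dec_coeff \<delta> b i (decode b i) else 0)"

definition ccoeff :: "(nat \<Rightarrow> nat) \<Rightarrow> nat \<Rightarrow> nat \<Rightarrow> real" where
  "ccoeff b a i = (if side b i = a then - 1 else 0)"

lemma delta: "0 < \<delta>" "\<delta> < 1 / 4" "\<delta> < 1"
  using eps by (auto simp: \<delta>_def)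

lemma dl_pos: "\<delta> * \<rho> > 0"
  using delta lam by simp

lemma mu_pos: "\<mu> > 0"
proof -
  have "(1 - \<epsilon>) * \<rho> < 1" using mult_strict_mono[of "1 - \<epsilon>" 1 \<rho> 1] eps lam by simp
  then show ?thesis by (simp add: \<mu>_def)
qed

lemma side_less: "side b i < 2"
  by (simp add: side_def dec_side_less)

text \<open>Seen from a single matrix, the adaptive decoder is a sequence of rank-one updates with
  coefficient 0 for the vectors of the other side. This makes the theory of \<open>kern\<close>
  available for all four kernels.\<close>

lemma decode_kern:
  "a < 2 \<Longrightarrow> decode b n a = kern (\<delta> * \<rho>) (dcoeff b a) n \<and> decode b n (a + 2) = kern \<mu> (ccoeff b a) n"
proof (induction n arbitrary: a)
  case 0
  then show ?case by (auto simp: decode_def init_def fun_eq_iff)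
next
  case (Suc n)
  have "decode b (Suc n) = dec_step \<delta> b n (decode b n)" by (simp add: decode_def)
  then show ?case
    using Suc.IH[OF Suc.prems] Suc.prems side_less[of b n]
    by (auto simp: dec_step_def side_def[symmetric] dcoeff_def ccoeff_def)
qed

text \<open>The trace of the identity that tightness expresses, read off at the unit
  vectors.\<close>

lemma norm_sum: "(\<Sum>i<m. v i \<bullet> v i) = d"
proof -
  have "(\<Sum>i<m. v i \<bullet> v i) = (\<Sum>i<m. \<Sum>r<d. (v i \<bullet> unit_vec d r)\<^sup>2)"
    using v_carrier by (intro sum.cong)
      (auto simp: scalar_prod_def[of "v _" "v _"] atLeast0LessThan power2_eq_square scalar_prod_right_unit
        carrier_vecD intro!: sum.cong)
  also have "\<dots> = (\<Sum>r<d. \<Sum>i<m. (v i \<bullet> unit_vec d r)\<^sup>2)" by (rule sum.swap)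
  also have "\<dots> = (\<Sum>r<d. 1)"
  proof (intro sum.cong refl)
    fix r assume "r \<in> {..<d}"
    then show "(\<Sum>i<m. (v i \<bullet> unit_vec d r)\<^sup>2) = 1" using tight[of "unit_vec d r"] by simp
  qed
  also have "\<dots> = d" by simp
  finally show ?thesis .
qed

lemma self_pos:
  fixes x :: "real Matrix.vec"
  assumes "x \<in> carrier_vec d" "x \<noteq> 0\<^sub>v d"
  shows "x \<bullet> x > 0"
  using admissible_quad_form_pos[of 1 0 "\<lambda>_. 0" x] assms by (simp add: admissible_def)

text \<open>Soundness of the test for every \<open>b\<close>, also for one that no encoder has
  produced: the updates of \<open>K (a + 2)\<close> have coefficient -1, and the test says precisely
  that their pivots stay positive.\<close>

lemma accepted_bound:
  assumes acc: "accepted b" and a: "a < 2" and x: "x \<in> carrier_vec d" "x \<noteq> 0\<^sub>v d"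
  shows "(\<Sum>i | i < m \<and> side b i = a. (v i \<bullet> x)\<^sup>2) < \<mu> * (x \<bullet> x)"
proof -
  have "admissible \<mu> m (ccoeff b a)"
    unfolding admissible_def using acc a decode_kern[OF a, of b]
    by (auto simp: accepted_def ccoeff_def)
  from admissible_quad_form_pos[OF mu_pos _ this x]
  have "(\<Sum>i<m. - ccoeff b a i * (v i \<bullet> x)\<^sup>2) < \<mu> * (x \<bullet> x)" by (simp add: sum_negf)
  also have "(\<Sum>i<m. - ccoeff b a i * (v i \<bullet> x)\<^sup>2) = (\<Sum>i<m. if side b i = a then (v i \<bullet> x)\<^sup>2 else 0)"
    by (intro sum.cong) (auto simp: ccoeff_def)
  also have "\<dots> = (\<Sum>i | i < m \<and> side b i = a. (v i \<bullet> x)\<^sup>2)"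
    by (simp add: sum.inter_filter[symmetric] conj_commute)
  finally show ?thesis .
qed

text \<open>Completeness of the test: a bound on the whole class passes to its prefixes, because the
  omitted terms are squares, and the bound on a prefix yields the next pivot.\<close>

lemma accepted_intro:
  assumes "\<And>a x. a < 2 \<Longrightarrow> x \<in> carrier_vec d \<Longrightarrow> x \<noteq> 0\<^sub>v d \<Longrightarrow>
    (\<Sum>i | i < m \<and> side b i = a. (v i \<bullet> x)\<^sup>2) < \<mu> * (x \<bullet> x)"
  shows "accepted b"
proof -
  have less: "kern \<mu> (ccoeff b a) n n n < 1"
    if n: "n < m" "side b n = a" and adm: "admissible \<mu> n (ccoeff b a)" for a n
  proof (rule kern_less_one[OF mu_pos n(1) adm])
    fix x :: "real Matrix.vec" assume x: "x \<in> carrier_vec d" "x \<noteq> 0\<^sub>v d"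
    have a: "a < 2" using n(2) side_less[of b n] by simp
    have "(v n \<bullet> x)\<^sup>2 - (\<Sum>i<n. ccoeff b a i * (v i \<bullet> x)\<^sup>2)
      = (\<Sum>i<Suc n. if side b i = a then (v i \<bullet> x)\<^sup>2 else 0)"
      using n(2) by (auto simp: sum_negf[symmetric] ccoeff_def intro!: sum.cong)
    also have "\<dots> = (\<Sum>i | i < Suc n \<and> side b i = a. (v i \<bullet> x)\<^sup>2)"
      by (simp add: sum.inter_filter[symmetric] conj_commute del: sum.lessThan_Suc)
    also have "\<dots> \<le> (\<Sum>i | i < m \<and> side b i = a. (v i \<bullet> x)\<^sup>2)"
      using n(1) by (intro sum_mono2) auto
    also have "\<dots> < \<mu> * (x \<bullet> x)" using assms[OF a x] .
    finally show "\<mu> * (x \<bullet> x) + (\<Sum>i<n. ccoeff b a i * (v i \<bullet> x)\<^sup>2) - (v n \<bullet> x)\<^sup>2 > 0" by simp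
  qed
  have "admissible \<mu> n (ccoeff b a)" if "n \<le> m" "a < 2" for n a
    using that
  proof (induction n)
    case (Suc n)
    then show ?case
      using less[of n a] by (cases "side b n = a") (auto simp: admissible_Suc ccoeff_def[of b a n])
  qed (simp add: admissible_def)
  then show ?thesis
    using less side_less decode_kern unfolding accepted_def by (metis less_imp_le)
qed

lemma decode_cong: "(\<And>i. i < n \<Longrightarrow> b i = b' i) \<Longrightarrow> decode b n = decode b' n"
  unfolding decode_def by (rule dec_cong)

lemma side_cong:
  assumes "\<And>j. j \<le> i \<Longrightarrow> b j = b' j"
  shows "side b i = side b' i" "dcoeff b a i = dcoeff b' a i"
proof -
  have "decode b i = decode b' i" using assms by (intro decode_cong) auto
  then show "side b i = side b' i" "dcoeff b a i = dcoeff b' a i"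
    using assms[of i] by (auto simp: side_def dcoeff_def dec_side_def dec_coeff_def)
qed

text \<open>The invariant of the encoder. The set \<open>S\<close> is fixed, \<open>t i\<close> is the side on which it puts
  \<open>v i\<close>, and \<open>w i\<close> is the weight of \<open>v i\<close> in the sketch of that side. The kernels given by
  \<open>dcoeff b a\<close> and \<open>e a\<close> belong to the matrices (decoded minus sketch) and (sketch minus target).\<close>

definition encodes :: "(nat \<Rightarrow> nat) \<Rightarrow> nat \<Rightarrow> (nat \<Rightarrow> nat) \<Rightarrow> (nat \<Rightarrow> nat \<Rightarrow> real) \<Rightarrow> (nat \<Rightarrow> real) \<Rightarrow> bool" where
  "encodes t n b e w \<longleftrightarrow>
     (\<forall>i. b i \<le> 2) \<and>
     (\<forall>i<n. w i \<ge> 0 \<and> (\<forall>a<2.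
        dcoeff b a i = of_bool (side b i = a) - (1 - \<delta>) * of_bool (t i = a) * w i \<and>
        e a i = of_bool (t i = a) * ((1 + \<delta>) * w i - 1))) \<and>
     (\<forall>a<2. admissible (\<delta> * \<rho>) n (dcoeff b a) \<and> admissible (\<delta> * \<rho>) n (e a)) \<and>
     (1 + \<delta>\<^sup>2) ^ card {i. i < n \<and> b i \<noteq> 0} \<le>
       (\<Prod>a<2. gain (\<delta> * \<rho>) n (dcoeff b a) * gain (\<delta> * \<rho>) n (e a))"

text \<open>Both cases are reduced to \<open>step\<close>, which asks for positive pivots and for a
  local inequality between the pivots of \<open>U\<close> and \<open>V\<close>. By causality the new
  symbol leaves the earlier coefficients and gains as they were.\<close>

lemma encoder_step:
  assumes enc: "encodes t n b e w" and n: "n < m" and t: "t n < 2"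
  shows "\<exists>b' e' w'. encodes t (Suc n) b' e' w'"
proof -
  let ?a = "t n" and ?q = "\<delta> * \<rho>"
  have b: "\<And>i. b i \<le> 2"
    and spec: "\<And>i a. i < n \<Longrightarrow> a < 2 \<Longrightarrow> w i \<ge> 0 \<and>
        dcoeff b a i = of_bool (side b i = a) - (1 - \<delta>) * of_bool (t i = a) * w i \<and>
        e a i = of_bool (t i = a) * ((1 + \<delta>) * w i - 1)"
    and adm: "\<And>a. a < 2 \<Longrightarrow> admissible ?q n (dcoeff b a)" "\<And>a. a < 2 \<Longrightarrow> admissible ?q n (e a)"
    and G: "(1 + \<delta>\<^sup>2) ^ card {i. i < n \<and> b i \<noteq> 0} \<le>
       (\<Prod>a<2. gain ?q n (dcoeff b a) * gain ?q n (e a))"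
    using enc by (auto simp: encodes_def)
  define s where "s = kern ?q (dcoeff b ?a) n n n"
  define z where "z = kern ?q (e ?a) n n n"
  have s0: "s \<ge> 0" and z0: "z \<ge> 0"
    unfolding s_def z_def using n adm t by (auto intro!: kern_nonneg dl_pos)
  have step: "\<exists>b' e' w'. encodes t (Suc n) b' e' w'"
    if x: "x \<le> 2" and W: "W \<ge> 0"
      and cf: "\<And>a. a < 2 \<Longrightarrow> dcoeff (b(n := x)) a n = of_bool (side (b(n := x)) n = a) - (1 - \<delta>) * of_bool (?a = a) * W"
      and pos: "\<And>a. a < 2 \<Longrightarrow> 1 + dcoeff (b(n := x)) a n * kern ?q (dcoeff b a) n n n > 0"
        "1 + ((1 + \<delta>) * W - 1) * z > 0"
      and gn: "(1 + \<delta>\<^sup>2) ^ of_bool (x \<noteq> 0) \<le>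
        (\<Prod>a<2. 1 + dcoeff (b(n := x)) a n * kern ?q (dcoeff b a) n n n) * (1 + ((1 + \<delta>) * W - 1) * z)"
    for x W
  proof -
    define b' where "b' = b(n := x)"
    define w' where "w' = w(n := W)"
    define e' where "e' a = (e a)(n := of_bool (?a = a) * ((1 + \<delta>) * W - 1))" for a
    have bb: "side b' i = side b i" "dcoeff b' a i = dcoeff b a i" if "i < n" for i a
      using that by (auto simp: b'_def intro!: side_cong)
    have ee: "e' a i = e a i" "w' i = w i" if "i < n" for i a using that by (auto simp: e'_def w'_def)
    have kb: "kern ?q (dcoeff b' a) n = kern ?q (dcoeff b a) n" "kern ?q (e' a) n = kern ?q (e a) n" for a
      using bb ee by (auto intro!: kern_cong)
    have gb: "gain ?q n (dcoeff b' a) = gain ?q n (dcoeff b a)" "gain ?q n (e' a) = gain ?q n (e a)" for a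
      using bb ee by (auto intro!: gain_cong)
    have ab: "admissible ?q n (dcoeff b' a)" "admissible ?q n (e' a)" if "a < 2" for a
      using adm[OF that] admissible_cong[of n "dcoeff b' a" "dcoeff b a"] admissible_cong[of n "e' a" "e a"] bb ee
      by auto
    have f': "(\<Prod>a<2. 1 + e' a n * kern ?q (e a) n n n) = 1 + ((1 + \<delta>) * W - 1) * z"
      using t by (auto simp: e'_def z_def numeral_2_eq_2 less_Suc_eq)
    have card: "card {i. i < Suc n \<and> b' i \<noteq> 0} = card {i. i < n \<and> b i \<noteq> 0} + of_bool (x \<noteq> 0)"
    proof -
      have "{i. i < Suc n \<and> b' i \<noteq> 0} = {i. i < n \<and> b i \<noteq> 0} \<union> (if x \<noteq> 0 then {n} else {})"
        by (auto simp: b'_def less_Suc_eq)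
      then show ?thesis by simp
    qed
    have "encodes t (Suc n) b' e' w'"
      unfolding encodes_def
    proof (intro conjI allI impI)
      show "b' i \<le> 2" for i using b x by (auto simp: b'_def)
      show "w' i \<ge> 0" if "i < Suc n" for i using that W spec[of i 0] by (auto simp: w'_def less_Suc_eq)
      show "dcoeff b' a i = of_bool (side b' i = a) - (1 - \<delta>) * of_bool (t i = a) * w' i"
        if "i < Suc n" "a < 2" for i a
      proof (cases "i = n")
        case True
        then show ?thesis using cf[OF that(2)] by (simp add: b'_def w'_def)
      next
        case False
        then have "i < n" using that by simp
        then show ?thesis using spec[OF \<open>i < n\<close> that(2)] bb ee by simp
      qed
      show "e' a i = of_bool (t i = a) * ((1 + \<delta>) * w' i - 1)" if "i < Suc n" "a < 2" for i a
        using that spec[of i a] by (cases "i = n") (auto simp: e'_def w'_def)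
      show "admissible ?q (Suc n) (dcoeff b' a)" if "a < 2" for a
        using ab[OF that] pos(1)[OF that] by (simp add: admissible_Suc kb b'_def[symmetric])
      show "admissible ?q (Suc n) (e' a)" if "a < 2" for a
        using ab[OF that] pos(2) by (auto simp: admissible_Suc kb z_def) (auto simp: e'_def)
      have "(1 + \<delta>\<^sup>2) ^ card {i. i < Suc n \<and> b' i \<noteq> 0}
        = (1 + \<delta>\<^sup>2) ^ card {i. i < n \<and> b i \<noteq> 0} * (1 + \<delta>\<^sup>2) ^ of_bool (x \<noteq> 0)"
        unfolding card by (simp add: power_add)
      also have "\<dots> \<le> (\<Prod>a<2. gain ?q n (dcoeff b a) * gain ?q n (e a)) *
        ((\<Prod>a<2. 1 + dcoeff b' a n * kern ?q (dcoeff b a) n n n) * (\<Prod>a<2. 1 + e' a n * kern ?q (e a) n n n))"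
        unfolding f' using G gn adm gain_pos[THEN less_imp_le]
        by (intro mult_mono) (auto simp: b'_def intro!: prod_nonneg mult_nonneg_nonneg)
      also have "\<dots> = (\<Prod>a<2. gain ?q (Suc n) (dcoeff b' a) * gain ?q (Suc n) (e' a))"
        unfolding gain_Suc kb gb by (simp only: prod.distrib mult_ac)
      finally show "(1 + \<delta>\<^sup>2) ^ card {i. i < Suc n \<and> b' i \<noteq> 0} \<le>
        (\<Prod>a<2. gain ?q (Suc n) (dcoeff b' a) * gain ?q (Suc n) (e' a))" .
    qed
    then show ?thesis by blast
  qed
  show ?thesis
  proof (cases "(1 + s) * (1 - z) \<ge> 1")
    case True
    \<comment> \<open>As 1 + s is positive, a product of at least 1 forces z < 1, so
      \<open>V\<close> stays positive definite when the new term is only subtracted.\<close>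
    have z1: "1 - z > 0" using True s0 by (smt (verit) mult_nonneg_nonpos)
    let ?b = "b(n := 0)"
    have dcd: "decode ?b n = decode b n" by (intro decode_cong) simp
    have dc: "dcoeff ?b a n = of_bool (side ?b n = a)" for a
      by (simp add: dcoeff_def dec_coeff_def)
    let ?k = "\<lambda>a. kern ?q (dcoeff b a) n n n"
    have k0: "?k a \<ge> 0" if "a < 2" for a
      using n adm(1)[OF that] by (auto intro!: kern_nonneg dl_pos)
    have "side ?b n = (if ?k 0 < ?k 1 then 1 else 0)"
      unfolding side_def dcd by (simp add: dec_side_def decode_kern[of 0] decode_kern[of 1, simplified])
    \<comment> \<open>The decoder takes the larger of the two kernels, so its pivot is at least 1 +
      s even when its side differs from \<open>t n\<close>.\<close>
    then have "?k (side ?b n) \<ge> s"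
      using t unfolding s_def by (cases "?k 0 < ?k 1") (auto simp: less_2_cases_iff)
    then have "(1 + ?k (side ?b n)) * (1 - z) \<ge> 1"
      using z1 by (intro order.trans[OF True] mult_right_mono) auto
    moreover have "(\<Prod>a<2. 1 + dcoeff ?b a n * ?k a) = 1 + ?k (side ?b n)"
      using side_less[of ?b n] by (auto simp: dc numeral_2_eq_2 less_Suc_eq)
    \<comment> \<open>Symbol 0 and weight 0: the sketch is unchanged, and \<open>V\<close> on the
      side \<open>t n\<close> loses the full new term.\<close>
    ultimately show ?thesis
      using True k0 z1 by (intro step[of 0 0]) (auto simp: dc add_pos_nonneg)
  next
    case False
    then have z: "(1 + s) * (1 - z) < 1" by simp
    \<comment> \<open>If \<open>s\<close> vanished, so would \<open>z\<close>, and the product would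
      be 1.\<close>
    have "s \<noteq> 0"
    proof
      assume "s = 0"
      then have "z = 0"
        using kern_eq_0[of ?q n n "dcoeff b ?a" ?q n "e ?a"] adm t n dl_pos by (simp add: s_def z_def)
      then show False using \<open>s = 0\<close> z by simp
    qed
    then have s: "s > 0" using s0 by simp
    let ?b = "b(n := Suc ?a)" and ?W = "head_weight \<delta> s"
    have dcd: "decode ?b n = decode b n" by (intro decode_cong) simp
    have sd: "side ?b n = ?a" using t by (auto simp: side_def dec_side_def less_2_cases_iff)
    have "decode b n ?a n n = s" using decode_kern[OF t] by (simp add: s_def)
    then have dc: "dcoeff ?b a n = of_bool (?a = a) * (1 - (1 - \<delta>) * ?W)" for a
      using sd by (auto simp: dcoeff_def dec_coeff_def dcd sd[unfolded side_def dcd])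
    note hg = head_gain[OF delta(1) delta(3) s z]
    have pr: "(\<Prod>a<2. 1 + dcoeff ?b a n * kern ?q (dcoeff b a) n n n) = 1 + (1 - (1 - \<delta>) * ?W) * s"
      using t by (auto simp: dc numeral_2_eq_2 less_Suc_eq s_def)
    show ?thesis
    proof (rule step[of "Suc ?a" ?W])
      show "1 + ((1 + \<delta>) * ?W - 1) * z > 0"
        using hg(1) delta(1) z0 mult_mono[of 1 "1 + \<delta>" 1 ?W] by (intro add_pos_nonneg mult_nonneg_nonneg) auto
      show "0 < 1 + dcoeff ?b a n * kern ?q (dcoeff b a) n n n" if "a < 2" for a
        using hg(2) by (auto simp: dc s_def)
    qed (use t hg pr in \<open>auto simp: dc sd\<close>)
  qed
qed

lemma encoder_exists:
  assumes "\<And>i. t i < 2" "n \<le> m"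
  shows "\<exists>b e w. encodes t n b e w"
  using assms(2)
proof (induction n)
  case 0
  have "encodes t 0 (\<lambda>_. 0) (\<lambda>_ _. 0) (\<lambda>_. 0)" by (simp add: encodes_def admissible_def gain_def)
  then show ?case by blast
next
  case (Suc n)
  then show ?case using encoder_step assms(1) by (metis Suc_le_lessD less_imp_le)
qed

text \<open>\<open>U > 0\<close> bounds the sketch by the decoded class, and \<open>V > 0\<close>
  bounds the target by the sketch. Chained, the decoded class exceeds ((1 - \<delta>)^2 / (1 +
  \<delta>) - \<delta>) \<rho>. The test bounds side \<open>a\<close> from above, so the chain is
  run on the other side.\<close>

lemma encodes_accepted:
  assumes enc: "encodes t m b e w" and t: "\<And>i. t i < 2"
    and S: "\<And>a x. a < 2 \<Longrightarrow> x \<in> carrier_vec d \<Longrightarrow>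
      \<rho> * (x \<bullet> x) \<le> (\<Sum>i<m. of_bool (t i = a) * (v i \<bullet> x)\<^sup>2)"
  shows "accepted b"
proof (rule accepted_intro)
  fix a and x :: "real Matrix.vec" assume a: "a < (2 :: nat)" and x: "x \<in> carrier_vec d" "x \<noteq> 0\<^sub>v d"
  define a' where "a' = 1 - a"
  have a': "a' < 2" by (simp add: a'_def)
  have adm: "admissible (\<delta> * \<rho>) m (dcoeff b a')" "admissible (\<delta> * \<rho>) m (e a')"
    using enc a' by (auto simp: encodes_def)
  have sp: "dcoeff b a' i = of_bool (side b i = a') - (1 - \<delta>) * of_bool (t i = a') * w i"
    "e a' i = of_bool (t i = a') * ((1 + \<delta>) * w i - 1)" if "i < m" for i
    using enc a' that by (auto simp: encodes_def)
  let ?q = "x \<bullet> x" and ?F = "\<lambda>f. \<Sum>i<m. f i * (v i \<bullet> x)\<^sup>2"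
  let ?R = "?F (\<lambda>i. of_bool (side b i = a'))" and ?H = "?F (\<lambda>i. of_bool (t i = a') * w i)"
  let ?T = "?F (\<lambda>i. of_bool (t i = a'))"
  have q: "?q > 0" using self_pos[OF x] .
  have "?F (dcoeff b a') = (\<Sum>i<m. of_bool (side b i = a') * (v i \<bullet> x)\<^sup>2 - (1 - \<delta>) * (of_bool (t i = a') * w i * (v i \<bullet> x)\<^sup>2))"
    by (intro sum.cong refl, subst sp) (simp_all add: algebra_simps)
  then have F1: "?F (dcoeff b a') = ?R - (1 - \<delta>) * ?H"
    by (simp add: sum_subtractf sum_distrib_left)
  have "?F (e a') = (\<Sum>i<m. (1 + \<delta>) * (of_bool (t i = a') * w i * (v i \<bullet> x)\<^sup>2) - of_bool (t i = a') * (v i \<bullet> x)\<^sup>2)"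
    by (intro sum.cong refl, subst sp) (simp_all add: algebra_simps)
  then have F2: "?F (e a') = (1 + \<delta>) * ?H - ?T"
    by (simp add: sum_subtractf sum_distrib_left)
  have 1: "\<delta> * \<rho> * ?q + ?R - (1 - \<delta>) * ?H > 0"
    using admissible_quad_form_pos[OF dl_pos order.refl adm(1) x] unfolding F1 by simp
  have "\<delta> * \<rho> * ?q + (1 + \<delta>) * ?H - ?T > 0"
    using admissible_quad_form_pos[OF dl_pos order.refl adm(2) x] unfolding F2 by simp
  then have "(1 - \<delta>) * (\<rho> * ?q) < (1 + \<delta>) * ?H"
    using S[OF a' x(1)] by (simp add: algebra_simps)
  then have "(1 - \<delta>) * ((1 - \<delta>) * (\<rho> * ?q)) < (1 - \<delta>) * ((1 + \<delta>) * ?H)"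
    using delta by (intro mult_strict_left_mono) auto
  also have "\<dots> = (1 + \<delta>) * ((1 - \<delta>) * ?H)" by simp
  also have "\<dots> < (1 + \<delta>) * (\<delta> * \<rho> * ?q + ?R)"
    using 1 delta by (intro mult_strict_left_mono) auto
  finally have "(1 + \<delta>) * ((1 - 4 * \<delta>) * (\<rho> * ?q)) < (1 + \<delta>) * ?R + (\<rho> * ?q) * ((1 + \<delta>) * (1 - 4 * \<delta>) - (1 - \<delta>) * (1 - \<delta>) + \<delta> * (1 + \<delta>))"
    by (simp add: algebra_simps)
  also have "\<dots> \<le> (1 + \<delta>) * ?R"
  proof -
    \<comment> \<open>Constant and linear terms cancel; this is the origin of the 4 in \<delta> =
      \<epsilon>/4.\<close>
    have "(1 + \<delta>) * (1 - 4 * \<delta>) - (1 - \<delta>) * (1 - \<delta>) + \<delta> * (1 + \<delta>) = - 4 * \<delta> * \<delta>"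
      by (simp add: algebra_simps)
    then show ?thesis using lam q delta by (simp add: mult_nonneg_nonpos)
  qed
  finally have "(1 - \<epsilon>) * (\<rho> * ?q) < ?R" using delta by (simp add: \<delta>_def)
  moreover have "(\<Sum>i | i < m \<and> side b i = a. (v i \<bullet> x)\<^sup>2) = ?q - ?R"
  proof -
    have "(\<Sum>i | i < m \<and> side b i = a. (v i \<bullet> x)\<^sup>2) = (\<Sum>i<m. if side b i = a then (v i \<bullet> x)\<^sup>2 else 0)"
      by (simp add: sum.inter_filter[symmetric] conj_commute)
    also have "\<dots> = (\<Sum>i<m. (v i \<bullet> x)\<^sup>2 - of_bool (side b i = a') * (v i \<bullet> x)\<^sup>2)"
    proof (intro sum.cong refl)
      fix i
      show "(if side b i = a then (v i \<bullet> x)\<^sup>2 else 0) = (v i \<bullet> x)\<^sup>2 - of_bool (side b i = a') * (v i \<bullet> x)\<^sup>2"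
        using side_less[of b i] a by (auto simp: a'_def less_2_cases_iff)
    qed
    finally show ?thesis using tight[OF x(1)] by (simp add: sum_subtractf)
  qed
  ultimately show "(\<Sum>i | i < m \<and> side b i = a. (v i \<bullet> x)\<^sup>2) < \<mu> * ?q"
    by (simp add: \<mu>_def algebra_simps)
qed

text \<open>The four matrices of the invariant add up to \<open>2 \<delta>\<close> times the sketch plus \<open>4 \<delta> \<rho> I\<close>, so that
  the product of their determinants is at most \<open>(2 \<delta>)\<close> to the power \<open>4 d\<close>; it starts at
  \<open>(\<delta> \<rho>)\<close> to the power \<open>4 d\<close>.\<close>

lemma encodes_card:
  assumes enc: "encodes t m b e w" and t: "\<And>i. t i < 2"
  shows "(1 + \<delta>\<^sup>2) ^ card {i. i < m \<and> b i \<noteq> 0} \<le> (2 / \<rho>) ^ (4 * d)"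
proof -
  let ?q = "\<delta> * \<rho>" and ?t = "2 * \<delta>"
  let ?tr = "\<lambda>f. ?q * d + (\<Sum>i<m. f i * (v i \<bullet> v i))"
  have adm: "\<And>a. a < 2 \<Longrightarrow> admissible ?q m (dcoeff b a)" "\<And>a. a < 2 \<Longrightarrow> admissible ?q m (e a)"
    using enc by (auto simp: encodes_def)
  define X where "X = (\<Sum>i<m. w i * (v i \<bullet> v i))"
  have s2: "side b i = 0 \<or> side b i = 1" "t i = 0 \<or> t i = 1" for i
    using side_less[of b i] t[of i] by auto
  have sp0: "dcoeff b 0 i = of_bool (side b i = 0) - (1 - \<delta>) * of_bool (t i = 0) * w i"
      "dcoeff b 1 i = of_bool (side b i = 1) - (1 - \<delta>) * of_bool (t i = 1) * w i"
      "e 0 i = of_bool (t i = 0) * ((1 + \<delta>) * w i - 1)"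
      "e 1 i = of_bool (t i = 1) * ((1 + \<delta>) * w i - 1)" if "i < m" for i
    using enc that by (auto simp: encodes_def)
  have sp: "dcoeff b 0 i + dcoeff b 1 i = 1 - (1 - \<delta>) * w i"
    "e 0 i + e 1 i = (1 + \<delta>) * w i - 1" if "i < m" for i
    using sp0[OF that] s2[of i] by auto
  have "?tr (dcoeff b 0) + ?tr (dcoeff b 1) = 2 * ?q * d + (\<Sum>i<m. (dcoeff b 0 i + dcoeff b 1 i) * (v i \<bullet> v i))"
    by (simp add: sum.distrib algebra_simps)
  also have "\<dots> = 2 * ?q * d + (\<Sum>i<m. v i \<bullet> v i - (1 - \<delta>) * (w i * (v i \<bullet> v i)))"
    using sp by (intro arg_cong[where f = "\<lambda>y. _ + y"] sum.cong refl) (simp add: left_diff_distrib)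
  also have "\<dots> = 2 * ?q * d + d - (1 - \<delta>) * X"
    by (simp add: sum_subtractf sum_distrib_left norm_sum X_def)
  finally have tU: "?tr (dcoeff b 0) + ?tr (dcoeff b 1) = 2 * ?q * d + d - (1 - \<delta>) * X" .
  have "?tr (e 0) + ?tr (e 1) = 2 * ?q * d + (\<Sum>i<m. (e 0 i + e 1 i) * (v i \<bullet> v i))"
    by (simp add: sum.distrib algebra_simps)
  also have "\<dots> = 2 * ?q * d + (\<Sum>i<m. (1 + \<delta>) * (w i * (v i \<bullet> v i)) - v i \<bullet> v i)"
    using sp by (intro arg_cong[where f = "\<lambda>y. _ + y"] sum.cong refl) (simp add: left_diff_distrib)
  also have "\<dots> = 2 * ?q * d - d + (1 + \<delta>) * X"
    by (simp add: sum_subtractf sum_distrib_left norm_sum X_def)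
  finally have tV: "?tr (e 0) + ?tr (e 1) = 2 * ?q * d - d + (1 + \<delta>) * X" .
  \<comment> \<open>The traces of the two \<open>U\<close> are nonnegative, which bounds the
    weighted trace \<open>X\<close> of the sketch and hence the traces of the two
    \<open>V\<close>.\<close>
  have "(1 - \<delta>) * X \<le> 2 * ?q * d + d"
    using admissible_trace_pos[OF dl_pos order.refl adm(1)[of 0]]
      admissible_trace_pos[OF dl_pos order.refl adm(1)[of 1]] tU by simp
  moreover have "?q \<le> (1/4) * (1/2)" using delta lam by (intro mult_mono) auto
  then have "2 * ?q * d \<le> d / 4" using mult_right_mono[of ?q "1/8" d] by simp
  ultimately have "(1 - \<delta>) * X \<le> 5/4 * d" by simp
  moreover have "(1 - \<delta>) * X \<ge> 3/4 * X \<or> X < 0" using delta mult_right_mono[of "3/4" "1 - \<delta>" X] by auto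
  ultimately have X: "X \<le> 5/3 * d" by auto
  have "2 * \<rho> * d \<le> d" using lam mult_right_mono[of "2 * \<rho>" 1 d] by simp
  \<comment> \<open>2 \<rho> d + X \<le> d + 5/3 d, so with the common scale
    \<open>2 * \<delta>\<close> the four exponents add up to at most 0.\<close>
  have T: "(?tr (dcoeff b 0) + ?tr (dcoeff b 1) + (?tr (e 0) + ?tr (e 1))) / ?t \<le> 4 * d"
  proof -
    have "(2 * ?q * d + d - (1 - \<delta>) * X + (2 * ?q * d - d + (1 + \<delta>) * X)) / ?t = 2 * \<rho> * d + X"
      using delta(1) by (simp add: field_simps)
    then show ?thesis unfolding tU tV using \<open>2 * \<rho> * d \<le> d\<close> X by simp
  qed
  have gl: "?q ^ d * gain ?q m f \<le> ?t ^ d * exp (?tr f / ?t - d)" if "admissible ?q m f" for f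
    using gain_le[OF dl_pos order.refl that, of ?t] delta by simp
  have gp: "?q ^ d * gain ?q m f \<ge> 0" if "admissible ?q m f" for f
    using gain_pos[OF that] dl_pos by simp
  let ?E = "\<lambda>f. exp (?tr f / ?t - d)"
  have "?q ^ (4 * d) * (\<Prod>a<2. gain ?q m (dcoeff b a) * gain ?q m (e a))
    = ((?q ^ d * gain ?q m (dcoeff b 0)) * (?q ^ d * gain ?q m (dcoeff b 1))) * ((?q ^ d * gain ?q m (e 0)) * (?q ^ d * gain ?q m (e 1)))"
  proof -
    have "?q ^ (4 * d) = ?q ^ d * ?q ^ d * (?q ^ d * ?q ^ d)"
      unfolding power_add[symmetric] by (rule arg_cong[where f = "power _"]) simp
    then show ?thesis by (simp add: numeral_2_eq_2 mult_ac)
  qed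
  also have "\<dots> \<le> ((?t ^ d * ?E (dcoeff b 0)) * (?t ^ d * ?E (dcoeff b 1))) * ((?t ^ d * ?E (e 0)) * (?t ^ d * ?E (e 1)))"
    using adm delta(1) by (intro mult_mono gl mult_nonneg_nonneg gp) auto
  also have "\<dots> = ?t ^ (4 * d) * exp ((?tr (dcoeff b 0) + ?tr (dcoeff b 1) + (?tr (e 0) + ?tr (e 1))) / ?t - 4 * d)"
  proof -
    have "?E (dcoeff b 0) * ?E (dcoeff b 1) * (?E (e 0) * ?E (e 1)) = exp ((?tr (dcoeff b 0) + ?tr (dcoeff b 1) + (?tr (e 0) + ?tr (e 1))) / ?t - 4 * d)"
      by (simp add: exp_add[symmetric] add_divide_distrib)
    moreover have "?t ^ (4 * d) = ?t ^ d * ?t ^ d * (?t ^ d * ?t ^ d)"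
      unfolding power_add[symmetric] by (rule arg_cong[where f = "power _"]) simp
    ultimately show ?thesis by (simp add: mult_ac)
  qed
  also have "\<dots> \<le> ?t ^ (4 * d)"
    using T delta(1) by (intro mult_right_le_one_le) auto
  finally have "(\<Prod>a<2. gain ?q m (dcoeff b a) * gain ?q m (e a)) \<le> ?t ^ (4 * d) / ?q ^ (4 * d)"
    by (intro mult_imp_le_div_pos zero_less_power dl_pos) (simp only: mult.commute[of _ "?q ^ (4 * d)"])
  also have "\<dots> = (2 / \<rho>) ^ (4 * d)"
    using delta(1) by (simp only: power_divide[symmetric]) simp
  finally show ?thesis
    using enc by (auto simp: encodes_def)
qed

end

section \<open>Executing programs\<close>

text \<open>Abstract memory: \<open>ra\<close> holds the output set, while \<open>na\<close> and
  \<open>wk\<close> are families of arrays indexed by array number and position, so that writes to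
  different arrays visibly do not interfere.\<close>

record st =
  ra :: "nat \<Rightarrow> nat"
  na :: "nat \<times> nat \<Rightarrow> nat"
  wk :: "nat \<times> nat \<Rightarrow> real"

definition cM :: nexp where "cM = NLoad (NConst 0)"
definition quad :: "nexp \<Rightarrow> nexp" where "quad e = NAdd (NAdd e e) (NAdd e e)"
definition na_at :: "nat \<Rightarrow> nexp \<Rightarrow> nexp" where
  "na_at r e = NAdd cM (NAdd (quad e) (NConst (Suc r)))"
definition NA :: "nat \<Rightarrow> nexp \<Rightarrow> nexp" where "NA r e = NLoad (na_at r e)"
definition reg :: "nat \<Rightarrow> nexp" where "reg j = NA 0 (NConst j)"
definition wk_at :: "nexp \<Rightarrow> nexp \<Rightarrow> nexp" where
  "wk_at r e = NAdd (reg 0) (NAdd (NAdd (quad e) (quad e)) r)"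
definition WK :: "nexp \<Rightarrow> nexp \<Rightarrow> rexp" where "WK r e = RLoad (wk_at r e)"
definition rreg :: "nat \<Rightarrow> rexp" where "rreg j = WK (NConst 0) (NConst j)"
definition enc2 :: "nexp \<Rightarrow> nexp \<Rightarrow> nexp" where "enc2 j l = NAdd (NA 2 (NAdd j l)) j"
definition RC :: "nat \<Rightarrow> rexp" where "RC n = ROfNat (NConst n)"

definition setN :: "nat \<Rightarrow> nexp \<Rightarrow> nexp \<Rightarrow> com" where "setN r e x = NStore (na_at r e) x"
definition setW :: "nexp \<Rightarrow> nexp \<Rightarrow> rexp \<Rightarrow> com" where "setW r e x = RStore (wk_at r e) x"
definition setS :: "nexp \<Rightarrow> nexp \<Rightarrow> com" where "setS i x = NStore (NAdd i (NConst 1)) x"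
definition For :: "nat \<Rightarrow> nexp \<Rightarrow> com \<Rightarrow> com" where
  "For j bnd body = Seq (setN 0 (NConst j) (NConst 0))
     (While (NLess (reg j) bnd) (Seq body (setN 0 (NConst j) (NAdd (reg j) (NConst 1)))))"

lemmas cost_defs = cM_def quad_def na_at_def NA_def reg_def wk_at_def WK_def rreg_def enc2_def RC_def

lemma cost_simps [simp]:
  "ncost cM = 2" "ncost (quad e) = 4 * ncost e + 3" "ncost (na_at r e) = 4 * ncost e + 8"
  "ncost (NA r e) = 4 * ncost e + 9" "ncost (reg j) = 13" "ncost (wk_at x e) = 8 * ncost e + ncost x + 22"
  "rcost (WK x e) = 8 * ncost e + ncost x + 23" "rcost (rreg j) = 32"
  "ncost (enc2 a b) = 5 * ncost a + 4 * ncost b + 14" "rcost (RC n) = 2"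
  by (simp_all add: cost_defs)

text \<open>A bound for the cost of every primitive command of the program.\<close>

definition unit_cost :: nat where "unit_cost = 20000"

section \<open>Memory layout and timed execution\<close>

locale ram =
  fixes m d :: nat and inp :: "nat \<Rightarrow> real"
  assumes m_pos: "0 < m"
begin

definition W :: nat where "W = 3 + m * d"

text \<open>Natural cell \<open>0\<close> holds \<open>m\<close> throughout, and the cells \<open>1, \<dots>, m\<close> hold the output set. The other
  natural cells are split by residues modulo 4 into registers (0), candidate bits (1), a table of
  triangular numbers (2) and the offsets of the input vectors (3). The real cells beyond the input
  are split modulo 8 into registers (0), a vector (1), the Gram matrix (2) and the four kernels
  (3 to 6). Two-dimensional arrays are addressed through \<^const>\<open>prod_encode\<close>, which the table of
  triangular numbers makes computable without multiplication.\<close>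

definition mem :: "st \<Rightarrow> nat \<Rightarrow> ram_state" where
  "mem \<sigma> c = \<lparr>nmem = (\<lambda>a. if a = 0 then m else if a \<le> m then ra \<sigma> (a - 1)
        else na \<sigma> ((a - m - 1) mod 4, (a - m - 1) div 4)),
     rmem = (\<lambda>a. if a < W then inp a else wk \<sigma> ((a - W) mod 8, (a - W) div 8)), clock = c\<rparr>"

definition nv :: "nexp \<Rightarrow> st \<Rightarrow> nat" where "nv e \<sigma> = nval e (mem \<sigma> 0)"
definition rv :: "rexp \<Rightarrow> st \<Rightarrow> real" where "rv e \<sigma> = rval e (mem \<sigma> 0)"
definition bv :: "bexp \<Rightarrow> st \<Rightarrow> bool" where "bv e \<sigma> = bval e (mem \<sigma> 0)"

lemma nval_mem: "nval e (mem \<sigma> c) = nv e \<sigma>"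
  unfolding nv_def by (induction e) (auto simp: mem_def)

lemma rval_mem: "rval e (mem \<sigma> c) = rv e \<sigma>"
  unfolding rv_def by (induction e) (simp_all add: nval_mem, simp add: mem_def)

lemma bval_mem: "bval e (mem \<sigma> c) = bv e \<sigma>"
  unfolding bv_def by (induction e) (simp_all add: nval_mem rval_mem)

lemma nv_simps [simp]:
  "nv (NConst n) \<sigma> = n"
  "nv (NAdd a b) \<sigma> = nv a \<sigma> + nv b \<sigma>"
  "nv (NSub a b) \<sigma> = nv a \<sigma> - nv b \<sigma>"
  "nv cM \<sigma> = m"
  "nv (quad a) \<sigma> = 4 * nv a \<sigma>"
  "nv (na_at r a) \<sigma> = m + 4 * nv a \<sigma> + r + 1"
  by (simp_all add: nv_def cM_def mem_def quad_def na_at_def)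

lemma nv_NA [simp]: "r < 4 \<Longrightarrow> nv (NA r e) \<sigma> = na \<sigma> (r, nv e \<sigma>)"
  using nv_simps(6)[of r e \<sigma>] by (simp add: nv_def NA_def mem_def)

lemma nv_reg [simp]: "nv (reg j) \<sigma> = na \<sigma> (0, j)"
  by (simp add: reg_def)

lemma nv_load_set: "0 < nv e \<sigma> \<Longrightarrow> nv e \<sigma> \<le> m \<Longrightarrow> nv (NLoad e) \<sigma> = ra \<sigma> (nv e \<sigma> - 1)"
  by (simp add: nv_def mem_def)

lemma rv_simps [simp]:
  "rv (ROfNat a) \<sigma> = real (nv a \<sigma>)"
  "rv (RAdd x y) \<sigma> = rv x \<sigma> + rv y \<sigma>"
  "rv (RSub x y) \<sigma> = rv x \<sigma> - rv y \<sigma>"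
  "rv (RMul x y) \<sigma> = rv x \<sigma> * rv y \<sigma>"
  "rv (RDiv x y) \<sigma> = rv x \<sigma> / rv y \<sigma>"
  "rv (RSqrt x) \<sigma> = sqrt (rv x \<sigma>)"
  "rv (RC n) \<sigma> = real n"
  by (simp_all add: rv_def nval_mem RC_def)

lemma rv_input: "nv a \<sigma> < W \<Longrightarrow> rv (RLoad a) \<sigma> = inp (nv a \<sigma>)"
  by (simp add: rv_def nv_def mem_def)

lemma bv_simps [simp]:
  "bv (NLess a b) \<sigma> \<longleftrightarrow> nv a \<sigma> < nv b \<sigma>"
  "bv (RLess x y) \<sigma> \<longleftrightarrow> rv x \<sigma> < rv y \<sigma>"
  "bv (BNot p) \<sigma> \<longleftrightarrow> \<not> bv p \<sigma>"
  "bv (BAnd p q) \<sigma> \<longleftrightarrow> bv p \<sigma> \<and> bv q \<sigma>"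
  by (simp_all add: bv_def nval_mem rval_mem)

lemma nv_wk_at [simp]: "na \<sigma> (0, 0) = W \<Longrightarrow> nv (wk_at r e) \<sigma> = W + 8 * nv e \<sigma> + nv r \<sigma>"
  by (simp add: wk_at_def)

lemma rv_WK [simp]:
  "na \<sigma> (0, 0) = W \<Longrightarrow> nv r \<sigma> < 8 \<Longrightarrow> rv (WK r e) \<sigma> = wk \<sigma> (nv r \<sigma>, nv e \<sigma>)"
  using nv_wk_at[of \<sigma> r e] by (simp add: rv_def WK_def nval_mem) (simp add: mem_def)

lemma rv_rreg [simp]: "na \<sigma> (0, 0) = W \<Longrightarrow> rv (rreg j) \<sigma> = wk \<sigma> (0, j)"
  by (simp add: rreg_def)

text \<open>Uniform in the starting clock and with only an upper bound on the elapsed time, so that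
  times add under composition and can be rounded up. The \<open>return_spmf\<close> says that the
  run surely terminates in one determined state.\<close>

definition ex :: "com \<Rightarrow> st \<Rightarrow> nat \<Rightarrow> st \<Rightarrow> bool" where
  "ex p \<sigma> t \<sigma>' \<longleftrightarrow> (\<forall>c. \<exists>c'\<le>c + t. run p (mem \<sigma> c) = return_spmf (mem \<sigma>' c'))"

lemma tick_mem [simp]: "tick t (mem \<sigma> c) = mem \<sigma> (c + t)"
  by (simp add: tick_def mem_def)

lemma ex_intro:
  assumes "\<And>c. run p (mem \<sigma> c) = return_spmf (mem \<sigma>' (c + k))" "k \<le> t"
  shows "ex p \<sigma> t \<sigma>'"
  unfolding ex_def using assms by (metis add_left_mono)

lemma ex_mono: "ex p \<sigma> t \<sigma>' \<Longrightarrow> t \<le> t' \<Longrightarrow> ex p \<sigma> t' \<sigma>'"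
  unfolding ex_def by (meson add_left_mono order.trans)

lemma ex_Seq: "ex p \<sigma> t \<sigma>' \<Longrightarrow> ex q \<sigma>' t' \<sigma>'' \<Longrightarrow> ex (Seq p q) \<sigma> (t + t') \<sigma>''"
  unfolding ex_def
proof
  fix c
  assume p: "\<forall>c. \<exists>c'\<le>c + t. run p (mem \<sigma> c) = return_spmf (mem \<sigma>' c')"
    and q: "\<forall>c. \<exists>c'\<le>c + t'. run q (mem \<sigma>' c) = return_spmf (mem \<sigma>'' c')"
  from p obtain c1 where c1: "c1 \<le> c + t" "run p (mem \<sigma> c) = return_spmf (mem \<sigma>' c1)" by blast
  from q obtain c2 where "c2 \<le> c1 + t'" "run q (mem \<sigma>' c1) = return_spmf (mem \<sigma>'' c2)" by blast
  with c1 show "\<exists>c'\<le>c + (t + t'). run (Seq p q) (mem \<sigma> c) = return_spmf (mem \<sigma>'' c')"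
    by (intro exI[of _ c2]) auto
qed

lemma ex_Cond:
  assumes "bcost b < unit_cost"
    and "bv b \<sigma> \<Longrightarrow> ex p \<sigma> t \<sigma>'" "\<not> bv b \<sigma> \<Longrightarrow> ex q \<sigma> t \<sigma>'"
  shows "ex (Cond b p q) \<sigma> (t + unit_cost) \<sigma>'"
proof -
  have "\<exists>c'\<le>c + (t + unit_cost). run (Cond b p q) (mem \<sigma> c) = return_spmf (mem \<sigma>' c')" for c
  proof -
    have "\<exists>c'\<le>(c + (bcost b + 1)) + t. run (Cond b p q) (mem \<sigma> c) = return_spmf (mem \<sigma>' c')"
      using assms(2,3)[unfolded ex_def, rule_format, of "c + (bcost b + 1)"]
      by (cases "bv b \<sigma>") (simp_all add: bval_mem)
    then obtain c' where "c' \<le> c + (bcost b + 1) + t" "run (Cond b p q) (mem \<sigma> c) = return_spmf (mem \<sigma>' c')"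
      by blast
    then show ?thesis using assms(1) by (intro exI[of _ c'] conjI) linarith+
  qed
  then show ?thesis by (auto simp: ex_def)
qed

lemma ex_While_done:
  assumes "bcost b < unit_cost" "\<not> bv b \<sigma>"
  shows "ex (While b p) \<sigma> unit_cost \<sigma>"
  using assms by (intro ex_intro[where k = "bcost b + 1"]) (auto simp: bval_mem while_loop.simps[of b])

lemma ex_While_step:
  assumes "bcost b < unit_cost" "bv b \<sigma>" "ex p \<sigma> t \<sigma>'" "ex (While b p) \<sigma>' t' \<sigma>''"
  shows "ex (While b p) \<sigma> (unit_cost + t + t') \<sigma>''"
proof -
  have "\<exists>c'\<le>c + (unit_cost + t + t'). run (While b p) (mem \<sigma> c) = return_spmf (mem \<sigma>'' c')" for c
  proof -
    obtain c1 where c1: "c1 \<le> (c + (bcost b + 1)) + t"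
      "run p (mem \<sigma> (c + (bcost b + 1))) = return_spmf (mem \<sigma>' c1)"
      using assms(3) unfolding ex_def by blast
    obtain c2 where c2: "c2 \<le> c1 + t'" "run (While b p) (mem \<sigma>' c1) = return_spmf (mem \<sigma>'' c2)"
      using assms(4) unfolding ex_def by blast
    have "run (While b p) (mem \<sigma> c) = return_spmf (mem \<sigma>'' c2)"
      using assms(2) c1(2) c2(2) by (simp add: bval_mem while_loop.simps[of b _ "mem \<sigma> c"])
    then show ?thesis using c1 c2 assms(1) by (intro exI[of _ c2]) auto
  qed
  then show ?thesis by (auto simp: ex_def)
qed

lemma ex_setN:
  assumes "r < 4" "ncost (na_at r e) + ncost x < unit_cost"
  shows "ex (setN r e x) \<sigma> unit_cost (\<sigma>\<lparr>na := (na \<sigma>)((r, nv e \<sigma>) := nv x \<sigma>)\<rparr>)"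
proof -
  let ?a = "m + 4 * nv e \<sigma> + r + 1"
  have "nwrite ?a (nv x \<sigma>) (mem \<sigma> c) = mem (\<sigma>\<lparr>na := (na \<sigma>)((r, nv e \<sigma>) := nv x \<sigma>)\<rparr>) c" for c
  proof -
    have "a = ?a" if "m < a" "(a - m - 1) mod 4 = r" "(a - m - 1) div 4 = nv e \<sigma>" for a
      using that div_mult_mod_eq[of "a - m - 1" 4] by linarith
    then show ?thesis using assms(1) by (auto simp: nwrite_def mem_def fun_eq_iff)
  qed
  then show ?thesis
    using assms(2) by (intro ex_intro[where k = "ncost (na_at r e) + ncost x + 1"])
      (auto simp: setN_def nval_mem)
qed

lemma ex_setW:
  assumes "na \<sigma> (0, 0) = W" "nv r \<sigma> < 8" "ncost (wk_at r e) + rcost x < unit_cost"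
  shows "ex (setW r e x) \<sigma> unit_cost (\<sigma>\<lparr>wk := (wk \<sigma>)((nv r \<sigma>, nv e \<sigma>) := rv x \<sigma>)\<rparr>)"
proof -
  let ?a = "W + 8 * nv e \<sigma> + nv r \<sigma>"
  have "rwrite ?a (rv x \<sigma>) (mem \<sigma> c) = mem (\<sigma>\<lparr>wk := (wk \<sigma>)((nv r \<sigma>, nv e \<sigma>) := rv x \<sigma>)\<rparr>) c" for c
  proof -
    have "a = ?a" if "\<not> a < W" "(a - W) mod 8 = nv r \<sigma>" "(a - W) div 8 = nv e \<sigma>" for a
      using that div_mult_mod_eq[of "a - W" 8] by linarith
    then show ?thesis using assms(2) by (auto simp: rwrite_def mem_def fun_eq_iff)
  qed
  then show ?thesis
    using assms(1,3) by (intro ex_intro[where k = "ncost (wk_at r e) + rcost x + 1"])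
      (auto simp: setW_def nval_mem rval_mem)
qed

lemma ex_setS:
  assumes "nv i \<sigma> < m" "ncost i + ncost x + 5 < unit_cost"
  shows "ex (setS i x) \<sigma> unit_cost (\<sigma>\<lparr>ra := (ra \<sigma>)(nv i \<sigma> := nv x \<sigma>)\<rparr>)"
proof -
  have "nwrite (nv i \<sigma> + 1) (nv x \<sigma>) (mem \<sigma> c) = mem (\<sigma>\<lparr>ra := (ra \<sigma>)(nv i \<sigma> := nv x \<sigma>)\<rparr>) c" for c
    using assms(1) by (auto simp: nwrite_def mem_def fun_eq_iff)
  then show ?thesis
    using assms(2) by (intro ex_intro[where k = "Suc (Suc (Suc (ncost i + ncost x)))"]) (auto simp: setS_def nval_mem)
qed

text \<open>The invariant is required of the state in which the counter already has its new value.
  The body must leave the counter as it found it; the bound is evaluated anew in every round, hence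
  the condition on \<open>bnd\<close>.\<close>

lemma ex_For:
  assumes I0: "I 0 (\<sigma>\<lparr>na := (na \<sigma>)((0, j) := 0)\<rparr>)"
    and step: "\<And>i \<sigma>. i < n \<Longrightarrow> I i \<sigma> \<Longrightarrow> na \<sigma> (0, j) = i \<Longrightarrow>
      \<exists>\<sigma>'. ex body \<sigma> T \<sigma>' \<and> na \<sigma>' (0, j) = i \<and> I (Suc i) (\<sigma>'\<lparr>na := (na \<sigma>')((0, j) := Suc i)\<rparr>)"
    and bnd: "\<And>i \<sigma>. i \<le> n \<Longrightarrow> I i \<sigma> \<Longrightarrow> nv bnd \<sigma> = n"
    and cost: "ncost bnd < 1000"
  shows "\<exists>\<sigma>'. ex (For j bnd body) \<sigma> ((n + 2) * (T + 2 * unit_cost)) \<sigma>' \<and> I n \<sigma>' \<and> na \<sigma>' (0, j) = n"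
proof -
  let ?b = "NLess (reg j) bnd" and ?inc = "setN 0 (NConst j) (NAdd (reg j) (NConst 1))"
  have b: "bcost ?b < unit_cost" using cost by (simp add: unit_cost_def)
  have loop: "\<exists>\<sigma>'. ex (While ?b (Seq body ?inc)) \<sigma> (k * (T + 2 * unit_cost) + unit_cost) \<sigma>' \<and> I n \<sigma>' \<and> na \<sigma>' (0, j) = n"
    if "I i \<sigma>" "na \<sigma> (0, j) = i" "i + k = n" for i k \<sigma>
    using that
  proof (induction k arbitrary: i \<sigma>)
    case 0
    then have "\<not> bv ?b \<sigma>" using bnd[of i \<sigma>] by simp
    from ex_While_done[OF b this] show ?case using 0 by auto
  next
    case (Suc k)
    then have i: "i < n" by simp
    from step[OF i Suc.prems(1,2)] obtain \<sigma>1 where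
      1: "ex body \<sigma> T \<sigma>1" "na \<sigma>1 (0, j) = i" "I (Suc i) (\<sigma>1\<lparr>na := (na \<sigma>1)((0, j) := Suc i)\<rparr>)" by blast
    let ?s = "\<sigma>1\<lparr>na := (na \<sigma>1)((0, j) := Suc i)\<rparr>"
    have "ex ?inc \<sigma>1 unit_cost (\<sigma>1\<lparr>na := (na \<sigma>1)((0, nv (NConst j) \<sigma>1) := nv (NAdd (reg j) (NConst 1)) \<sigma>1)\<rparr>)"
      by (rule ex_setN) (simp_all add: unit_cost_def)
    then have "ex ?inc \<sigma>1 unit_cost ?s" using 1(2) by simp
    with 1(1) have body: "ex (Seq body ?inc) \<sigma> (T + unit_cost) ?s" by (rule ex_Seq)
    from Suc.IH[of "Suc i" ?s] 1(3) Suc.prems(3) obtain \<sigma>' where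
      2: "ex (While ?b (Seq body ?inc)) ?s (k * (T + 2 * unit_cost) + unit_cost) \<sigma>'" "I n \<sigma>'" "na \<sigma>' (0, j) = n"
      by auto
    have "bv ?b \<sigma>" using bnd[of i \<sigma>] Suc.prems i by simp
    from ex_While_step[OF b this body 2(1)] show ?case
      using 2 by (intro exI[of _ \<sigma>']) (auto elim!: ex_mono)
  qed
  have "ex (setN 0 (NConst j) (NConst 0)) \<sigma> unit_cost (\<sigma>\<lparr>na := (na \<sigma>)((0, nv (NConst j) \<sigma>) := nv (NConst 0) \<sigma>)\<rparr>)"
    by (rule ex_setN) (simp_all add: unit_cost_def)
  then have 0: "ex (setN 0 (NConst j) (NConst 0)) \<sigma> unit_cost (\<sigma>\<lparr>na := (na \<sigma>)((0, j) := 0)\<rparr>)" by simp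
  from loop[OF I0, of n] obtain \<sigma>' where
    "ex (While ?b (Seq body ?inc)) (\<sigma>\<lparr>na := (na \<sigma>)((0, j) := 0)\<rparr>) (n * (T + 2 * unit_cost) + unit_cost) \<sigma>'"
    "I n \<sigma>'" "na \<sigma>' (0, j) = n" by auto
  with ex_Seq[OF 0 this(1)] show ?thesis
    unfolding For_def by (intro exI[of _ \<sigma>']) (auto elim!: ex_mono)
qed

definition frame :: "(nat \<times> nat) set \<Rightarrow> (nat \<times> nat) set \<Rightarrow> st \<Rightarrow> st \<Rightarrow> bool" where
  "frame A B \<sigma> \<sigma>' \<longleftrightarrow> ra \<sigma>' = ra \<sigma> \<and> (\<forall>p. p \<notin> A \<longrightarrow> na \<sigma>' p = na \<sigma> p) \<and> (\<forall>p. p \<notin> B \<longrightarrow> wk \<sigma>' p = wk \<sigma> p)"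

text \<open>Indices up to 2 m, because the code of a pair (j, l) with both entries at most
  \<open>m\<close> looks up entry j + l.\<close>

definition tables :: "st \<Rightarrow> bool" where
  "tables \<sigma> \<longleftrightarrow> na \<sigma> (0, 0) = W \<and> na \<sigma> (0, 1) = d \<and> (\<forall>k\<le>2 * m. na \<sigma> (2, k) = triangle k)"

lemma nv_enc2:
  "tables \<sigma> \<Longrightarrow> nv j \<sigma> \<le> m \<Longrightarrow> nv l \<sigma> \<le> m \<Longrightarrow> nv (enc2 j l) \<sigma> = prod_encode (nv j \<sigma>, nv l \<sigma>)"
  by (simp add: enc2_def tables_def prod_encode_def)

lemma tables_frame:
  "tables \<sigma> \<Longrightarrow> frame A B \<sigma> \<sigma>' \<Longrightarrow> A \<inter> ({(0, 0), (0, 1)} \<union> {2} \<times> UNIV) = {} \<Longrightarrow> tables \<sigma>'"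
  unfolding tables_def frame_def by (smt (verit, best) Int_iff Un_iff SigmaI UNIV_I empty_iff insertCI)

end

section \<open>The decoder as a program\<close>

text \<open>Natural registers: 0 base of the real workspace, 1 \<open>d\<close>, 2 to 5 loop counters, 6 bound on the
  number of set bits, 7 number of bits, 8 number of set bits, 9 position, 10 test passed, 11 number
  of a kernel, 12 exhaustive mode, 13 side, 14 vector is stored, 15 result (1 found, 2 none).
  Real registers: 0 \<open>\<rho>\<close>, 1 \<open>\<delta>\<close>, 2 \<open>\<delta> \<rho>\<close>, 3 \<open>\<mu>\<close>, 4 bound on the gain, 5 accumulator, 6 coefficient,
  7 update factor, 8 power of \<open>1 + \<delta>\<^sup>2\<close>.\<close>

definition kk :: nexp where "kk = NAdd (NConst 3) (reg 11)"

text \<open>Column \<open>i\<close> is copied to a separate vector, and c / (1 + c K_ii) to a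
  register, since the double loop overwrites the entries from which both are taken.\<close>

definition update_com :: com where
  "update_com = Seq
     (setW (NConst 0) (NConst 7)
        (RDiv (rreg 6) (RAdd (RC 1) (RMul (rreg 6) (WK kk (enc2 (reg 2) (reg 2)))))))
     (Seq (For 3 cM (setW (NConst 1) (reg 3) (WK kk (enc2 (reg 3) (reg 2)))))
        (For 3 cM (For 4 cM (setW kk (enc2 (reg 3) (reg 4))
           (RSub (WK kk (enc2 (reg 3) (reg 4)))
              (RMul (rreg 7) (RMul (WK (NConst 1) (reg 3)) (WK (NConst 1) (reg 4)))))))))"

context ram
begin

lemma frame_refl [simp]: "frame A B \<sigma> \<sigma>"
  by (simp add: frame_def)

lemma frame_trans: "frame A B \<sigma> \<sigma>' \<Longrightarrow> frame A' B' \<sigma>' \<sigma>'' \<Longrightarrow> A \<union> A' \<subseteq> A'' \<Longrightarrow> B \<union> B' \<subseteq> B'' \<Longrightarrow> frame A'' B'' \<sigma> \<sigma>''"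
  unfolding frame_def by (metis Un_iff subset_iff)

lemma frame_na: "frame A B \<sigma> \<sigma>' \<Longrightarrow> p \<notin> A \<Longrightarrow> na \<sigma>' p = na \<sigma> p"
  unfolding frame_def by blast

lemma frame_wk: "frame A B \<sigma> \<sigma>' \<Longrightarrow> p \<notin> B \<Longrightarrow> wk \<sigma>' p = wk \<sigma> p"
  unfolding frame_def by blast

lemma frame_upd_na: "frame A B \<sigma> \<sigma>' \<Longrightarrow> p \<in> A \<Longrightarrow> frame A B \<sigma> (\<sigma>'\<lparr>na := (na \<sigma>')(p := x)\<rparr>)"
  by (auto simp: frame_def)

lemma frame_upd_wk: "frame A B \<sigma> \<sigma>' \<Longrightarrow> p \<in> B \<Longrightarrow> frame A B \<sigma> (\<sigma>'\<lparr>wk := (wk \<sigma>')(p := x)\<rparr>)"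
  by (auto simp: frame_def)

lemma tables_W: "tables \<sigma> \<Longrightarrow> na \<sigma> (0, 0) = W"
  by (simp add: tables_def)

abbreviation kmat :: "st \<Rightarrow> nat \<Rightarrow> nat \<Rightarrow> nat \<Rightarrow> real" where
  "kmat \<sigma> k j l \<equiv> wk \<sigma> (3 + k, prod_encode (j, l))"

lemma power_mono_M: "k \<le> n \<Longrightarrow> (m + 2) ^ k \<le> (m + 2) ^ n"
  by (rule power_increasing) simp_all

lemma update_correct:
  assumes tab: "tables \<sigma>" and i: "na \<sigma> (0, 2) = i" "i < m" and k: "na \<sigma> (0, 11) = k" "k < 4"
    and c: "wk \<sigma> (0, 6) = c"
  shows "\<exists>\<sigma>'. ex update_com \<sigma> (9 * unit_cost * (m + 2)\<^sup>2) \<sigma>' \<and>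
    frame {(0, 3), (0, 4)} ({(0, 7)} \<union> {1} \<times> UNIV \<union> {3 + k} \<times> UNIV) \<sigma> \<sigma>' \<and>
    (\<forall>j<m. \<forall>l<m. kmat \<sigma>' k j l = rank_one_update (kmat \<sigma> k) i c j l)"
proof -
  let ?u = unit_cost and ?R = "{3 + k} \<times> (UNIV :: nat set)" and ?Y = "{1} \<times> (UNIV :: nat set)"
  have W: "na \<sigma> (0, 0) = W" using tab by (rule tables_W)
  define g where "g = c / (1 + c * kmat \<sigma> k i i)"
  define \<sigma>1 where "\<sigma>1 = \<sigma>\<lparr>wk := (wk \<sigma>)((0, 7) := g)\<rparr>"
  have p1: "ex (setW (NConst 0) (NConst 7)
        (RDiv (rreg 6) (RAdd (RC 1) (RMul (rreg 6) (WK kk (enc2 (reg 2) (reg 2))))))) \<sigma> ?u \<sigma>1"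
    (is "ex (setW _ _ ?x) _ _ _")
  proof -
    have "rv ?x \<sigma> = g" using W i k c tab by (simp add: kk_def nv_enc2 g_def)
    moreover have "ex (setW (NConst 0) (NConst 7) ?x) \<sigma> ?u
        (\<sigma>\<lparr>wk := (wk \<sigma>)((nv (NConst 0) \<sigma>, nv (NConst 7) \<sigma>) := rv ?x \<sigma>)\<rparr>)"
      by (rule ex_setW[OF W]) (simp_all add: unit_cost_def kk_def)
    ultimately show ?thesis by (simp add: \<sigma>1_def)
  qed
  have f1: "frame {} {(0, 7)} \<sigma> \<sigma>1" by (simp add: frame_def \<sigma>1_def)
  have t1: "tables \<sigma>1" using tab by (simp add: tables_def \<sigma>1_def)
  have K1: "kmat \<sigma>1 k = kmat \<sigma> k" by (simp add: \<sigma>1_def fun_eq_iff)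
  define I where "I n \<tau> \<longleftrightarrow> frame {(0, 3)} ?Y \<sigma>1 \<tau> \<and> (\<forall>j<n. wk \<tau> (1, j) = kmat \<sigma> k j i)" for n \<tau>
  have "\<exists>\<sigma>2. ex (For 3 cM (setW (NConst 1) (reg 3) (WK kk (enc2 (reg 3) (reg 2))))) \<sigma>1 ((m + 2) * (?u + 2 * ?u)) \<sigma>2
    \<and> I m \<sigma>2 \<and> na \<sigma>2 (0, 3) = m"
  proof (rule ex_For)
    show "I 0 (\<sigma>1\<lparr>na := (na \<sigma>1)((0, 3) := 0)\<rparr>)" by (simp add: I_def frame_upd_na)
    show "nv cM \<tau> = m" for \<tau> by simp
    show "ncost cM < 1000" by simp
    fix j \<tau> assume j: "j < m" and I: "I j \<tau>" and r: "na \<tau> (0, 3) = j"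
    have fr: "frame {(0, 3)} ?Y \<sigma>1 \<tau>" using I by (simp add: I_def)
    have t: "tables \<tau>" by (rule tables_frame[OF t1 fr]) auto
    have r2: "na \<tau> (0, 2) = i" "na \<tau> (0, 11) = k" using frame_na[OF fr] i k by (auto simp: \<sigma>1_def)
    have v: "rv (WK kk (enc2 (reg 3) (reg 2))) \<tau> = kmat \<sigma> k j i"
      using r r2 t j i(2) k(2) tables_W[OF t] frame_wk[OF fr] K1[THEN fun_cong, THEN fun_cong, of j i]
      by (simp add: kk_def nv_enc2)
    have "ex (setW (NConst 1) (reg 3) (WK kk (enc2 (reg 3) (reg 2)))) \<tau> ?u
      (\<tau>\<lparr>wk := (wk \<tau>)((nv (NConst 1) \<tau>, nv (reg 3) \<tau>) := rv (WK kk (enc2 (reg 3) (reg 2))) \<tau>)\<rparr>)"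
      by (rule ex_setW[OF tables_W[OF t]]) (simp_all add: unit_cost_def kk_def)
    then have "ex (setW (NConst 1) (reg 3) (WK kk (enc2 (reg 3) (reg 2)))) \<tau> ?u
      (\<tau>\<lparr>wk := (wk \<tau>)((1, j) := kmat \<sigma> k j i)\<rparr>)" unfolding v by (simp add: r)
    moreover have "I (Suc j) (\<tau>\<lparr>wk := (wk \<tau>)((1, j) := kmat \<sigma> k j i), na := (na \<tau>)((0, 3) := Suc j)\<rparr>)"
      using I by (auto simp: I_def less_Suc_eq frame_def)
    ultimately show "\<exists>\<sigma>'. ex (setW (NConst 1) (reg 3) (WK kk (enc2 (reg 3) (reg 2)))) \<tau> ?u \<sigma>' \<and>
      na \<sigma>' (0, 3) = j \<and> I (Suc j) (\<sigma>'\<lparr>na := (na \<sigma>')((0, 3) := Suc j)\<rparr>)"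
      using r by (intro exI[of _ "\<tau>\<lparr>wk := (wk \<tau>)((1, j) := kmat \<sigma> k j i)\<rparr>"]) simp
  qed
  then obtain \<sigma>2 where p2: "ex (For 3 cM (setW (NConst 1) (reg 3) (WK kk (enc2 (reg 3) (reg 2))))) \<sigma>1 ((m + 2) * (?u + 2 * ?u)) \<sigma>2"
    and f2: "frame {(0, 3)} ?Y \<sigma>1 \<sigma>2" and y2: "\<And>j. j < m \<Longrightarrow> wk \<sigma>2 (1, j) = kmat \<sigma> k j i"
    unfolding I_def by auto
  have t2: "tables \<sigma>2" by (rule tables_frame[OF t1 f2]) auto
  have K2: "kmat \<sigma>2 k = kmat \<sigma> k" using frame_wk[OF f2] K1 by (simp add: fun_eq_iff)
  have g2: "wk \<sigma>2 (0, 7) = g" "na \<sigma>2 (0, 11) = k" using frame_wk[OF f2] frame_na[OF f2] k by (auto simp: \<sigma>1_def)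
  define new where "new = rank_one_update (kmat \<sigma> k) i c"
  define A where "A = {(0 :: nat, 3 :: nat), (0, 4)}"
  \<comment> \<open>Entries not yet visited are still the old ones: each new entry is formed from
    its own old value and the saved column.\<close>
  define J where "J j \<tau> \<longleftrightarrow> frame A ?R \<sigma>2 \<tau> \<and> (\<forall>a b. kmat \<tau> k a b = (if a < j \<and> b < m then new a b else kmat \<sigma> k a b))" for j \<tau>
  define J' where "J' j l \<tau> \<longleftrightarrow> frame A ?R \<sigma>2 \<tau> \<and> na \<tau> (0, 3) = j \<and>
    (\<forall>a b. kmat \<tau> k a b = (if a < j \<and> b < m \<or> a = j \<and> b < l then new a b else kmat \<sigma> k a b))" for j l \<tau>
  let ?p = "setW kk (enc2 (reg 3) (reg 4))
           (RSub (WK kk (enc2 (reg 3) (reg 4)))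
              (RMul (rreg 7) (RMul (WK (NConst 1) (reg 3)) (WK (NConst 1) (reg 4)))))"
  have inner: "\<exists>\<sigma>'. ex (For 4 cM ?p) \<tau> ((m + 2) * (?u + 2 * ?u)) \<sigma>' \<and> J' j m \<sigma>' \<and> na \<sigma>' (0, 4) = m"
    if j: "j < m" and J: "J j \<tau>" and r: "na \<tau> (0, 3) = j" for j \<tau>
  proof (rule ex_For)
    show "J' j 0 (\<tau>\<lparr>na := (na \<tau>)((0, 4) := 0)\<rparr>)" using J r by (auto simp: J_def J'_def A_def intro: frame_upd_na)
    show "nv cM \<tau> = m" for \<tau> by simp
    show "ncost cM < 1000" by simp
    fix l \<tau> assume l: "l < m" and J': "J' j l \<tau>" and rl: "na \<tau> (0, 4) = l"
    have fr: "frame A ?R \<sigma>2 \<tau>" and r: "na \<tau> (0, 3) = j" using J' by (simp_all add: J'_def)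
    have t: "tables \<tau>" by (rule tables_frame[OF t2 fr]) (auto simp: A_def)
    have rk: "na \<tau> (0, 11) = k" "wk \<tau> (0, 7) = g" "\<And>j. j < m \<Longrightarrow> wk \<tau> (1, j) = kmat \<sigma> k j i"
      using frame_na[OF fr, of "(0, 11)"] frame_wk[OF fr] g2 y2 by (auto simp: A_def)
    have e: "nv (enc2 (reg 3) (reg 4)) \<tau> = prod_encode (j, l)" using t r rl j l by (simp add: nv_enc2)
    have old: "kmat \<tau> k j l = kmat \<sigma> k j l" using J' by (simp add: J'_def)
    have v: "rv (RSub (WK kk (enc2 (reg 3) (reg 4)))
              (RMul (rreg 7) (RMul (WK (NConst 1) (reg 3)) (WK (NConst 1) (reg 4))))) \<tau> = new j l"
      using r rl rk t j l k(2) tables_W[OF t] old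
      by (simp add: kk_def e new_def rank_one_update_def g_def)
    have "ex ?p \<tau> ?u (\<tau>\<lparr>wk := (wk \<tau>)((nv kk \<tau>, nv (enc2 (reg 3) (reg 4)) \<tau>) :=
       rv (RSub (WK kk (enc2 (reg 3) (reg 4)))
              (RMul (rreg 7) (RMul (WK (NConst 1) (reg 3)) (WK (NConst 1) (reg 4))))) \<tau>)\<rparr>)"
      using k(2) rk by (intro ex_setW[OF tables_W[OF t]]) (simp_all add: unit_cost_def kk_def)
    then have "ex ?p \<tau> ?u (\<tau>\<lparr>wk := (wk \<tau>)((3 + k, prod_encode (j, l)) := new j l)\<rparr>)"
      unfolding v e using rk by (simp add: kk_def)
    moreover have "J' j (Suc l) (\<tau>\<lparr>wk := (wk \<tau>)((3 + k, prod_encode (j, l)) := new j l), na := (na \<tau>)((0, 4) := Suc l)\<rparr>)"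
      using J' by (auto simp: J'_def A_def frame_def less_Suc_eq)
    ultimately show "\<exists>\<sigma>'. ex ?p \<tau> ?u \<sigma>' \<and> na \<sigma>' (0, 4) = l \<and> J' j (Suc l) (\<sigma>'\<lparr>na := (na \<sigma>')((0, 4) := Suc l)\<rparr>)"
      using rl by (intro exI[of _ "\<tau>\<lparr>wk := (wk \<tau>)((3 + k, prod_encode (j, l)) := new j l)\<rparr>"]) simp
  qed
  have "\<exists>\<sigma>'. ex (For 3 cM (For 4 cM ?p)) \<sigma>2 ((m + 2) * ((m + 2) * (?u + 2 * ?u) + 2 * ?u)) \<sigma>' \<and> J m \<sigma>' \<and> na \<sigma>' (0, 3) = m"
  proof (rule ex_For)
    show "J 0 (\<sigma>2\<lparr>na := (na \<sigma>2)((0, 3) := 0)\<rparr>)" using K2 by (simp add: J_def A_def frame_upd_na fun_eq_iff)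
    show "nv cM \<tau> = m" for \<tau> by simp
    show "ncost cM < 1000" by simp
    fix j \<tau> assume "j < m" "J j \<tau>" "na \<tau> (0, 3) = j"
    from inner[OF this] obtain \<sigma>' where s: "ex (For 4 cM ?p) \<tau> ((m + 2) * (?u + 2 * ?u)) \<sigma>'" "J' j m \<sigma>'" by blast
    then have "J (Suc j) (\<sigma>'\<lparr>na := (na \<sigma>')((0, 3) := Suc j)\<rparr>)"
      by (auto simp: J_def J'_def A_def less_Suc_eq intro: frame_upd_na)
    with s show "\<exists>\<sigma>'. ex (For 4 cM ?p) \<tau> ((m + 2) * (?u + 2 * ?u)) \<sigma>' \<and> na \<sigma>' (0, 3) = j \<and> J (Suc j) (\<sigma>'\<lparr>na := (na \<sigma>')((0, 3) := Suc j)\<rparr>)"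
      by (auto simp: J'_def)
  qed
  then obtain \<sigma>3 where p3: "ex (For 3 cM (For 4 cM ?p)) \<sigma>2 ((m + 2) * ((m + 2) * (?u + 2 * ?u) + 2 * ?u)) \<sigma>3" "J m \<sigma>3"
    by blast
  have "ex update_com \<sigma> (?u + ((m + 2) * (?u + 2 * ?u) + (m + 2) * ((m + 2) * (?u + 2 * ?u) + 2 * ?u))) \<sigma>3"
    unfolding update_com_def by (rule ex_Seq[OF p1 ex_Seq[OF p2 p3(1)]])
  moreover have "?u + ((m + 2) * (?u + 2 * ?u) + (m + 2) * ((m + 2) * (?u + 2 * ?u) + 2 * ?u)) \<le> 9 * ?u * (m + 2)\<^sup>2"
    by (simp add: power2_eq_square algebra_simps)
  ultimately have "ex update_com \<sigma> (9 * unit_cost * (m + 2)\<^sup>2) \<sigma>3" by (rule ex_mono)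
  moreover have "frame {(0, 3), (0, 4)} ({(0, 7)} \<union> ?Y \<union> ?R) \<sigma> \<sigma>3"
    using p3(2) unfolding J_def A_def
    by (intro frame_trans[OF frame_trans[OF f1 f2 order.refl order.refl]]) auto
  moreover have "\<forall>j<m. \<forall>l<m. kmat \<sigma>3 k j l = rank_one_update (kmat \<sigma> k) i c j l"
    using p3(2) by (simp add: J_def new_def)
  ultimately show ?thesis by blast
qed

end

definition setreg :: "nat \<Rightarrow> nexp \<Rightarrow> com" where "setreg j e = setN 0 (NConst j) e"
definition setrreg :: "nat \<Rightarrow> rexp \<Rightarrow> com" where "setrreg j x = setW (NConst 0) (NConst j) x"

definition kdiag :: "nexp \<Rightarrow> rexp" where "kdiag k = WK (NAdd (NConst 3) k) (enc2 (reg 2) (reg 2))"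

definition side_com :: com where
  "side_com = Cond (NLess (NConst 0) (NA 1 (reg 2)))
     (Seq (setreg 13 (NConst 0)) (setreg 14 (NConst 1)))
     (Cond (NLess (NConst 0) (NAdd (NA 1 (NAdd cM (reg 2))) (reg 12)))
        (Seq (setreg 13 (NConst 1)) (setreg 14 (NConst 1)))
        (Seq (setreg 14 (NConst 0))
           (Cond (RLess (kdiag (NConst 0)) (kdiag (NConst 1)))
              (setreg 13 (NConst 1)) (setreg 13 (NConst 0)))))"

definition coeff_com :: com where
  "coeff_com = Seq (setreg 11 (reg 13))
     (Cond (NLess (NConst 0) (reg 14))
        (Cond (RLess (kdiag (reg 11)) (rreg 1))
           (setrreg 6 (RSub (RC 1) (RMul (RSub (RC 1) (rreg 1)) (RDiv (rreg 1) (kdiag (reg 11))))))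
           (setrreg 6 (RSub (RC 1) (RMul (RSub (RC 1) (rreg 1)) (RC 1)))))
        (setrreg 6 (RC 1)))"

text \<open>Writing \<open>1 - side\<close> makes the class of side 0 the output. The test precedes
  the subtraction, since the pivot of a vector is taken in the matrix without it.
  \<open>Cond\<close> has two branches, so a passed test writes to the scratch register 14.\<close>

definition step_com :: com where
  "step_com = Seq side_com (Seq coeff_com (Seq (setS (reg 2) (NSub (NConst 1) (reg 13)))
     (Seq update_com (Seq (setreg 11 (NAdd (reg 13) (NConst 2)))
     (Seq (Cond (RLess (kdiag (reg 11)) (RC 1)) (setreg 14 (NConst 0)) (setreg 10 (NConst 0)))
     (Seq (setrreg 6 (RSub (RC 0) (RC 1))) update_com))))))"

definition init_com :: com where
  "init_com =
     Seq (setW (NConst 3) (enc2 (reg 3) (reg 4)) (RDiv (WK (NConst 2) (enc2 (reg 3) (reg 4))) (rreg 2)))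
    (Seq (setW (NConst 4) (enc2 (reg 3) (reg 4)) (RDiv (WK (NConst 2) (enc2 (reg 3) (reg 4))) (rreg 2)))
    (Seq (setW (NConst 5) (enc2 (reg 3) (reg 4)) (RDiv (WK (NConst 2) (enc2 (reg 3) (reg 4))) (rreg 3)))
         (setW (NConst 6) (enc2 (reg 3) (reg 4)) (RDiv (WK (NConst 2) (enc2 (reg 3) (reg 4))) (rreg 3)))))"

definition decode_com :: com where
  "decode_com = Seq (For 3 cM (For 4 cM init_com)) (Seq (setreg 10 (NConst 1)) (For 2 cM step_com))"

context ram
begin

lemma ex_setreg: "ncost e < 10000 \<Longrightarrow> ex (setreg j e) \<sigma> unit_cost (\<sigma>\<lparr>na := (na \<sigma>)((0, j) := nv e \<sigma>)\<rparr>)"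
  using ex_setN[of 0 "NConst j" e \<sigma>] by (simp add: setreg_def unit_cost_def)

lemma ex_setrreg:
  "na \<sigma> (0, 0) = W \<Longrightarrow> rcost x < 15000 \<Longrightarrow> ex (setrreg j x) \<sigma> unit_cost (\<sigma>\<lparr>wk := (wk \<sigma>)((0, j) := rv x \<sigma>)\<rparr>)"
  using ex_setW[of \<sigma> "NConst 0" "NConst j" x] by (simp add: setrreg_def unit_cost_def)

lemma ex_eq: "ex p \<sigma> t \<sigma>' \<Longrightarrow> \<sigma>' = \<sigma>'' \<Longrightarrow> t \<le> t' \<Longrightarrow> ex p \<sigma> t' \<sigma>''"
  using ex_mono by blast

lemma ex_Cond_True:
  "bv b \<sigma> \<Longrightarrow> bcost b < unit_cost \<Longrightarrow> ex p \<sigma> t \<sigma>' \<Longrightarrow> ex (Cond b p q) \<sigma> (t + unit_cost) \<sigma>'"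
  by (rule ex_Cond) auto

lemma ex_Cond_False:
  "\<not> bv b \<sigma> \<Longrightarrow> bcost b < unit_cost \<Longrightarrow> ex q \<sigma> t \<sigma>' \<Longrightarrow> ex (Cond b p q) \<sigma> (t + unit_cost) \<sigma>'"
  by (rule ex_Cond) auto

lemma rv_kdiag:
  assumes "tables \<sigma>" "na \<sigma> (0, 2) < m" "nv k \<sigma> < 4"
  shows "rv (kdiag k) \<sigma> = kmat \<sigma> (nv k \<sigma>) (na \<sigma> (0, 2)) (na \<sigma> (0, 2))"
  using assms tables_W[OF assms(1)] by (simp add: kdiag_def nv_enc2)

definition symbol :: "st \<Rightarrow> nat \<Rightarrow> nat" where
  "symbol \<sigma> i = (if 0 < na \<sigma> (1, i) then 1 else if 0 < na \<sigma> (1, m + i) + na \<sigma> (0, 12) then 2 else 0)"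

definition agree :: "st \<Rightarrow> (nat \<Rightarrow> nat \<Rightarrow> nat \<Rightarrow> real) \<Rightarrow> bool" where
  "agree \<sigma> K \<longleftrightarrow> (\<forall>k<4. \<forall>j<m. \<forall>l<m. kmat \<sigma> k j l = K k j l)"

lemma side_correct:
  assumes tab: "tables \<sigma>" and i: "na \<sigma> (0, 2) = i" "i < m" and ag: "agree \<sigma> K" and b: "b i = symbol \<sigma> i"
  shows "ex side_com \<sigma> (6 * unit_cost)
    (\<sigma>\<lparr>na := (na \<sigma>)((0, 14) := of_bool (b i \<noteq> 0), (0, 13) := dec_side b i K)\<rparr>)"
proof -
  let ?u = unit_cost
  have c: "bcost (NLess (NConst 0) (NA 1 (reg 2))) < ?u"
    "bcost (NLess (NConst 0) (NAdd (NA 1 (NAdd cM (reg 2))) (reg 12))) < ?u"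
    "bcost (RLess (kdiag (NConst 0)) (kdiag (NConst 1))) < ?u"
    by (simp_all add: unit_cost_def kdiag_def)
  have n: "ncost (NConst x) < 10000" for x by simp
  consider (one) "0 < na \<sigma> (1, i)" | (two) "\<not> 0 < na \<sigma> (1, i)" "0 < na \<sigma> (1, m + i) + na \<sigma> (0, 12)"
    | (zero) "\<not> 0 < na \<sigma> (1, i)" "\<not> 0 < na \<sigma> (1, m + i) + na \<sigma> (0, 12)"
    by metis
  then show ?thesis
  proof cases
    case one
    then have bi: "b i = 1" and "bv (NLess (NConst 0) (NA 1 (reg 2))) \<sigma>"
      unfolding b symbol_def by (simp_all add: i(1))
    note e = ex_Cond_True[OF this(2) c(1) ex_Seq[OF ex_setreg[OF n, of 13 0] ex_setreg[OF n, of 14 1]]]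
    show ?thesis unfolding side_com_def
      by (rule ex_eq[OF e]) (simp_all add: bi dec_side_def fun_upd_twist)
  next
    case two
    then have bi: "b i = 2" and 1: "\<not> bv (NLess (NConst 0) (NA 1 (reg 2))) \<sigma>"
      and 2: "bv (NLess (NConst 0) (NAdd (NA 1 (NAdd cM (reg 2))) (reg 12))) \<sigma>"
      unfolding b symbol_def by (simp_all add: i(1))
    note e = ex_Cond_False[OF 1 c(1) ex_Cond_True[OF 2 c(2) ex_Seq[OF ex_setreg[OF n, of 13 1] ex_setreg[OF n, of 14 1]]]]
    show ?thesis unfolding side_com_def
      by (rule ex_eq[OF e]) (simp_all add: bi dec_side_def fun_upd_twist)
  next
    case zero
    then have bi: "b i = 0" and 1: "\<not> bv (NLess (NConst 0) (NA 1 (reg 2))) \<sigma>"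
      and 2: "\<not> bv (NLess (NConst 0) (NAdd (NA 1 (NAdd cM (reg 2))) (reg 12))) \<sigma>"
      unfolding b symbol_def by (simp_all add: i(1))
    let ?s = "\<sigma>\<lparr>na := (na \<sigma>)((0, 14) := nv (NConst 0) \<sigma>)\<rparr>"
    have t: "tables ?s" using tab by (auto simp: tables_def)
    have 3: "bv (RLess (kdiag (NConst 0)) (kdiag (NConst 1))) ?s \<longleftrightarrow> K 0 i i < K 1 i i"
      using rv_kdiag[OF t] i ag by (simp add: agree_def)
    have "ex (Cond (RLess (kdiag (NConst 0)) (kdiag (NConst 1))) (setreg 13 (NConst 1)) (setreg 13 (NConst 0))) ?s (?u + ?u)
      (\<sigma>\<lparr>na := (na \<sigma>)((0, 14) := of_bool (b i \<noteq> 0), (0, 13) := dec_side b i K)\<rparr>)"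
    proof (rule ex_Cond[OF c(3)])
      assume "bv (RLess (kdiag (NConst 0)) (kdiag (NConst 1))) ?s"
      then show "ex (setreg 13 (NConst 1)) ?s ?u (\<sigma>\<lparr>na := (na \<sigma>)((0, 14) := of_bool (b i \<noteq> 0), (0, 13) := dec_side b i K)\<rparr>)"
        using 3 ex_setreg[OF n, of 13 1 ?s] bi by (simp add: dec_side_def)
    next
      assume "\<not> bv (RLess (kdiag (NConst 0)) (kdiag (NConst 1))) ?s"
      then show "ex (setreg 13 (NConst 0)) ?s ?u (\<sigma>\<lparr>na := (na \<sigma>)((0, 14) := of_bool (b i \<noteq> 0), (0, 13) := dec_side b i K)\<rparr>)"
        using 3 ex_setreg[OF n, of 13 0 ?s] bi by (simp add: dec_side_def)
    qed
    note e = ex_Cond_False[OF 1 c(1) ex_Cond_False[OF 2 c(2) ex_Seq[OF ex_setreg[OF n, of 14 0] this]]]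
    show ?thesis unfolding side_com_def
      by (rule ex_mono[OF e]) simp
  qed
qed

lemma coeff_correct:
  assumes tab: "tables \<sigma>" and i: "na \<sigma> (0, 2) = i" "i < m" and ag: "agree \<sigma> K"
    and \<delta>: "wk \<sigma> (0, 1) = \<delta>" and s: "na \<sigma> (0, 13) = dec_side b i K" "na \<sigma> (0, 14) = of_bool (b i \<noteq> 0)"
  shows "ex coeff_com \<sigma> (4 * unit_cost)
    (\<sigma>\<lparr>na := (na \<sigma>)((0, 11) := dec_side b i K), wk := (wk \<sigma>)((0, 6) := dec_coeff \<delta> b i K)\<rparr>)"
proof -
  let ?u = unit_cost
  let ?s = "\<sigma>\<lparr>na := (na \<sigma>)((0, 11) := dec_side b i K)\<rparr>"
  let ?s' = "\<sigma>\<lparr>na := (na \<sigma>)((0, 11) := dec_side b i K), wk := (wk \<sigma>)((0, 6) := dec_coeff \<delta> b i K)\<rparr>"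
  have t: "tables ?s" using tab by (auto simp: tables_def)
  note W = tables_W[OF t]
  have k: "rv (kdiag (reg 11)) ?s = K (dec_side b i K) i i"
    using rv_kdiag[OF t, of "reg 11"] i ag dec_side_less[of b i K] by (simp add: agree_def)
  have d: "rv (rreg 1) ?s = \<delta>" using W \<delta> by simp
  have 1: "ex (setreg 11 (reg 13)) \<sigma> ?u ?s"
    using ex_setreg[of "reg 13" 11 \<sigma>] s by simp
  have 2: "ex (Cond (NLess (NConst 0) (reg 14))
        (Cond (RLess (kdiag (reg 11)) (rreg 1))
           (setrreg 6 (RSub (RC 1) (RMul (RSub (RC 1) (rreg 1)) (RDiv (rreg 1) (kdiag (reg 11))))))
           (setrreg 6 (RSub (RC 1) (RMul (RSub (RC 1) (rreg 1)) (RC 1)))))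
        (setrreg 6 (RC 1))) ?s ((?u + ?u) + ?u) ?s'"
  proof (rule ex_Cond)
    show "bcost (NLess (NConst 0) (reg 14)) < ?u" by (simp add: unit_cost_def)
    assume "bv (NLess (NConst 0) (reg 14)) ?s"
    then have b: "b i \<noteq> 0" using s by (simp split: if_splits)
    show "ex (Cond (RLess (kdiag (reg 11)) (rreg 1))
           (setrreg 6 (RSub (RC 1) (RMul (RSub (RC 1) (rreg 1)) (RDiv (rreg 1) (kdiag (reg 11))))))
           (setrreg 6 (RSub (RC 1) (RMul (RSub (RC 1) (rreg 1)) (RC 1))))) ?s (?u + ?u) ?s'"
    proof (rule ex_Cond)
      show "bcost (RLess (kdiag (reg 11)) (rreg 1)) < ?u" by (simp add: unit_cost_def kdiag_def)
    next
      assume "bv (RLess (kdiag (reg 11)) (rreg 1)) ?s"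
      then show "ex (setrreg 6 (RSub (RC 1) (RMul (RSub (RC 1) (rreg 1)) (RDiv (rreg 1) (kdiag (reg 11)))))) ?s ?u ?s'"
        using ex_setrreg[OF W, of "RSub (RC 1) (RMul (RSub (RC 1) (rreg 1)) (RDiv (rreg 1) (kdiag (reg 11))))" 6] k d b
        by (simp add: dec_coeff_def head_weight_def kdiag_def)
    next
      assume "\<not> bv (RLess (kdiag (reg 11)) (rreg 1)) ?s"
      then show "ex (setrreg 6 (RSub (RC 1) (RMul (RSub (RC 1) (rreg 1)) (RC 1)))) ?s ?u ?s'"
        using ex_setrreg[OF W, of "RSub (RC 1) (RMul (RSub (RC 1) (rreg 1)) (RC 1))" 6] k d b
        by (simp add: dec_coeff_def head_weight_def kdiag_def)
    qed
  next
    assume "\<not> bv (NLess (NConst 0) (reg 14)) ?s"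
    then have b: "b i = 0" using s by (simp split: if_splits)
    show "ex (setrreg 6 (RC 1)) ?s (?u + ?u) ?s'"
      by (rule ex_mono[of _ _ ?u]) (use ex_setrreg[OF W, of "RC 1" 6] b in \<open>simp_all add: dec_coeff_def RC_def\<close>)
  qed
  show ?thesis
    unfolding coeff_com_def by (rule ex_mono[OF ex_Seq[OF 1 2]]) simp
qed

lemma rank_one_update_cong:
  "(\<And>j l. j < m \<Longrightarrow> l < m \<Longrightarrow> K j l = K' j l) \<Longrightarrow> i < m \<Longrightarrow> j < m \<Longrightarrow> l < m \<Longrightarrow>
    rank_one_update K i c j l = rank_one_update K' i c j l"
  by (simp add: rank_one_update_def)

lemma frame_trans_same: "frame A B \<sigma> \<sigma>' \<Longrightarrow> frame A B \<sigma>' \<sigma>'' \<Longrightarrow> frame A B \<sigma> \<sigma>''"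
  by (rule frame_trans) auto

definition step_na :: "(nat \<times> nat) set" where
  "step_na = {(0, 3), (0, 4), (0, 10), (0, 11), (0, 13), (0, 14)}"

definition step_wk :: "(nat \<times> nat) set" where
  "step_wk = {(0, 6), (0, 7)} \<union> {1, 3, 4, 5, 6} \<times> UNIV"

lemma step_correct:
  assumes tab: "tables \<sigma>" and i: "na \<sigma> (0, 2) = i" "i < m" and ag: "agree \<sigma> K" and b: "b i = symbol \<sigma> i"
    and \<delta>: "wk \<sigma> (0, 1) = \<delta>"
  shows "\<exists>\<sigma>'. ex step_com \<sigma> (40 * unit_cost * (m + 2)\<^sup>2) \<sigma>' \<and>
    frame step_na step_wk (\<sigma>\<lparr>ra := (ra \<sigma>)(i := 1 - dec_side b i K)\<rparr>) \<sigma>' \<and>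
    agree \<sigma>' (dec_step \<delta> b i K) \<and>
    na \<sigma>' (0, 10) = (if K (dec_side b i K + 2) i i < 1 then na \<sigma> (0, 10) else 0)"
proof -
  let ?u = unit_cost and ?a = "dec_side b i K" and ?c = "dec_coeff \<delta> b i K"
  have a: "?a < 2" by (rule dec_side_less)
  define \<sigma>1 where "\<sigma>1 = \<sigma>\<lparr>na := (na \<sigma>)((0, 14) := of_bool (b i \<noteq> 0), (0, 13) := ?a)\<rparr>"
  have e1: "ex side_com \<sigma> (6 * ?u) \<sigma>1"
    unfolding \<sigma>1_def using tab i ag b by (rule side_correct)
  define \<sigma>2 where "\<sigma>2 = \<sigma>1\<lparr>na := (na \<sigma>1)((0, 11) := ?a), wk := (wk \<sigma>1)((0, 6) := ?c)\<rparr>"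
  have e2: "ex coeff_com \<sigma>1 (4 * ?u) \<sigma>2"
    unfolding \<sigma>2_def
    by (rule coeff_correct) (use tab i ag \<delta> in \<open>auto simp: \<sigma>1_def tables_def agree_def\<close>)
  define \<sigma>3 where "\<sigma>3 = \<sigma>2\<lparr>ra := (ra \<sigma>)(i := 1 - ?a)\<rparr>"
  have e3: "ex (setS (reg 2) (NSub (NConst 1) (reg 13))) \<sigma>2 ?u \<sigma>3"
    using ex_setS[of "reg 2" \<sigma>2 "NSub (NConst 1) (reg 13)"] i
    by (simp add: \<sigma>3_def \<sigma>2_def \<sigma>1_def unit_cost_def)
  have t3: "tables \<sigma>3" using tab by (auto simp: tables_def \<sigma>3_def \<sigma>2_def \<sigma>1_def)
  have K3: "kmat \<sigma>3 k = kmat \<sigma> k" for k by (simp add: \<sigma>3_def \<sigma>2_def \<sigma>1_def)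
  have "\<exists>\<sigma>4. ex update_com \<sigma>3 (9 * ?u * (m + 2)\<^sup>2) \<sigma>4 \<and>
    frame {(0, 3), (0, 4)} ({(0, 7)} \<union> {1} \<times> UNIV \<union> {3 + ?a} \<times> UNIV) \<sigma>3 \<sigma>4 \<and>
    (\<forall>j<m. \<forall>l<m. kmat \<sigma>4 ?a j l = rank_one_update (kmat \<sigma>3 ?a) i ?c j l)"
    by (rule update_correct[OF t3]) (use i a in \<open>auto simp: \<sigma>3_def \<sigma>2_def \<sigma>1_def\<close>)
  then obtain \<sigma>4 where e4: "ex update_com \<sigma>3 (9 * ?u * (m + 2)\<^sup>2) \<sigma>4"
    and f4: "frame {(0, 3), (0, 4)} ({(0, 7)} \<union> {1} \<times> UNIV \<union> {3 + ?a} \<times> UNIV) \<sigma>3 \<sigma>4"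
    and K4: "\<And>j l. j < m \<Longrightarrow> l < m \<Longrightarrow> kmat \<sigma>4 ?a j l = rank_one_update (kmat \<sigma>3 ?a) i ?c j l" by blast
  have t4: "tables \<sigma>4" by (rule tables_frame[OF t3 f4]) auto
  have r4: "na \<sigma>4 (0, 2) = i" "na \<sigma>4 (0, 13) = ?a" "na \<sigma>4 (0, 10) = na \<sigma> (0, 10)"
    using frame_na[OF f4] i by (auto simp: \<sigma>3_def \<sigma>2_def \<sigma>1_def)
  define \<sigma>5 where "\<sigma>5 = \<sigma>4\<lparr>na := (na \<sigma>4)((0, 11) := ?a + 2)\<rparr>"
  have e5: "ex (setreg 11 (NAdd (reg 13) (NConst 2))) \<sigma>4 ?u \<sigma>5"
    using ex_setreg[of "NAdd (reg 13) (NConst 2)" 11 \<sigma>4] r4 by (simp add: \<sigma>5_def)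
  have t5: "tables \<sigma>5" using t4 by (auto simp: tables_def \<sigma>5_def)
  \<comment> \<open>The first update touches only the kernel of its side, so the test and the second
    update still see the old kernel \<open>?a + 2\<close>.\<close>
  have Ko: "kmat \<sigma>4 k j l = kmat \<sigma> k j l" if "k \<noteq> ?a" for k j l
    using frame_wk[OF f4, of "(3 + k, prod_encode (j, l))"] K3[of k] that by (auto simp: fun_eq_iff)
  have k5: "rv (kdiag (reg 11)) \<sigma>5 = K (?a + 2) i i"
  proof -
    have "rv (kdiag (reg 11)) \<sigma>5 = kmat \<sigma>5 (?a + 2) i i"
      using rv_kdiag[OF t5, of "reg 11"] r4 i a by (simp add: \<sigma>5_def)
    also have "\<dots> = kmat \<sigma> (?a + 2) i i" using Ko[of "?a + 2"] by (simp add: \<sigma>5_def)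
    also have "\<dots> = K (?a + 2) i i"
      using ag[unfolded agree_def, rule_format, of "?a + 2" i i] a i by simp
    finally show ?thesis .
  qed
  define \<sigma>6 where "\<sigma>6 = (if K (?a + 2) i i < 1 then \<sigma>5\<lparr>na := (na \<sigma>5)((0, 14) := 0)\<rparr> else \<sigma>5\<lparr>na := (na \<sigma>5)((0, 10) := 0)\<rparr>)"
  have e6: "ex (Cond (RLess (kdiag (reg 11)) (RC 1)) (setreg 14 (NConst 0)) (setreg 10 (NConst 0))) \<sigma>5 (?u + ?u) \<sigma>6"
    by (rule ex_Cond) (use ex_setreg[of "NConst 0" 14 \<sigma>5] ex_setreg[of "NConst 0" 10 \<sigma>5] k5 in
      \<open>auto simp: \<sigma>6_def unit_cost_def kdiag_def\<close>)
  define \<sigma>7 where "\<sigma>7 = \<sigma>6\<lparr>wk := (wk \<sigma>6)((0, 6) := - 1)\<rparr>"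
  have t7: "tables \<sigma>7" using t5 by (auto simp: tables_def \<sigma>6_def \<sigma>7_def)
  have e7: "ex (setrreg 6 (RSub (RC 0) (RC 1))) \<sigma>6 ?u \<sigma>7"
    using ex_setrreg[of \<sigma>6 "RSub (RC 0) (RC 1)" 6] tables_W[OF t7] by (simp add: \<sigma>7_def RC_def)
  have "\<exists>\<sigma>8. ex update_com \<sigma>7 (9 * ?u * (m + 2)\<^sup>2) \<sigma>8 \<and>
    frame {(0, 3), (0, 4)} ({(0, 7)} \<union> {1} \<times> UNIV \<union> {3 + (?a + 2)} \<times> UNIV) \<sigma>7 \<sigma>8 \<and>
    (\<forall>j<m. \<forall>l<m. kmat \<sigma>8 (?a + 2) j l = rank_one_update (kmat \<sigma>7 (?a + 2)) i (- 1) j l)"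
    by (rule update_correct[OF t7]) (use i a r4 in \<open>auto simp: \<sigma>7_def \<sigma>6_def \<sigma>5_def\<close>)
  then obtain \<sigma>8 where e8: "ex update_com \<sigma>7 (9 * ?u * (m + 2)\<^sup>2) \<sigma>8"
    and f8: "frame {(0, 3), (0, 4)} ({(0, 7)} \<union> {1} \<times> UNIV \<union> {3 + (?a + 2)} \<times> UNIV) \<sigma>7 \<sigma>8"
    and K8: "\<And>j l. j < m \<Longrightarrow> l < m \<Longrightarrow> kmat \<sigma>8 (?a + 2) j l = rank_one_update (kmat \<sigma>7 (?a + 2)) i (- 1) j l" by blast
  have K7: "kmat \<sigma>7 k = kmat \<sigma>4 k" for k by (simp add: \<sigma>7_def \<sigma>6_def \<sigma>5_def)
  have Ko8: "kmat \<sigma>8 k j l = kmat \<sigma>4 k j l" if "k \<noteq> ?a + 2" for k j l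
    using frame_wk[OF f8, of "(3 + k, prod_encode (j, l))"] K7[of k] that by (auto simp: fun_eq_iff)
  have "agree \<sigma>8 (dec_step \<delta> b i K)"
    unfolding agree_def
  proof (intro allI impI)
    fix k j l assume k: "k < (4 :: nat)" and j: "j < m" and l: "l < m"
    have Kk: "kmat \<sigma> k j l = K k j l" if "k < 4" "j < m" "l < m" for k j l
      using ag that by (simp add: agree_def)
    consider "k = ?a" | "k = ?a + 2" | "k \<noteq> ?a" "k \<noteq> ?a + 2" by blast
    then show "kmat \<sigma>8 k j l = dec_step \<delta> b i K k j l"
    proof cases
      case 1
      have "kmat \<sigma>8 k j l = rank_one_update (kmat \<sigma>3 ?a) i ?c j l" using Ko8 K4[OF j l] 1 by simp
      also have "\<dots> = rank_one_update (K ?a) i ?c j l"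
        using K3[of ?a] Kk[of ?a] a i j l by (intro rank_one_update_cong) (auto simp: fun_eq_iff)
      finally show ?thesis using 1 by (simp add: dec_step_def)
    next
      case 2
      have "kmat \<sigma>8 k j l = rank_one_update (kmat \<sigma>7 (?a + 2)) i (- 1) j l" using K8[OF j l] 2 by simp
      also have "\<dots> = rank_one_update (K (?a + 2)) i (- 1) j l"
        using K7[of "?a + 2"] Ko[of "?a + 2"] Kk[of "?a + 2"] a i j l by (intro rank_one_update_cong) (auto simp: fun_eq_iff)
      finally show ?thesis using 2 by (simp add: dec_step_def)
    next
      case 3
      then show ?thesis using Ko8[of k j l] Ko[of k j l] Kk[OF k j l] by (simp add: dec_step_def)
    qed
  qed
  moreover have "na \<sigma>8 (0, 10) = (if K (?a + 2) i i < 1 then na \<sigma> (0, 10) else 0)"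
    using frame_na[OF f8, of "(0, 10)"] r4 by (simp add: \<sigma>7_def \<sigma>6_def \<sigma>5_def)
  moreover have "frame step_na step_wk (\<sigma>\<lparr>ra := (ra \<sigma>)(i := 1 - ?a)\<rparr>) \<sigma>8"
  proof -
    have "frame step_na step_wk (\<sigma>\<lparr>ra := (ra \<sigma>)(i := 1 - ?a)\<rparr>) \<sigma>3"
      by (auto simp: frame_def \<sigma>3_def \<sigma>2_def \<sigma>1_def step_na_def step_wk_def)
    moreover have "frame step_na step_wk \<sigma>3 \<sigma>4"
      using a by (intro frame_trans[OF f4 frame_refl[of "{}" "{}"]]) (auto simp: step_na_def step_wk_def)
    moreover have "frame step_na step_wk \<sigma>4 \<sigma>7"
      by (auto simp: frame_def \<sigma>7_def \<sigma>6_def \<sigma>5_def step_na_def step_wk_def)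
    moreover have "frame step_na step_wk \<sigma>7 \<sigma>8"
      using a by (intro frame_trans[OF f8 frame_refl[of "{}" "{}"]]) (auto simp: step_na_def step_wk_def)
    ultimately show ?thesis by (elim frame_trans_same) simp
  qed
  moreover have "ex step_com \<sigma> (40 * ?u * (m + 2)\<^sup>2) \<sigma>8"
    unfolding step_com_def
  proof (rule ex_mono[OF ex_Seq[OF e1 ex_Seq[OF e2 ex_Seq[OF e3 ex_Seq[OF e4 ex_Seq[OF e5 ex_Seq[OF e6 ex_Seq[OF e7 e8]]]]]]]])
    have "1 \<le> (m + 2)\<^sup>2" by simp
    then show "6 * ?u + (4 * ?u + (?u + (9 * ?u * (m + 2)\<^sup>2 + (?u + (?u + ?u + (?u + 9 * ?u * (m + 2)\<^sup>2)))))) \<le> 40 * ?u * (m + 2)\<^sup>2"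
      using mult_le_mono2[of 1 "(m + 2)\<^sup>2" ?u] by linarith
  qed
  ultimately show ?thesis by (intro exI[of _ \<sigma>8] conjI)
qed

end

context ram
begin

lemma init_correct:
  assumes tab: "tables \<sigma>" and q: "wk \<sigma> (0, 2) = q" "wk \<sigma> (0, 3) = \<mu>"
    and G: "\<And>j l. j < m \<Longrightarrow> l < m \<Longrightarrow> wk \<sigma> (2, prod_encode (j, l)) = G j l"
  shows "\<exists>\<sigma>'. ex (For 3 cM (For 4 cM init_com)) \<sigma> (8 * unit_cost * (m + 2)\<^sup>2) \<sigma>' \<and>
    frame {(0, 3), (0, 4)} ({3, 4, 5, 6} \<times> UNIV) \<sigma> \<sigma>' \<and>
    agree \<sigma>' (\<lambda>k j l. G j l / (if k < 2 then q else \<mu>))"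
proof -
  let ?u = unit_cost
  define A where "A = {(0 :: nat, 3 :: nat), (0, 4)}"
  define B where "B = {3, 4, 5, 6 :: nat} \<times> (UNIV :: nat set)"
  define ini where "ini = (\<lambda>k j l. G j l / (if k < (2 :: nat) then q else \<mu>))"
  define J where "J j \<tau> \<longleftrightarrow> frame A B \<sigma> \<tau> \<and> (\<forall>k<4. \<forall>a<j. \<forall>b<m. kmat \<tau> k a b = ini k a b)" for j \<tau>
  define J' where "J' j l \<tau> \<longleftrightarrow> J j \<tau> \<and> na \<tau> (0, 3) = j \<and> (\<forall>k<4. \<forall>b<l. kmat \<tau> k j b = ini k j b)" for j l \<tau>
  have body: "\<exists>\<sigma>'. ex init_com \<tau> (4 * ?u) \<sigma>' \<and> na \<sigma>' (0, 4) = l \<and> J' j (Suc l) (\<sigma>'\<lparr>na := (na \<sigma>')((0, 4) := Suc l)\<rparr>)"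
    if j: "j < m" and l: "l < m" and J': "J' j l \<tau>" and rl: "na \<tau> (0, 4) = l" for j l \<tau>
  proof -
    have fr: "frame A B \<sigma> \<tau>" and r: "na \<tau> (0, 3) = j" using J' by (auto simp: J_def J'_def)
    have t: "tables \<tau>" by (rule tables_frame[OF tab fr]) (auto simp: A_def)
    let ?e = "enc2 (reg 3) (reg 4)" and ?p = "prod_encode (j, l)"
    have v: "wk \<tau> (0, 2) = q" "wk \<tau> (0, 3) = \<mu>" "wk \<tau> (2, ?p) = G j l"
      using frame_wk[OF fr] q G[OF j l] by (auto simp: B_def)
    have st: "ex (setW (NConst k) ?e (RDiv (WK (NConst 2) ?e) (rreg x))) (\<tau>\<lparr>wk := w\<rparr>) ?u (\<tau>\<lparr>wk := w((k, ?p) := G j l / w (0, x))\<rparr>)"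
      if "k < 8" "w (2, ?p) = G j l" for k x w
    proof -
      have t': "tables (\<tau>\<lparr>wk := w\<rparr>)" using t by (simp add: tables_def)
      have e: "nv ?e (\<tau>\<lparr>wk := w\<rparr>) = ?p" using nv_enc2[OF t'] r rl j l by simp
      have "rv (RDiv (WK (NConst 2) ?e) (rreg x)) (\<tau>\<lparr>wk := w\<rparr>) = G j l / w (0, x)"
        using tables_W[OF t'] e that by simp
      then show ?thesis
        using ex_setW[OF tables_W[OF t'], of "NConst k" ?e "RDiv (WK (NConst 2) ?e) (rreg x)"] that e
        by (simp add: unit_cost_def)
    qed
    let ?w0 = "wk \<tau>"
    let ?w1 = "?w0((3, ?p) := G j l / ?w0 (0, 2))"
    let ?w2 = "?w1((4, ?p) := G j l / ?w1 (0, 2))"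
    let ?w3 = "?w2((5, ?p) := G j l / ?w2 (0, 3))"
    let ?w4 = "?w3((6, ?p) := G j l / ?w3 (0, 3))"
    have s0: "\<tau>\<lparr>wk := wk \<tau>\<rparr> = \<tau>" by simp
    have e: "ex init_com (\<tau>\<lparr>wk := ?w0\<rparr>) (?u + (?u + (?u + ?u))) (\<tau>\<lparr>wk := ?w4\<rparr>)"
      unfolding init_com_def using v
      by (intro ex_Seq[OF st ex_Seq[OF st ex_Seq[OF st st]]]) simp_all
    define s where "s = \<tau>\<lparr>wk := ?w4, na := (na \<tau>)((0, 4) := Suc l)\<rparr>"
    have "frame A B \<sigma> s" using fr by (auto simp: frame_def A_def B_def s_def)
    moreover have "na s (0, 3) = j" using r by (simp add: s_def)
    moreover have "kmat s k a b = (if k < 4 \<and> a = j \<and> b = l then ini k j l else kmat \<tau> k a b)" for k a b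
      using v by (auto simp: ini_def s_def)
    ultimately have "J' j (Suc l) s" using J' by (auto simp: J'_def J_def less_Suc_eq)
    then show ?thesis
      using e rl unfolding s0 s_def by (intro exI[of _ "\<tau>\<lparr>wk := ?w4\<rparr>"]) (simp add: ex_mono)
  qed
  have inner: "\<exists>\<sigma>'. ex (For 4 cM init_com) \<tau> ((m + 2) * (4 * ?u + 2 * ?u)) \<sigma>' \<and> J' j m \<sigma>' \<and> na \<sigma>' (0, 4) = m"
    if j: "j < m" and J: "J j \<tau>" and r: "na \<tau> (0, 3) = j" for j \<tau>
  proof (rule ex_For)
    have "frame A B \<sigma> (\<tau>\<lparr>na := (na \<tau>)((0, 4) := 0)\<rparr>)" using J by (auto simp: J_def A_def intro!: frame_upd_na)
    then show "J' j 0 (\<tau>\<lparr>na := (na \<tau>)((0, 4) := 0)\<rparr>)" using J r by (auto simp: J_def J'_def)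
  qed (use body[OF j] in auto)
  have "\<exists>\<sigma>'. ex (For 3 cM (For 4 cM init_com)) \<sigma> ((m + 2) * ((m + 2) * (4 * ?u + 2 * ?u) + 2 * ?u)) \<sigma>' \<and> J m \<sigma>' \<and> na \<sigma>' (0, 3) = m"
  proof (rule ex_For)
    show "J 0 (\<sigma>\<lparr>na := (na \<sigma>)((0, 3) := 0)\<rparr>)" by (simp add: J_def A_def frame_upd_na)
    fix j \<tau> assume "j < m" "J j \<tau>" "na \<tau> (0, 3) = j"
    from inner[OF this] obtain \<sigma>' where s: "ex (For 4 cM init_com) \<tau> ((m + 2) * (4 * ?u + 2 * ?u)) \<sigma>'" "J' j m \<sigma>'" by blast
    then have "frame A B \<sigma> (\<sigma>'\<lparr>na := (na \<sigma>')((0, 3) := Suc j)\<rparr>)" by (auto simp: J_def J'_def A_def intro!: frame_upd_na)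
    then have "J (Suc j) (\<sigma>'\<lparr>na := (na \<sigma>')((0, 3) := Suc j)\<rparr>)"
      using s by (auto simp: J_def J'_def less_Suc_eq)
    with s show "\<exists>\<sigma>'. ex (For 4 cM init_com) \<tau> ((m + 2) * (4 * ?u + 2 * ?u)) \<sigma>' \<and> na \<sigma>' (0, 3) = j \<and> J (Suc j) (\<sigma>'\<lparr>na := (na \<sigma>')((0, 3) := Suc j)\<rparr>)"
      by (auto simp: J'_def)
  qed auto
  then obtain \<sigma>' where "ex (For 3 cM (For 4 cM init_com)) \<sigma> ((m + 2) * ((m + 2) * (4 * ?u + 2 * ?u) + 2 * ?u)) \<sigma>'" and J: "J m \<sigma>'"
    by blast
  then have "ex (For 3 cM (For 4 cM init_com)) \<sigma> (8 * unit_cost * (m + 2)\<^sup>2) \<sigma>'"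
    by (elim ex_mono) (simp add: power2_eq_square algebra_simps)
  with J show ?thesis unfolding J_def A_def B_def ini_def[symmetric] by (auto simp: agree_def)
qed

definition decode_na :: "(nat \<times> nat) set" where
  "decode_na = insert (0, 2) step_na"

text \<open>Unlike \<open>frame\<close>, this lets the output set change, because every decoding
  rewrites it.\<close>

definition same :: "st \<Rightarrow> st \<Rightarrow> bool" where
  "same \<sigma> \<sigma>' \<longleftrightarrow> (\<forall>p. p \<notin> decode_na \<longrightarrow> na \<sigma>' p = na \<sigma> p) \<and> (\<forall>p. p \<notin> step_wk \<longrightarrow> wk \<sigma>' p = wk \<sigma> p)"

lemma same_trans: "same \<sigma> \<sigma>' \<Longrightarrow> same \<sigma>' \<sigma>'' \<Longrightarrow> same \<sigma> \<sigma>''"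
  unfolding same_def by metis

lemma same_tables: "same \<sigma> \<sigma>' \<Longrightarrow> tables \<sigma> \<Longrightarrow> tables \<sigma>'"
  by (auto simp: same_def tables_def decode_na_def step_na_def)

lemma same_symbol: "same \<sigma> \<sigma>' \<Longrightarrow> symbol \<sigma>' i = symbol \<sigma> i"
  by (auto simp: same_def symbol_def decode_na_def step_na_def)

lemma frame_same: "frame A B (\<sigma>\<lparr>ra := f\<rparr>) \<sigma>' \<Longrightarrow> A \<subseteq> decode_na \<Longrightarrow> B \<subseteq> step_wk \<Longrightarrow> same \<sigma> \<sigma>'"
  unfolding frame_def same_def by (auto simp del: split_paired_All)

lemma decode_correct:
  assumes tab: "tables \<sigma>" and q: "wk \<sigma> (0, 1) = \<delta>" "wk \<sigma> (0, 2) = q" "wk \<sigma> (0, 3) = \<mu>"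
    and G: "\<And>j l. j < m \<Longrightarrow> l < m \<Longrightarrow> wk \<sigma> (2, prod_encode (j, l)) = G j l"
    and b: "\<And>i. i < m \<Longrightarrow> b i = symbol \<sigma> i"
  defines "D \<equiv> dec \<delta> (\<lambda>k j l. G j l / (if k < 2 then q else \<mu>)) b"
  shows "\<exists>\<sigma>'. ex decode_com \<sigma> (60 * unit_cost * (m + 2) ^ 3) \<sigma>' \<and> same \<sigma> \<sigma>' \<and>
    (\<forall>i<m. ra \<sigma>' i = 1 - dec_side b i (D i)) \<and>
    na \<sigma>' (0, 10) = of_bool (\<forall>i<m. D i (dec_side b i (D i) + 2) i i < 1)"
proof -
  let ?u = unit_cost
  obtain \<sigma>1 where e1: "ex (For 3 cM (For 4 cM init_com)) \<sigma> (8 * unit_cost * (m + 2)\<^sup>2) \<sigma>1"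
    and f1: "frame {(0, 3), (0, 4)} ({3, 4, 5, 6} \<times> UNIV) \<sigma> \<sigma>1" and a1: "agree \<sigma>1 (D 0)"
    using init_correct[OF tab q(2,3) G] unfolding D_def by auto
  have s1: "same \<sigma> \<sigma>1" by (rule frame_same[where f = "ra \<sigma>"]) (use f1 in \<open>auto simp: decode_na_def step_na_def step_wk_def\<close>)
  define \<sigma>2 where "\<sigma>2 = \<sigma>1\<lparr>na := (na \<sigma>1)((0, 10) := 1)\<rparr>"
  have e2: "ex (setreg 10 (NConst 1)) \<sigma>1 ?u \<sigma>2"
    using ex_setreg[of "NConst 1" 10 \<sigma>1] by (simp add: \<sigma>2_def)
  define I where "I n \<tau> \<longleftrightarrow> same \<sigma> \<tau> \<and> agree \<tau> (D n) \<and> (\<forall>i<n. ra \<tau> i = 1 - dec_side b i (D i)) \<and>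
    na \<tau> (0, 10) = of_bool (\<forall>i<n. D i (dec_side b i (D i) + 2) i i < 1)" for n \<tau>
  have "\<exists>\<sigma>'. ex (For 2 cM step_com) \<sigma>2 ((m + 2) * (40 * ?u * (m + 2)\<^sup>2 + 2 * ?u)) \<sigma>' \<and> I m \<sigma>' \<and> na \<sigma>' (0, 2) = m"
  proof (rule ex_For)
    have "same \<sigma>1 (\<sigma>2\<lparr>na := (na \<sigma>2)((0, 2) := 0)\<rparr>)" by (auto simp: same_def \<sigma>2_def decode_na_def step_na_def)
    then show "I 0 (\<sigma>2\<lparr>na := (na \<sigma>2)((0, 2) := 0)\<rparr>)"
      using same_trans[OF s1] a1 by (auto simp: I_def agree_def \<sigma>2_def)
    fix i \<tau> assume i: "i < m" and I: "I i \<tau>" and r: "na \<tau> (0, 2) = i"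
    have s: "same \<sigma> \<tau>" and ag: "agree \<tau> (D i)" using I by (auto simp: I_def)
    have d: "wk \<tau> (0, 1) = \<delta>" using s q by (auto simp: same_def step_wk_def)
    have b': "b i = symbol \<tau> i" using b[OF i] same_symbol[OF s] by simp
    from step_correct[OF same_tables[OF s tab] r i ag, where b = b and \<delta> = \<delta>, OF b' d] obtain \<sigma>' where
      s': "ex step_com \<tau> (40 * unit_cost * (m + 2)\<^sup>2) \<sigma>'"
      "frame step_na step_wk (\<tau>\<lparr>ra := (ra \<tau>)(i := 1 - dec_side b i (D i))\<rparr>) \<sigma>'"
      "agree \<sigma>' (dec_step \<delta> b i (D i))"
      "na \<sigma>' (0, 10) = (if D i (dec_side b i (D i) + 2) i i < 1 then na \<tau> (0, 10) else 0)" by blast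
    have r': "na \<sigma>' (0, 2) = i" using frame_na[OF s'(2), of "(0, 2)"] r by (simp add: step_na_def)
    have ra: "ra \<sigma>' = (ra \<tau>)(i := 1 - dec_side b i (D i))" using s'(2) by (simp add: frame_def)
    have "same \<tau> \<sigma>'" by (rule frame_same[OF s'(2)]) (auto simp: decode_na_def)
    then have "same \<tau> (\<sigma>'\<lparr>na := (na \<sigma>')((0, 2) := Suc i)\<rparr>)" by (auto simp: same_def decode_na_def)
    then have "same \<sigma> (\<sigma>'\<lparr>na := (na \<sigma>')((0, 2) := Suc i)\<rparr>)" using same_trans[OF s] by blast
    moreover have "D (Suc i) = dec_step \<delta> b i (D i)" by (simp add: D_def)
    moreover have "na \<sigma>' (0, 10) = of_bool (\<forall>i'<Suc i. D i' (dec_side b i' (D i') + 2) i' i' < 1)"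
      using s'(4) I unfolding I_def by (simp add: All_less_Suc)
    ultimately have "I (Suc i) (\<sigma>'\<lparr>na := (na \<sigma>')((0, 2) := Suc i)\<rparr>)"
      using s'(3) I ra by (auto simp: I_def agree_def less_Suc_eq)
    with s' r' show "\<exists>\<sigma>'. ex step_com \<tau> (40 * unit_cost * (m + 2)\<^sup>2) \<sigma>' \<and> na \<sigma>' (0, 2) = i \<and>
      I (Suc i) (\<sigma>'\<lparr>na := (na \<sigma>')((0, 2) := Suc i)\<rparr>)" by blast
  qed auto
  then obtain \<sigma>3 where e3: "ex (For 2 cM step_com) \<sigma>2 ((m + 2) * (40 * ?u * (m + 2)\<^sup>2 + 2 * ?u)) \<sigma>3" and I: "I m \<sigma>3"
    by blast
  have "ex decode_com \<sigma> (8 * unit_cost * (m + 2)\<^sup>2 + (?u + (m + 2) * (40 * ?u * (m + 2)\<^sup>2 + 2 * ?u))) \<sigma>3"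
    unfolding decode_com_def by (rule ex_Seq[OF e1 ex_Seq[OF e2 e3]])
  moreover have "8 * unit_cost * (m + 2)\<^sup>2 + (?u + (m + 2) * (40 * ?u * (m + 2)\<^sup>2 + 2 * ?u)) \<le> 60 * unit_cost * (m + 2) ^ 3"
    by (simp add: power2_eq_square power3_eq_cube algebra_simps)
  ultimately have "ex decode_com \<sigma> (60 * unit_cost * (m + 2) ^ 3) \<sigma>3" by (rule ex_mono)
  then show ?thesis using I unfolding I_def by blast
qed

end

section \<open>Enumerating the candidates\<close>

text \<open>The order of the numbers with these binary digits; enumerating candidates is counting
  with a bounded number of ones.\<close>

definition set_less :: "nat set \<Rightarrow> nat set \<Rightarrow> bool" (infix \<open>\<lless>\<close> 50) where
  "X \<lless> Z \<longleftrightarrow> (\<exists>k. k \<in> Z \<and> k \<notin> X \<and> (\<forall>j>k. j \<in> X \<longleftrightarrow> j \<in> Z))"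

lemma set_less_irrefl: "\<not> X \<lless> X"
  by (simp add: set_less_def)

lemma set_less_trans:
  assumes "X \<lless> Y" "Y \<lless> Z"
  shows "X \<lless> Z"
proof -
  from assms obtain k k' where k: "k \<in> Y" "k \<notin> X" "\<And>j. j > k \<Longrightarrow> j \<in> X \<longleftrightarrow> j \<in> Y"
    and k': "k' \<in> Z" "k' \<notin> Y" "\<And>j. j > k' \<Longrightarrow> j \<in> Y \<longleftrightarrow> j \<in> Z"
    unfolding set_less_def by blast
  have "k \<noteq> k'" using k k' by blast
  then consider "k < k'" | "k' < k" by linarith
  then show ?thesis
  proof cases
    case 1
    then show ?thesis unfolding set_less_def using k k' by (intro exI[of _ k']) auto
  next
    case 2
    then show ?thesis unfolding set_less_def using k k' by (intro exI[of _ k]) auto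
  qed
qed

lemma set_less_total:
  assumes "finite X" "finite Z" "X \<noteq> Z"
  shows "X \<lless> Z \<or> Z \<lless> X"
proof -
  let ?D = "(X - Z) \<union> (Z - X)"
  have D: "finite ?D" "?D \<noteq> {}" using assms by auto
  have "Max ?D \<in> ?D" using D by (rule Max_in)
  moreover have "j \<in> X \<longleftrightarrow> j \<in> Z" if "j > Max ?D" for j
    using Max_ge[OF D(1), of j] that by auto
  ultimately show ?thesis unfolding set_less_def by blast
qed

text \<open>The successor, among the sets with at most \<open>h\<close> elements, of \<open>X\<close> in the order of binary
  numbers: the run of ones that starts at \<open>p\<close> is replaced by a one at its end \<open>q\<close>. If \<open>X\<close> is full,
  everything that differs from \<open>X\<close> only below its least element \<open>p\<close> is skipped.\<close>

lemma set_successor: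
  assumes p: "p = 0 \<or> h \<le> card X" "\<And>k. k < p \<Longrightarrow> k \<notin> X" and q: "p \<le> q" "\<And>k. p \<le> k \<Longrightarrow> k < q \<Longrightarrow> k \<in> X"
    and Z: "X \<lless> Z" "card Z \<le> h" "finite X" "finite Z"
  shows "\<exists>k\<ge>q. k \<in> Z" and "q \<notin> X \<Longrightarrow> Z = insert q (X - {..<q}) \<or> insert q (X - {..<q}) \<lless> Z"
proof -
  from Z obtain k where k: "k \<in> Z" "k \<notin> X" "\<And>j. j > k \<Longrightarrow> j \<in> X \<longleftrightarrow> j \<in> Z"
    unfolding set_less_def by blast
  \<comment> \<open>Otherwise \<open>Z\<close> contains \<open>X\<close> and the further element
    \<open>k\<close>. Then p > 0, so \<open>X\<close> is full and \<open>Z\<close> has more than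
    \<open>h\<close> elements.\<close>
  have "k \<ge> p"
  proof (rule ccontr)
    assume "\<not> k \<ge> p"
    then have kp: "k < p" by simp
    have "x \<in> Z" if "x \<in> X" for x
    proof -
      have "\<not> x < p" using p(2) that by blast
      then show ?thesis using k(3)[of x] kp that by simp
    qed
    then have "insert k X \<subseteq> Z" using k(1) by blast
    then have "card (insert k X) \<le> card Z" using Z by (intro card_mono) auto
    then show False using kp p(1) Z k(2) by simp
  qed
  then have kq: "k \<ge> q" using q(2) k(2) not_le by blast
  then show "\<exists>k\<ge>q. k \<in> Z" using k(1) by blast
  assume qX: "q \<notin> X"
  let ?Y = "insert q (X - {..<q})"
  show "Z = ?Y \<or> ?Y \<lless> Z"
  proof (cases "k = q")
    case False
    then have "k > q" using kq by simp
    then have "k \<in> Z \<and> k \<notin> ?Y \<and> (\<forall>j>k. j \<in> ?Y \<longleftrightarrow> j \<in> Z)" using k by auto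
    then show ?thesis unfolding set_less_def by blast
  next
    case True
    \<comment> \<open>Now \<open>Z\<close> contains \<open>q\<close> and agrees with
      \<open>X\<close> above it; among such sets \<open>?Y\<close> is the least, having nothing
      below \<open>q\<close>.\<close>
    show ?thesis
    proof (rule ccontr)
      assume n: "\<not> ?thesis"
      then have "Z \<lless> ?Y" using set_less_total[of ?Y Z] Z by auto
      then obtain j where j: "j \<in> ?Y" "j \<notin> Z" unfolding set_less_def by blast
      then show False using k(1,2) k(3)[of j] True by (cases "j = q") auto
    qed
  qed
qed

lemma set_less_successor:
  assumes "q \<notin> X"
  shows "X \<lless> insert q (X - {..<q})"
  unfolding set_less_def using assms by (intro exI[of _ q]) auto

section \<open>Counting in memory\<close>

definition skip_com :: com where
  "skip_com = While (BAnd (NLess (reg 9) (reg 7)) (BNot (NLess (NConst 0) (NA 1 (reg 9)))))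
     (setreg 9 (NAdd (reg 9) (NConst 1)))"

definition clear_com :: com where
  "clear_com = While (BAnd (NLess (reg 9) (reg 7)) (NLess (NConst 0) (NA 1 (reg 9))))
     (Seq (setN 1 (reg 9) (NConst 0))
     (Seq (setreg 8 (NSub (reg 8) (NConst 1))) (setreg 9 (NAdd (reg 9) (NConst 1)))))"

definition next_com :: com where
  "next_com = Seq (setreg 9 (NConst 0))
     (Seq (Cond (NLess (reg 8) (reg 6)) (setreg 9 (NConst 0)) skip_com)
     (Seq clear_com
     (Cond (NLess (reg 9) (reg 7))
        (Seq (setN 1 (reg 9) (NConst 1)) (setreg 8 (NAdd (reg 8) (NConst 1))))
        (setreg 15 (NConst 2)))))"

definition enum_com :: com where
  "enum_com = While (NLess (reg 15) (NConst 1))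
     (Seq decode_com (Cond (NLess (NConst 0) (reg 10)) (setreg 15 (NConst 1)) next_com))"

context ram
begin

definition bits :: "nat set \<Rightarrow> st \<Rightarrow> bool" where
  "bits X \<sigma> \<longleftrightarrow> (\<forall>k. na \<sigma> (1, k) = of_bool (k \<in> X))"

lemma skip_correct:
  assumes "bits X \<sigma>" "na \<sigma> (0, 7) = L" "na \<sigma> (0, 9) + n = p" "p \<le> L"
    "\<And>k. k < p \<Longrightarrow> k \<notin> X" "p \<in> X \<or> p = L"
  shows "ex skip_com \<sigma> (n * (2 * unit_cost) + unit_cost) (\<sigma>\<lparr>na := (na \<sigma>)((0, 9) := p)\<rparr>)"
  using assms(1-3)
proof (induction n arbitrary: \<sigma>)
  let ?b = "BAnd (NLess (reg 9) (reg 7)) (BNot (NLess (NConst 0) (NA 1 (reg 9))))"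
  have b: "bcost ?b < unit_cost" by (simp add: unit_cost_def)
  {
    case 0
    then have "\<not> bv ?b \<sigma>" using assms(6) by (auto simp: bits_def)
    from ex_While_done[OF b this] have e: "ex skip_com \<sigma> unit_cost \<sigma>" unfolding skip_com_def .
    have "(na \<sigma>)((0, 9) := p) = na \<sigma>" using 0 by (intro fun_upd_idem) simp
    then show ?case by (intro ex_eq[OF e]) simp_all
  next
    case (Suc n)
    let ?s = "\<sigma>\<lparr>na := (na \<sigma>)((0, 9) := Suc (na \<sigma> (0, 9)))\<rparr>"
    have 1: "bv ?b \<sigma>" using Suc.prems assms(4,5) by (auto simp: bits_def)
    have 2: "ex (setreg 9 (NAdd (reg 9) (NConst 1))) \<sigma> unit_cost ?s"
      using ex_setreg[of "NAdd (reg 9) (NConst 1)" 9 \<sigma>] by simp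
    have 3: "ex skip_com ?s (n * (2 * unit_cost) + unit_cost) (?s\<lparr>na := (na ?s)((0, 9) := p)\<rparr>)"
      by (rule Suc.IH) (use Suc.prems in \<open>auto simp: bits_def\<close>)
    have eq: "?s\<lparr>na := (na ?s)((0, 9) := p)\<rparr> = \<sigma>\<lparr>na := (na \<sigma>)((0, 9) := p)\<rparr>" by simp
    show ?case
      using ex_While_step[OF b 1 2 3[unfolded skip_com_def eq]] unfolding skip_com_def
      by (rule ex_mono) simp
  }
qed

lemma clear_correct:
  assumes "bits X \<sigma>" "na \<sigma> (0, 7) = L" "na \<sigma> (0, 9) + n = q" "q \<le> L"
    "\<And>k. na \<sigma> (0, 9) \<le> k \<Longrightarrow> k < q \<Longrightarrow> k \<in> X" "q \<notin> X \<or> q = L"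
  shows "\<exists>\<sigma>'. ex clear_com \<sigma> (n * (4 * unit_cost) + unit_cost) \<sigma>' \<and>
    frame ({(0, 8), (0, 9)} \<union> {1} \<times> UNIV) {} \<sigma> \<sigma>' \<and> bits (X - {na \<sigma> (0, 9)..<q}) \<sigma>' \<and>
    na \<sigma>' (0, 9) = q \<and> na \<sigma>' (0, 8) = na \<sigma> (0, 8) - n"
  using assms(1-3,5,6)
proof (induction n arbitrary: \<sigma> X)
  let ?b = "BAnd (NLess (reg 9) (reg 7)) (NLess (NConst 0) (NA 1 (reg 9)))"
  have b: "bcost ?b < unit_cost" by (simp add: unit_cost_def)
  {
    case 0
    then have "\<not> bv ?b \<sigma>" by (auto simp: bits_def)
    from ex_While_done[OF b this] have "ex clear_com \<sigma> unit_cost \<sigma>" unfolding clear_com_def .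
    then show ?case using 0 by (intro exI[of _ \<sigma>]) auto
  next
    case (Suc n)
    define a where "a = na \<sigma> (0, 9)"
    have aX: "a \<in> X" using Suc.prems a_def by simp
    define s where "s = \<sigma>\<lparr>na := (na \<sigma>)((1, a) := 0, (0, 8) := na \<sigma> (0, 8) - 1, (0, 9) := Suc a)\<rparr>"
    have 1: "bv ?b \<sigma>" using Suc.prems assms(4) aX by (auto simp: bits_def a_def)
    let ?s1 = "\<sigma>\<lparr>na := (na \<sigma>)((1, a) := 0)\<rparr>"
    let ?s2 = "\<sigma>\<lparr>na := (na \<sigma>)((1, a) := 0, (0, 8) := na \<sigma> (0, 8) - 1)\<rparr>"
    have 21: "ex (setN 1 (reg 9) (NConst 0)) \<sigma> unit_cost ?s1"
      using ex_setN[of 1 "reg 9" "NConst 0" \<sigma>] by (simp add: a_def unit_cost_def)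
    have 22: "ex (setreg 8 (NSub (reg 8) (NConst 1))) ?s1 unit_cost ?s2"
      using ex_setreg[of "NSub (reg 8) (NConst 1)" 8 ?s1] by simp
    have 23: "ex (setreg 9 (NAdd (reg 9) (NConst 1))) ?s2 unit_cost s"
      using ex_setreg[of "NAdd (reg 9) (NConst 1)" 9 ?s2] by (simp add: s_def a_def)
    have b': "bits (X - {a}) s" using Suc.prems by (auto simp: bits_def s_def)
    have "\<exists>\<sigma>'. ex clear_com s (n * (4 * unit_cost) + unit_cost) \<sigma>' \<and>
      frame ({(0, 8), (0, 9)} \<union> {1} \<times> UNIV) {} s \<sigma>' \<and> bits (X - {a} - {na s (0, 9)..<q}) \<sigma>' \<and>
      na \<sigma>' (0, 9) = q \<and> na \<sigma>' (0, 8) = na s (0, 8) - n"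
      by (rule Suc.IH[OF b']) (use Suc.prems in \<open>auto simp: s_def a_def\<close>)
    then obtain \<sigma>' where 3: "ex clear_com s (n * (4 * unit_cost) + unit_cost) \<sigma>'"
      "frame ({(0, 8), (0, 9)} \<union> {1} \<times> UNIV) {} s \<sigma>'" "bits (X - {a} - {na s (0, 9)..<q}) \<sigma>'"
      "na \<sigma>' (0, 9) = q" "na \<sigma>' (0, 8) = na s (0, 8) - n" by blast
    have "ex clear_com \<sigma> (Suc n * (4 * unit_cost) + unit_cost) \<sigma>'"
      using ex_While_step[OF b 1 ex_Seq[OF 21 ex_Seq[OF 22 23]] 3(1)[unfolded clear_com_def]] unfolding clear_com_def
      by (elim ex_eq) auto
    moreover have "frame ({(0, 8), (0, 9)} \<union> {1} \<times> UNIV) {} \<sigma> \<sigma>'"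
      using 3(2) by (auto simp: frame_def s_def)
    moreover have "X - {a} - {na s (0, 9)..<q} = X - {na \<sigma> (0, 9)..<q}"
      using Suc.prems by (auto simp: s_def a_def)
    ultimately show ?case using 3 by (intro exI[of _ \<sigma>']) (auto simp: s_def)
  }
qed

lemma next_correct:
  assumes X: "bits X \<sigma>" "X \<subseteq> {..<L}" "card X \<le> h"
    and r: "na \<sigma> (0, 6) = h" "na \<sigma> (0, 7) = L" "na \<sigma> (0, 8) = card X"
    and L: "L \<le> 2 * m"
  shows "\<exists>\<sigma>'. ex next_com \<sigma> (40 * unit_cost * (m + 2)) \<sigma>' \<and>
    frame ({(0, 8), (0, 9), (0, 15)} \<union> {1} \<times> UNIV) {} \<sigma> \<sigma>' \<and>
    (na \<sigma>' (0, 15) = 2 \<and> (\<forall>Z\<subseteq>{..<L}. card Z \<le> h \<longrightarrow> \<not> X \<lless> Z) \<or>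
     na \<sigma>' (0, 15) = na \<sigma> (0, 15) \<and> (\<exists>Y. bits Y \<sigma>' \<and> Y \<subseteq> {..<L} \<and> card Y \<le> h \<and> na \<sigma>' (0, 8) = card Y \<and>
       X \<lless> Y \<and> (\<forall>Z\<subseteq>{..<L}. card Z \<le> h \<and> X \<lless> Z \<longrightarrow> Z = Y \<or> Y \<lless> Z)))"
proof -
  let ?u = unit_cost
  have fX: "finite X" using X(2) finite_subset by blast
  \<comment> \<open>Below the least element of a full set no bit can be added. The empty set is full
    only for h = 0; then the scan runs off the end at \<open>L\<close>.\<close>
  define p where "p = (if card X < h then 0 else if X = {} then L else Min X)"
  have "Min X < L" if "X \<noteq> {}" using Min_in[OF fX that] X(2) by auto
  then have pL: "p \<le> L" by (auto simp: p_def less_imp_le)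
  have p0: "k \<notin> X" if "k < p" for k
    using that Min_le[OF fX, of k] by (auto simp: p_def split: if_splits)
  have ph: "p = 0 \<or> h \<le> card X" by (simp add: p_def)
  have pX: "p \<in> X \<or> p = L" if "\<not> card X < h" using that Min_in[OF fX] by (auto simp: p_def)
  define q where "q = (LEAST q. p \<le> q \<and> (q \<notin> X \<or> q = L))"
  have q: "p \<le> q" "q \<notin> X \<or> q = L" "q \<le> L"
    using LeastI[of "\<lambda>q. p \<le> q \<and> (q \<notin> X \<or> q = L)" L] Least_le[of "\<lambda>q. p \<le> q \<and> (q \<notin> X \<or> q = L)" L] pL
    unfolding q_def by auto
  have run: "k \<in> X" if "p \<le> k" "k < q" for k
    using not_less_Least[of k "\<lambda>q. p \<le> q \<and> (q \<notin> X \<or> q = L)"] that unfolding q_def by auto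
  have qX: "q \<notin> X" using q X(2) by auto
  let ?s0 = "\<sigma>\<lparr>na := (na \<sigma>)((0, 9) := 0)\<rparr>"
  define s1 where "s1 = \<sigma>\<lparr>na := (na \<sigma>)((0, 9) := p)\<rparr>"
  have e0: "ex (setreg 9 (NConst 0)) \<sigma> ?u ?s0" using ex_setreg[of "NConst 0" 9 \<sigma>] by simp
  have e1: "ex (Cond (NLess (reg 8) (reg 6)) (setreg 9 (NConst 0)) skip_com) ?s0 ((p * (2 * ?u) + ?u) + ?u) s1"
  proof (rule ex_Cond)
    show "bcost (NLess (reg 8) (reg 6)) < ?u" by (simp add: unit_cost_def)
    assume "bv (NLess (reg 8) (reg 6)) ?s0"
    then have "p = 0" using r by (simp add: p_def)
    then show "ex (setreg 9 (NConst 0)) ?s0 (p * (2 * ?u) + ?u) s1"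
      using ex_setreg[of "NConst 0" 9 ?s0] by (simp add: s1_def)
  next
    assume "\<not> bv (NLess (reg 8) (reg 6)) ?s0"
    then have "\<not> card X < h" using r by simp
    then have "ex skip_com ?s0 (p * (2 * ?u) + ?u) (?s0\<lparr>na := (na ?s0)((0, 9) := p)\<rparr>)"
      using X(1) r pL p0 pX by (intro skip_correct[where X = X and L = L]) (auto simp: bits_def)
    then show "ex skip_com ?s0 (p * (2 * ?u) + ?u) s1" by (simp add: s1_def)
  qed
  have "\<exists>\<sigma>'. ex clear_com s1 ((q - p) * (4 * ?u) + ?u) \<sigma>' \<and>
    frame ({(0, 8), (0, 9)} \<union> {1} \<times> UNIV) {} s1 \<sigma>' \<and> bits (X - {na s1 (0, 9)..<q}) \<sigma>' \<and>
    na \<sigma>' (0, 9) = q \<and> na \<sigma>' (0, 8) = na s1 (0, 8) - (q - p)"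
    by (rule clear_correct[where L = L]) (use X r q run in \<open>auto simp: s1_def bits_def\<close>)
  then obtain s2 where e2: "ex clear_com s1 ((q - p) * (4 * ?u) + ?u) s2"
    and f2: "frame ({(0, 8), (0, 9)} \<union> {1} \<times> UNIV) {} s1 s2" and b2: "bits (X - {p..<q}) s2"
    and r2: "na s2 (0, 9) = q" "na s2 (0, 8) = card X - (q - p)"
    using r by (auto simp: s1_def)
  have Xq: "X - {p..<q} = X - {..<q}" using p0 by force
  have cX: "card (X - {..<q}) = card X - (q - p)"
    unfolding Xq[symmetric] using run by (subst card_Diff_subset) auto
  have f2': "frame ({(0, 8), (0, 9)} \<union> {1} \<times> UNIV) {} \<sigma> s2" using f2 by (auto simp: frame_def s1_def)
  have r2': "na s2 (0, 7) = L" "na s2 (0, 15) = na \<sigma> (0, 15)" using frame_na[OF f2'] r by auto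
  let ?b = "NLess (reg 9) (reg 7)"
  let ?last = "Cond ?b (Seq (setN 1 (reg 9) (NConst 1)) (setreg 8 (NAdd (reg 8) (NConst 1)))) (setreg 15 (NConst 2))"
  have b: "bcost ?b < ?u" by (simp add: unit_cost_def)
  have tm: "?u + ((p * (2 * ?u) + ?u) + ?u + ((q - p) * (4 * ?u) + ?u + (2 * ?u + ?u))) \<le> 40 * ?u * (m + 2)"
  proof -
    have "p \<le> 2 * m" "q - p \<le> 2 * m" using pL q L by auto
    then have "p * (2 * ?u) \<le> 2 * m * (2 * ?u)" "(q - p) * (4 * ?u) \<le> 2 * m * (4 * ?u)" by (simp_all only: mult_le_mono1)
    moreover have "?u + ((2 * m * (2 * ?u) + ?u) + ?u + (2 * m * (4 * ?u) + ?u + (2 * ?u + ?u))) \<le> 40 * ?u * (m + 2)"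
      by (simp add: algebra_simps)
    ultimately show ?thesis by linarith
  qed
  have fin: "ex next_com \<sigma> (40 * ?u * (m + 2)) s3" if "ex ?last s2 (2 * ?u + ?u) s3" for s3
    unfolding next_com_def using tm by (rule ex_mono[OF ex_Seq[OF e0 ex_Seq[OF e1 ex_Seq[OF e2 that]]]])
  show ?thesis
  proof (cases "q < L")
    case True
    define Y where "Y = insert q (X - {..<q})"
    let ?s3 = "s2\<lparr>na := (na s2)((1, q) := 1)\<rparr>"
    define s4 where "s4 = s2\<lparr>na := (na s2)((1, q) := 1, (0, 8) := Suc (na s2 (0, 8)))\<rparr>"
    have 1: "ex (setN 1 (reg 9) (NConst 1)) s2 ?u ?s3"
      using ex_setN[of 1 "reg 9" "NConst 1" s2] r2 by (simp add: unit_cost_def)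
    have 2: "ex (setreg 8 (NAdd (reg 8) (NConst 1))) ?s3 ?u s4"
      using ex_setreg[of "NAdd (reg 8) (NConst 1)" 8 ?s3] by (simp add: s4_def)
    have "ex ?last s2 ((?u + ?u) + ?u) s4"
      using True r2 r2' by (intro ex_Cond_True[OF _ b ex_Seq[OF 1 2]]) simp
    then have "ex ?last s2 (2 * ?u + ?u) s4" by (rule ex_mono) simp
    then have e: "ex next_com \<sigma> (40 * ?u * (m + 2)) s4" by (rule fin)
    have cY: "card Y = Suc (card X - (q - p))" unfolding Y_def using fX cX qX by (subst card_insert_disjoint) auto
    have "card Y \<le> h"
    proof (cases "card X < h")
      \<comment> \<open>A full \<open>X\<close> has a run of ones that starts at \<open>p\<close>;
        removing it makes room for the bit \<open>q\<close>.\<close>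
      case False
      then have "X \<noteq> {}" "p \<in> X" using pX[OF False] pL True q by auto
      then have "q > p" using q qX by (cases "p = q") auto
      moreover have "card {p..<q} \<le> card X" using run fX by (intro card_mono) auto
      ultimately show ?thesis using cY X(3) by simp
    qed (simp add: cY)
    moreover have "bits Y s4" using b2 unfolding Xq by (auto simp: bits_def Y_def s4_def)
    moreover have "Y \<subseteq> {..<L}" using X(2) True by (auto simp: Y_def)
    moreover have "na s4 (0, 8) = card Y" using cY r2 by (simp add: s4_def)
    moreover have "X \<lless> Y" unfolding Y_def by (rule set_less_successor[OF qX])
    moreover have "Z = Y \<or> Y \<lless> Z" if "Z \<subseteq> {..<L}" "card Z \<le> h" "X \<lless> Z" for Z
      unfolding Y_def using set_successor(2)[OF ph p0 q(1) run that(3,2) fX _ qX] that(1) finite_subset by blast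
    moreover have "na s4 (0, 15) = na \<sigma> (0, 15)" using r2' by (simp add: s4_def)
    moreover have "frame ({(0, 8), (0, 9), (0, 15)} \<union> {1} \<times> UNIV) {} \<sigma> s4"
      using f2' by (auto simp: frame_def s4_def)
    ultimately show ?thesis using e by (intro exI[of _ s4] conjI disjI2 exI[of _ Y]) auto
  next
    case False
    then have qL: "q = L" using q by simp
    define s3 where "s3 = s2\<lparr>na := (na s2)((0, 15) := 2)\<rparr>"
    have "ex ?last s2 (?u + ?u) s3"
      using False r2 r2' ex_setreg[of "NConst 2" 15 s2] by (intro ex_Cond_False[OF _ b]) (simp_all add: s3_def)
    then have "ex ?last s2 (2 * ?u + ?u) s3" by (rule ex_mono) simp
    then have e: "ex next_com \<sigma> (40 * ?u * (m + 2)) s3" by (rule fin)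
    have "\<not> X \<lless> Z" if "Z \<subseteq> {..<L}" "card Z \<le> h" for Z
    proof
      assume "X \<lless> Z"
      from set_successor(1)[OF ph p0 q(1) run this that(2) fX] that(1) finite_subset[OF that(1)] qL
      show False by auto
    qed
    moreover have "frame ({(0, 8), (0, 9), (0, 15)} \<union> {1} \<times> UNIV) {} \<sigma> s3"
      using f2' by (auto simp: frame_def s3_def)
    ultimately show ?thesis using e by (intro exI[of _ s3]) (auto simp: s3_def)
  qed
qed

end

text \<open>Bit \<open>i\<close> stores \<open>v\<^sub>i\<close> for side 0, bit \<open>m + i\<close> for side 1. In exhaustive mode (\<open>br > 0\<close>) the bits
  \<open>i < m\<close> are the colouring itself.\<close>

definition bit_symbol :: "nat \<Rightarrow> nat \<Rightarrow> nat set \<Rightarrow> nat \<Rightarrow> nat" where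
  "bit_symbol m br X i = (if i \<in> X then 1 else if m + i \<in> X \<or> 0 < br then 2 else 0)"

section \<open>The search loop\<close>

context ram
begin

definition ready :: "real \<Rightarrow> real \<Rightarrow> real \<Rightarrow> (nat \<Rightarrow> nat \<Rightarrow> real) \<Rightarrow> nat \<Rightarrow> nat \<Rightarrow> nat \<Rightarrow> st \<Rightarrow> bool" where
  "ready \<delta> q \<mu> G h L br \<sigma> \<longleftrightarrow> tables \<sigma> \<and> wk \<sigma> (0, 1) = \<delta> \<and> wk \<sigma> (0, 2) = q \<and> wk \<sigma> (0, 3) = \<mu> \<and>
     (\<forall>j<m. \<forall>l<m. wk \<sigma> (2, prod_encode (j, l)) = G j l) \<and>
     na \<sigma> (0, 6) = h \<and> na \<sigma> (0, 7) = L \<and> na \<sigma> (0, 12) = br"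

lemma ready_same: "ready \<delta> q \<mu> G h L br \<sigma> \<Longrightarrow> same \<sigma> \<sigma>' \<Longrightarrow> ready \<delta> q \<mu> G h L br \<sigma>'"
  using same_tables[of \<sigma> \<sigma>']
  by (simp add: ready_def same_def decode_na_def step_na_def step_wk_def)

lemma ready_next:
  assumes "ready \<delta> q \<mu> G h L br \<sigma>" and fr: "frame ({(0, 8), (0, 9), (0, 15)} \<union> {1} \<times> UNIV) {} \<sigma> \<sigma>'"
  shows "ready \<delta> q \<mu> G h L br \<sigma>'"
proof -
  have "tables \<sigma>'" using assms(1) by (intro tables_frame[OF _ fr]) (auto simp: ready_def)
  then show ?thesis using assms(1) frame_na[OF fr] frame_wk[OF fr] by (simp add: ready_def)
qed

text \<open>The program is verified for arbitrary constants and an arbitrary matrix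
  \<open>G\<close>. Positive definiteness enters only when the result is matched with the decoder of
  a tight family.\<close>

definition decoded :: "real \<Rightarrow> real \<Rightarrow> real \<Rightarrow> (nat \<Rightarrow> nat \<Rightarrow> real) \<Rightarrow> nat \<Rightarrow> nat set \<Rightarrow> nat \<Rightarrow> nat \<Rightarrow> nat \<Rightarrow> nat \<Rightarrow> real" where
  "decoded \<delta> q \<mu> G br X = dec \<delta> (\<lambda>k j l. G j l / (if k < 2 then q else \<mu>)) (bit_symbol m br X)"

definition chosen_side :: "real \<Rightarrow> real \<Rightarrow> real \<Rightarrow> (nat \<Rightarrow> nat \<Rightarrow> real) \<Rightarrow> nat \<Rightarrow> nat set \<Rightarrow> nat \<Rightarrow> nat" where
  "chosen_side \<delta> q \<mu> G br X i = dec_side (bit_symbol m br X) i (decoded \<delta> q \<mu> G br X i)"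

definition passes :: "real \<Rightarrow> real \<Rightarrow> real \<Rightarrow> (nat \<Rightarrow> nat \<Rightarrow> real) \<Rightarrow> nat \<Rightarrow> nat set \<Rightarrow> bool" where
  "passes \<delta> q \<mu> G br X \<longleftrightarrow> (\<forall>i<m. decoded \<delta> q \<mu> G br X i (chosen_side \<delta> q \<mu> G br X i + 2) i i < 1)"

definition enum_time :: nat where "enum_time = 110 * unit_cost * (m + 2) ^ 3"

text \<open>Induction on the number of candidates after \<open>X\<close>: passing to the successor
  strictly shrinks this set, and each round is charged \<open>enum_time\<close>. Minimality of the
  successor ensures that no candidate is passed over.\<close>

lemma enum_correct:
  assumes "ready \<delta> q \<mu> G h L br \<sigma>" "bits X \<sigma>" "X \<subseteq> {..<L}" "card X \<le> h" "na \<sigma> (0, 8) = card X"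
    "na \<sigma> (0, 15) = 0" "L \<le> 2 * m" "card {Z. Z \<subseteq> {..<L} \<and> card Z \<le> h \<and> X \<lless> Z} = N"
  shows "\<exists>\<sigma>'. ex enum_com \<sigma> ((N + 1) * enum_time + unit_cost) \<sigma>' \<and> na \<sigma>' (0, 0) = W \<and>
    (na \<sigma>' (0, 15) = 1 \<and> (\<exists>Z\<subseteq>{..<L}. card Z \<le> h \<and> passes \<delta> q \<mu> G br Z \<and> (\<forall>i<m. ra \<sigma>' i = 1 - chosen_side \<delta> q \<mu> G br Z i)) \<or>
     na \<sigma>' (0, 15) = 2 \<and> (\<forall>Z\<subseteq>{..<L}. card Z \<le> h \<and> (Z = X \<or> X \<lless> Z) \<longrightarrow> \<not> passes \<delta> q \<mu> G br Z))"
  using assms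
proof (induction N arbitrary: X \<sigma> rule: less_induct)
  case (less N)
  let ?u = unit_cost and ?b = "NLess (reg 15) (NConst 1)"
  let ?body = "Seq decode_com (Cond (NLess (NConst 0) (reg 10)) (setreg 15 (NConst 1)) next_com)"
  have b: "bcost ?b < ?u" "bcost (NLess (NConst 0) (reg 10)) < ?u" by (simp_all add: unit_cost_def)
  have b1: "bv ?b \<sigma>" using less.prems by simp
  have sy: "bit_symbol m br X i = symbol \<sigma> i" for i
    using less.prems(1,2) by (auto simp: bit_symbol_def symbol_def bits_def ready_def)
  have "\<exists>\<sigma>'. ex decode_com \<sigma> (60 * ?u * (m + 2) ^ 3) \<sigma>' \<and> same \<sigma> \<sigma>' \<and>
    (\<forall>i<m. ra \<sigma>' i = 1 - chosen_side \<delta> q \<mu> G br X i) \<and> na \<sigma>' (0, 10) = of_bool (passes \<delta> q \<mu> G br X)"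
    unfolding chosen_side_def passes_def decoded_def
    by (rule decode_correct) (use less.prems(1) sy in \<open>auto simp: ready_def\<close>)
  then obtain s1 where e1: "ex decode_com \<sigma> (60 * ?u * (m + 2) ^ 3) s1" and sm: "same \<sigma> s1"
    and ra: "\<And>i. i < m \<Longrightarrow> ra s1 i = 1 - chosen_side \<delta> q \<mu> G br X i"
    and ok: "na s1 (0, 10) = of_bool (passes \<delta> q \<mu> G br X)" by blast
  have rd1: "ready \<delta> q \<mu> G h L br s1" using ready_same[OF less.prems(1) sm] .
  have r1: "na s1 (0, 6) = h" "na s1 (0, 7) = L" "na s1 (0, 8) = card X" "na s1 (0, 15) = 0" "bits X s1" "na s1 (0, 0) = W"
    using sm less.prems tables_W[of s1] rd1 by (auto simp: ready_def bits_def same_def decode_na_def step_na_def)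
  have pw: "?u * (m + 2) \<le> ?u * (m + 2) ^ 3" "?u \<le> ?u * (m + 2) ^ 3"
    using mult_le_mono2[OF power_mono_M[of 1 3], of ?u] mult_le_mono2[OF power_mono_M[of 0 3], of ?u]
    by (simp_all only: power_one_right power_0 mult_1_right)
  show ?case
  proof (cases "passes \<delta> q \<mu> G br X")
    case True
    let ?s2 = "s1\<lparr>na := (na s1)((0, 15) := 1)\<rparr>"
    have "ex (Cond (NLess (NConst 0) (reg 10)) (setreg 15 (NConst 1)) next_com) s1 (?u + ?u) ?s2"
      using ok True ex_setreg[of "NConst 1" 15 s1] by (intro ex_Cond_True[OF _ b(2)]) simp_all
    from ex_Seq[OF e1 this] have e2: "ex ?body \<sigma> (60 * ?u * (m + 2) ^ 3 + (?u + ?u)) ?s2" .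
    have e3: "ex enum_com ?s2 ?u ?s2"
      unfolding enum_com_def by (rule ex_While_done[OF b(1)]) simp
    have "ex enum_com \<sigma> (?u + (60 * ?u * (m + 2) ^ 3 + (?u + ?u)) + ?u) ?s2"
      unfolding enum_com_def by (rule ex_While_step[OF b(1) b1 e2 e3[unfolded enum_com_def]])
    moreover have "?u + (60 * ?u * (m + 2) ^ 3 + (?u + ?u)) + ?u \<le> (N + 1) * enum_time + ?u"
      using pw unfolding enum_time_def by simp
    ultimately have "ex enum_com \<sigma> ((N + 1) * enum_time + ?u) ?s2" by (rule ex_mono)
    moreover have "\<exists>Z\<subseteq>{..<L}. card Z \<le> h \<and> passes \<delta> q \<mu> G br Z \<and> (\<forall>i<m. ra ?s2 i = 1 - chosen_side \<delta> q \<mu> G br Z i)"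
      using True ra less.prems by (intro exI[of _ X]) auto
    ultimately show ?thesis using r1 by (intro exI[of _ ?s2] conjI disjI1) simp_all
  next
    case False
    let ?fin = "{(0, 8), (0, 9), (0, 15)} \<union> {1} \<times> UNIV"
    obtain s2 where e2: "ex next_com s1 (40 * ?u * (m + 2)) s2" and fr: "frame ?fin {} s1 s2"
      and alt: "na s2 (0, 15) = 2 \<and> (\<forall>Z\<subseteq>{..<L}. card Z \<le> h \<longrightarrow> \<not> X \<lless> Z) \<or>
       na s2 (0, 15) = na s1 (0, 15) \<and> (\<exists>Y. bits Y s2 \<and> Y \<subseteq> {..<L} \<and> card Y \<le> h \<and> na s2 (0, 8) = card Y \<and>
       X \<lless> Y \<and> (\<forall>Z\<subseteq>{..<L}. card Z \<le> h \<and> X \<lless> Z \<longrightarrow> Z = Y \<or> Y \<lless> Z))"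
      using next_correct[OF r1(5) less.prems(3,4) r1(1-3) less.prems(7)] by blast
    have rd2: "ready \<delta> q \<mu> G h L br s2" using ready_next[OF rd1 fr] .
    have W2: "na s2 (0, 0) = W" using rd2 tables_W[of s2] by (simp add: ready_def)
    have "ex (Cond (NLess (NConst 0) (reg 10)) (setreg 15 (NConst 1)) next_com) s1 (40 * ?u * (m + 2) + ?u) s2"
      using ok False by (intro ex_Cond_False[OF _ b(2) e2]) simp_all
    from ex_Seq[OF e1 this] have e3: "ex ?body \<sigma> (60 * ?u * (m + 2) ^ 3 + (40 * ?u * (m + 2) + ?u)) s2" .
    have tm: "?u + (60 * ?u * (m + 2) ^ 3 + (40 * ?u * (m + 2) + ?u)) \<le> enum_time"
      using pw unfolding enum_time_def by linarith
    from alt show ?thesis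
    proof
      assume stop: "na s2 (0, 15) = 2 \<and> (\<forall>Z\<subseteq>{..<L}. card Z \<le> h \<longrightarrow> \<not> X \<lless> Z)"
      have e4: "ex enum_com s2 ?u s2"
        unfolding enum_com_def using stop by (intro ex_While_done[OF b(1)]) simp
      have "ex enum_com \<sigma> (?u + (60 * ?u * (m + 2) ^ 3 + (40 * ?u * (m + 2) + ?u)) + ?u) s2"
        unfolding enum_com_def by (rule ex_While_step[OF b(1) b1 e3 e4[unfolded enum_com_def]])
      then have "ex enum_com \<sigma> ((N + 1) * enum_time + ?u) s2"
        by (rule ex_mono) (use tm in simp)
      then show ?thesis using stop False W2 by (intro exI[of _ s2] conjI disjI2) auto
    next
      assume "na s2 (0, 15) = na s1 (0, 15) \<and> (\<exists>Y. bits Y s2 \<and> Y \<subseteq> {..<L} \<and> card Y \<le> h \<and> na s2 (0, 8) = card Y \<and>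
       X \<lless> Y \<and> (\<forall>Z\<subseteq>{..<L}. card Z \<le> h \<and> X \<lless> Z \<longrightarrow> Z = Y \<or> Y \<lless> Z))"
      then obtain Y where Y: "bits Y s2" "Y \<subseteq> {..<L}" "card Y \<le> h" "na s2 (0, 8) = card Y" "X \<lless> Y"
        and min: "\<And>Z. Z \<subseteq> {..<L} \<Longrightarrow> card Z \<le> h \<Longrightarrow> X \<lless> Z \<Longrightarrow> Z = Y \<or> Y \<lless> Z" and s0: "na s2 (0, 15) = 0"
        using r1 by auto
      let ?N = "\<lambda>X. {Z. Z \<subseteq> {..<L} \<and> card Z \<le> h \<and> X \<lless> Z}"
      have lt: "card (?N Y) < N"
      proof -
        have "finite (?N X)" by (rule finite_subset[of _ "Pow {..<L}"]) auto
        moreover have "?N Y \<subset> ?N X"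
          using Y set_less_trans[OF Y(5)] set_less_irrefl[of Y] by auto
        ultimately have "card (?N Y) < card (?N X)" by (rule psubset_card_mono)
        then show ?thesis using less.prems(8) by simp
      qed
      from less.IH[OF lt rd2 Y(1-4) s0 less.prems(7) refl] obtain s3 where
        e4: "ex enum_com s2 ((card (?N Y) + 1) * enum_time + ?u) s3" and W3: "na s3 (0, 0) = W"
        and alt': "na s3 (0, 15) = 1 \<and> (\<exists>Z\<subseteq>{..<L}. card Z \<le> h \<and> passes \<delta> q \<mu> G br Z \<and> (\<forall>i<m. ra s3 i = 1 - chosen_side \<delta> q \<mu> G br Z i)) \<or>
          na s3 (0, 15) = 2 \<and> (\<forall>Z\<subseteq>{..<L}. card Z \<le> h \<and> (Z = Y \<or> Y \<lless> Z) \<longrightarrow> \<not> passes \<delta> q \<mu> G br Z)"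
        by blast
      have "ex enum_com \<sigma> (?u + (60 * ?u * (m + 2) ^ 3 + (40 * ?u * (m + 2) + ?u)) + ((card (?N Y) + 1) * enum_time + ?u)) s3"
        unfolding enum_com_def by (rule ex_While_step[OF b(1) b1 e3 e4[unfolded enum_com_def]])
      moreover have "?u + (60 * ?u * (m + 2) ^ 3 + (40 * ?u * (m + 2) + ?u)) + ((card (?N Y) + 1) * enum_time + ?u) \<le> (N + 1) * enum_time + ?u"
      proof -
        have "(card (?N Y) + 1) * enum_time \<le> N * enum_time" using lt by (intro mult_le_mono1) simp
        then show ?thesis using tm by simp
      qed
      ultimately have "ex enum_com \<sigma> ((N + 1) * enum_time + ?u) s3" by (rule ex_mono)
      moreover have "na s3 (0, 15) = 1 \<and> (\<exists>Z\<subseteq>{..<L}. card Z \<le> h \<and> passes \<delta> q \<mu> G br Z \<and> (\<forall>i<m. ra s3 i = 1 - chosen_side \<delta> q \<mu> G br Z i)) \<or>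
          na s3 (0, 15) = 2 \<and> (\<forall>Z\<subseteq>{..<L}. card Z \<le> h \<and> (Z = X \<or> X \<lless> Z) \<longrightarrow> \<not> passes \<delta> q \<mu> G br Z)"
        using alt' min False by blast
      ultimately show ?thesis using W3 by blast
    qed
  qed
qed

end

section \<open>The complete program\<close>

text \<open>Naturals have no multiplication, so the offsets 3 + k d and the triangular numbers are
  accumulated by addition. \<open>d\<close> is saved first, because its input cell 1 later holds the
  first bit of the output set.\<close>

definition offset_com :: com where
  "offset_com = Seq (setreg 1 (NLoad (NConst 1)))
     (Seq (setN 3 (NConst 0) (NConst 3))
     (Seq (For 2 cM (setN 3 (NAdd (reg 2) (NConst 1)) (NAdd (NA 3 (reg 2)) (reg 1))))
     (Seq (setreg 0 (NA 3 cM))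
     (For 2 (NAdd cM cM) (setN 2 (NAdd (reg 2) (NConst 1)) (NAdd (NA 2 (reg 2)) (NAdd (reg 2) (NConst 1))))))))"

definition coord :: "nexp \<Rightarrow> rexp" where
  "coord j = RLoad (NAdd (NA 3 j) (reg 5))"

definition gram_entry_com :: com where
  "gram_entry_com = Seq (setrreg 5 (RC 0))
     (Seq (For 5 (reg 1) (setrreg 5 (RAdd (rreg 5) (RMul (coord (reg 3)) (coord (reg 4))))))
     (setW (NConst 2) (enc2 (reg 3) (reg 4)) (rreg 5)))"

definition gram_com :: com where
  "gram_com = For 3 cM (For 4 cM gram_entry_com)"

context ram
begin

definition offsets :: "st \<Rightarrow> bool" where
  "offsets \<sigma> \<longleftrightarrow> (\<forall>k\<le>m. na \<sigma> (3, k) = 3 + k * d)"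

definition gram :: "nat \<Rightarrow> nat \<Rightarrow> real" where
  "gram j l = (\<Sum>t<d. inp (3 + j * d + t) * inp (3 + l * d + t))"

lemma offset_correct:
  assumes "ra \<sigma> 0 = d" "\<And>p. na \<sigma> p = 0"
  shows "\<exists>\<sigma>'. ex offset_com \<sigma> (20 * unit_cost * (m + 2)) \<sigma>' \<and> tables \<sigma>' \<and> offsets \<sigma>' \<and>
    frame ({(0, 0), (0, 1), (0, 2)} \<union> {2, 3} \<times> UNIV) {} \<sigma> \<sigma>'"
proof -
  let ?u = unit_cost
  define s1 where "s1 = \<sigma>\<lparr>na := (na \<sigma>)((0, 1) := d)\<rparr>"
  have e1: "ex (setreg 1 (NLoad (NConst 1))) \<sigma> ?u s1"
    using ex_setreg[of "NLoad (NConst 1)" 1 \<sigma>] nv_load_set[of "NConst 1" \<sigma>] assms m_pos by (simp add: s1_def)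
  define s2 where "s2 = s1\<lparr>na := (na s1)((3, 0) := 3)\<rparr>"
  have e2: "ex (setN 3 (NConst 0) (NConst 3)) s1 ?u s2"
    using ex_setN[of 3 "NConst 0" "NConst 3" s1] by (simp add: s2_def unit_cost_def)
  let ?A = "{(0, 2)} \<union> {3 :: nat} \<times> (UNIV :: nat set)"
  define I where "I n \<tau> \<longleftrightarrow> frame ?A {} s2 \<tau> \<and> (\<forall>k\<le>n. na \<tau> (3, k) = 3 + k * d)" for n \<tau>
  let ?p = "setN 3 (NAdd (reg 2) (NConst 1)) (NAdd (NA 3 (reg 2)) (reg 1))"
  have "\<exists>\<sigma>'. ex (For 2 cM ?p) s2 ((m + 2) * (?u + 2 * ?u)) \<sigma>' \<and> I m \<sigma>' \<and> na \<sigma>' (0, 2) = m"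
  proof (rule ex_For)
    show "I 0 (s2\<lparr>na := (na s2)((0, 2) := 0)\<rparr>)" by (simp add: I_def frame_upd_na) (simp add: s2_def)
    fix i \<tau> assume "i < m" and I: "I i \<tau>" and r: "na \<tau> (0, 2) = i"
    have fr: "frame ?A {} s2 \<tau>" using I by (simp add: I_def)
    have v: "na \<tau> (3, i) = 3 + i * d" "na \<tau> (0, 1) = d"
      using I frame_na[OF fr, of "(0, 1)"] by (auto simp: I_def s2_def s1_def)
    let ?s = "\<tau>\<lparr>na := (na \<tau>)((3, Suc i) := 3 + Suc i * d)\<rparr>"
    have "ex ?p \<tau> ?u ?s"
      using ex_setN[of 3 "NAdd (reg 2) (NConst 1)" "NAdd (NA 3 (reg 2)) (reg 1)" \<tau>] r v
      by (simp add: unit_cost_def algebra_simps)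
    moreover have "I (Suc i) (?s\<lparr>na := (na ?s)((0, 2) := Suc i)\<rparr>)"
      using I by (auto simp: I_def frame_def le_Suc_eq)
    ultimately show "\<exists>\<sigma>'. ex ?p \<tau> ?u \<sigma>' \<and> na \<sigma>' (0, 2) = i \<and> I (Suc i) (\<sigma>'\<lparr>na := (na \<sigma>')((0, 2) := Suc i)\<rparr>)"
      using r by (intro exI[of _ ?s]) simp
  qed auto
  then obtain s3 where e3: "ex (For 2 cM ?p) s2 ((m + 2) * (?u + 2 * ?u)) s3"
    and f3: "frame ?A {} s2 s3" and o3: "\<And>k. k \<le> m \<Longrightarrow> na s3 (3, k) = 3 + k * d"
    unfolding I_def by blast
  define s4 where "s4 = s3\<lparr>na := (na s3)((0, 0) := W)\<rparr>"
  have e4: "ex (setreg 0 (NA 3 cM)) s3 ?u s4"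
    using ex_setreg[of "NA 3 cM" 0 s3] o3[of m] by (simp add: s4_def W_def)
  let ?A' = "{(0, 2)} \<union> {2 :: nat} \<times> (UNIV :: nat set)"
  define J where "J n \<tau> \<longleftrightarrow> frame ?A' {} s4 \<tau> \<and> (\<forall>k\<le>n. na \<tau> (2, k) = triangle k)" for n \<tau>
  let ?q = "setN 2 (NAdd (reg 2) (NConst 1)) (NAdd (NA 2 (reg 2)) (NAdd (reg 2) (NConst 1)))"
  have z4: "na s4 (2, 0) = 0" using frame_na[OF f3, of "(2, 0)"] assms(2) by (simp add: s4_def s2_def s1_def)
  have "\<exists>\<sigma>'. ex (For 2 (NAdd cM cM) ?q) s4 ((2 * m + 2) * (?u + 2 * ?u)) \<sigma>' \<and> J (2 * m) \<sigma>' \<and> na \<sigma>' (0, 2) = 2 * m"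
  proof (rule ex_For)
    show "J 0 (s4\<lparr>na := (na s4)((0, 2) := 0)\<rparr>)" using z4 by (simp add: J_def frame_upd_na)
    fix i \<tau> assume "i < 2 * m" and J: "J i \<tau>" and r: "na \<tau> (0, 2) = i"
    have v: "na \<tau> (2, i) = triangle i" using J by (auto simp: J_def)
    let ?s = "\<tau>\<lparr>na := (na \<tau>)((2, Suc i) := triangle (Suc i))\<rparr>"
    have "ex ?q \<tau> ?u ?s"
      using ex_setN[of 2 "NAdd (reg 2) (NConst 1)" "NAdd (NA 2 (reg 2)) (NAdd (reg 2) (NConst 1))" \<tau>] r v
      by (simp add: unit_cost_def)
    moreover have "J (Suc i) (?s\<lparr>na := (na ?s)((0, 2) := Suc i)\<rparr>)"
      using J by (auto simp: J_def frame_def le_Suc_eq)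
    ultimately show "\<exists>\<sigma>'. ex ?q \<tau> ?u \<sigma>' \<and> na \<sigma>' (0, 2) = i \<and> J (Suc i) (\<sigma>'\<lparr>na := (na \<sigma>')((0, 2) := Suc i)\<rparr>)"
      using r by (intro exI[of _ ?s]) simp
  qed auto
  then obtain s5 where e5: "ex (For 2 (NAdd cM cM) ?q) s4 ((2 * m + 2) * (?u + 2 * ?u)) s5"
    and f5: "frame ?A' {} s4 s5" and t5: "\<And>k. k \<le> 2 * m \<Longrightarrow> na s5 (2, k) = triangle k"
    unfolding J_def by blast
  have "ex offset_com \<sigma> (20 * ?u * (m + 2)) s5"
    unfolding offset_com_def
    by (rule ex_mono[OF ex_Seq[OF e1 ex_Seq[OF e2 ex_Seq[OF e3 ex_Seq[OF e4 e5]]]]]) (simp add: algebra_simps)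
  moreover have "tables s5"
    using t5 frame_na[OF f5] frame_na[OF f3] by (simp add: tables_def s4_def s2_def s1_def)
  moreover have "offsets s5"
    using o3 frame_na[OF f5] by (simp add: offsets_def s4_def)
  moreover have "frame ({(0, 0), (0, 1), (0, 2)} \<union> {2, 3} \<times> UNIV) {} \<sigma> s5"
  proof -
    let ?F = "frame ({(0, 0), (0, 1), (0, 2)} \<union> {2, 3} \<times> UNIV) {}"
    have "?F \<sigma> s2" by (auto simp: frame_def s2_def s1_def)
    moreover have "?F s2 s3" by (rule frame_trans[OF f3 frame_refl[of "{}" "{}"]]) auto
    moreover have "?F s3 s4" by (auto simp: frame_def s4_def)
    moreover have "?F s4 s5" by (rule frame_trans[OF f5 frame_refl[of "{}" "{}"]]) auto
    ultimately show ?thesis by (elim frame_trans_same) simp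
  qed
  ultimately show ?thesis by blast
qed

lemma gram_correct:
  assumes tab: "tables \<sigma>" and off: "offsets \<sigma>"
  shows "\<exists>\<sigma>'. ex gram_com \<sigma> (20 * unit_cost * (m + 2)\<^sup>2 * (d + 2)) \<sigma>' \<and>
    frame {(0, 3), (0, 4), (0, 5)} ({(0, 5)} \<union> {2} \<times> UNIV) \<sigma> \<sigma>' \<and>
    (\<forall>j<m. \<forall>l<m. wk \<sigma>' (2, prod_encode (j, l)) = gram j l)"
proof -
  let ?u = unit_cost
  define A where "A = {(0 :: nat, 3 :: nat), (0, 4), (0, 5)}"
  define B where "B = {(0 :: nat, 5 :: nat)} \<union> {2} \<times> UNIV"
  have tt: "tables \<tau>" "offsets \<tau>" if "frame A B \<sigma> \<tau>" for \<tau>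
  proof -
    show "tables \<tau>" by (rule tables_frame[OF tab that]) (auto simp: A_def)
    show "offsets \<tau>" using off frame_na[OF that] by (simp add: offsets_def A_def)
  qed
  define J where "J j \<tau> \<longleftrightarrow> frame A B \<sigma> \<tau> \<and> (\<forall>a<j. \<forall>b<m. wk \<tau> (2, prod_encode (a, b)) = gram a b)" for j \<tau>
  define J' where "J' j l \<tau> \<longleftrightarrow> J j \<tau> \<and> na \<tau> (0, 3) = j \<and> (\<forall>b<l. wk \<tau> (2, prod_encode (j, b)) = gram j b)" for j l \<tau>
  define J2 where "J2 j l t \<tau> \<longleftrightarrow> J' j l \<tau> \<and> na \<tau> (0, 4) = l \<and>
    wk \<tau> (0, 5) = (\<Sum>t<t. inp (3 + j * d + t) * inp (3 + l * d + t))" for j l t \<tau>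
  let ?x = "RAdd (rreg 5) (RMul (coord (reg 3)) (coord (reg 4)))"
  have fJ: "frame A B \<sigma> \<tau>" if "J' j l \<tau>" for j l \<tau> using that by (simp add: J'_def J_def)
  have updJ: "J' j l (\<tau>\<lparr>na := (na \<tau>)(p := x)\<rparr>)" if "J' j l \<tau>" "p = (0, 4) \<or> p = (0, 5)" for j l \<tau> p x
    using that frame_upd_na[OF fJ[OF that(1)], of p x] by (auto simp: J'_def J_def A_def)
  have updW: "J' j l (\<tau>\<lparr>wk := (wk \<tau>)((0, 5) := x)\<rparr>)" if "J' j l \<tau>" for j l \<tau> x
    using that frame_upd_wk[OF fJ[OF that(1)], of "(0, 5)" x] by (auto simp: J'_def J_def B_def)
  have inner: "\<exists>\<sigma>'. ex (For 5 (reg 1) (setrreg 5 ?x)) \<tau> ((d + 2) * (?u + 2 * ?u)) \<sigma>' \<and> J2 j l d \<sigma>' \<and> na \<sigma>' (0, 5) = d"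
    if j: "j < m" and l: "l < m" and J2: "J2 j l 0 \<tau>" for j l \<tau>
  proof (rule ex_For)
    show "J2 j l 0 (\<tau>\<lparr>na := (na \<tau>)((0, 5) := 0)\<rparr>)" using J2 updJ by (auto simp: J2_def)
    show "nv (reg 1) \<tau> = d" if "J2 j l i \<tau>" for i \<tau>
      using that tt(1)[OF fJ[of j l \<tau>]] by (simp add: J2_def tables_def)
    fix t \<tau> assume t: "t < d" and J2: "J2 j l t \<tau>" and r: "na \<tau> (0, 5) = t"
    have J': "J' j l \<tau>" and r': "na \<tau> (0, 3) = j" "na \<tau> (0, 4) = l" using J2 by (auto simp: J2_def J'_def)
    note tb = tt[OF fJ[OF J']]
    have ad: "3 + a * d + t < W" if "a < m" for a
    proof -
      have "a * d + t < Suc a * d" using t by simp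
      also have "Suc a * d \<le> m * d" using that by (intro mult_le_mono1) simp
      finally show ?thesis by (simp add: W_def)
    qed
    have "rv (coord (reg 3)) \<tau> = inp (3 + j * d + t)"
      using rv_input[of "NAdd (NA 3 (reg 3)) (reg 5)" \<tau>] r r' tb j ad[OF j] by (simp add: coord_def offsets_def add.assoc)
    moreover have "rv (coord (reg 4)) \<tau> = inp (3 + l * d + t)"
      using rv_input[of "NAdd (NA 3 (reg 4)) (reg 5)" \<tau>] r r' tb l ad[OF l] by (simp add: coord_def offsets_def add.assoc)
    ultimately have v: "rv ?x \<tau> = (\<Sum>t<Suc t. inp (3 + j * d + t) * inp (3 + l * d + t))"
      using J2 tables_W[OF tb(1)] by (simp add: J2_def)
    let ?s = "\<tau>\<lparr>wk := (wk \<tau>)((0, 5) := rv ?x \<tau>)\<rparr>"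
    have e: "ex (setrreg 5 ?x) \<tau> ?u ?s"
      by (rule ex_setrreg[OF tables_W[OF tb(1)]]) (simp add: coord_def)
    have "J2 j l (Suc t) (?s\<lparr>na := (na ?s)((0, 5) := Suc t)\<rparr>)"
      using updJ[OF updW[OF J', of "rv ?x \<tau>"], of "(0, 5)" "Suc t"] r' v by (simp add: J2_def)
    with e r show "\<exists>\<sigma>'. ex (setrreg 5 ?x) \<tau> ?u \<sigma>' \<and> na \<sigma>' (0, 5) = t \<and> J2 j l (Suc t) (\<sigma>'\<lparr>na := (na \<sigma>')((0, 5) := Suc t)\<rparr>)"
      by (intro exI[of _ ?s]) simp
  qed auto
  define T where "T = ?u + ((d + 2) * (?u + 2 * ?u) + ?u)"
  have entry: "\<exists>\<sigma>'. ex gram_entry_com \<tau> T \<sigma>' \<and> na \<sigma>' (0, 4) = l \<and> J' j (Suc l) (\<sigma>'\<lparr>na := (na \<sigma>')((0, 4) := Suc l)\<rparr>)"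
    if j: "j < m" and l: "l < m" and J': "J' j l \<tau>" and r: "na \<tau> (0, 4) = l" for j l \<tau>
  proof -
    let ?s1 = "\<tau>\<lparr>wk := (wk \<tau>)((0, 5) := 0)\<rparr>"
    have e1: "ex (setrreg 5 (RC 0)) \<tau> ?u ?s1"
      using ex_setrreg[OF tables_W[OF tt(1)[OF fJ[OF J']]], of "RC 0" 5] by simp
    have "J2 j l 0 ?s1" using updW[OF J', of 0] r by (simp add: J2_def)
    from inner[OF j l this] obtain s2 where e2: "ex (For 5 (reg 1) (setrreg 5 ?x)) ?s1 ((d + 2) * (?u + 2 * ?u)) s2"
      and J2: "J2 j l d s2" by blast
    have J2': "J' j l s2" and r2: "na s2 (0, 3) = j" "na s2 (0, 4) = l" "wk s2 (0, 5) = gram j l"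
      using J2 by (auto simp: J2_def J'_def gram_def)
    note tb = tt[OF fJ[OF J2']]
    define s3 where "s3 = s2\<lparr>wk := (wk s2)((2, prod_encode (j, l)) := gram j l)\<rparr>"
    have e3: "ex (setW (NConst 2) (enc2 (reg 3) (reg 4)) (rreg 5)) s2 ?u s3"
      using ex_setW[OF tables_W[OF tb(1)], of "NConst 2" "enc2 (reg 3) (reg 4)" "rreg 5"] r2 j l
        nv_enc2[OF tb(1), of "reg 3" "reg 4"] tables_W[OF tb(1)]
      by (simp add: s3_def unit_cost_def)
    have "frame A B \<sigma> s3" unfolding s3_def using fJ[OF J2'] by (intro frame_upd_wk) (auto simp: B_def)
    then have "frame A B \<sigma> (s3\<lparr>na := (na s3)((0, 4) := Suc l)\<rparr>)" by (intro frame_upd_na) (auto simp: A_def)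
    then have "J' j (Suc l) (s3\<lparr>na := (na s3)((0, 4) := Suc l)\<rparr>)"
      using J2' by (auto simp: J'_def J_def s3_def less_Suc_eq)
    moreover have "ex gram_entry_com \<tau> T s3"
      unfolding gram_entry_com_def T_def by (rule ex_Seq[OF e1 ex_Seq[OF e2 e3]])
    moreover have "na s3 (0, 4) = l" using r2 by (simp add: s3_def)
    ultimately show ?thesis by blast
  qed
  have mid: "\<exists>\<sigma>'. ex (For 4 cM gram_entry_com) \<tau> ((m + 2) * (T + 2 * ?u)) \<sigma>' \<and> J' j m \<sigma>' \<and> na \<sigma>' (0, 4) = m"
    if j: "j < m" and J: "J j \<tau>" and r: "na \<tau> (0, 3) = j" for j \<tau>
  proof (rule ex_For)
    have "J' j 0 \<tau>" using J r by (simp add: J'_def)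
    then show "J' j 0 (\<tau>\<lparr>na := (na \<tau>)((0, 4) := 0)\<rparr>)" using updJ by blast
  qed (use entry[OF j] in auto)
  have "\<exists>\<sigma>'. ex gram_com \<sigma> ((m + 2) * ((m + 2) * (T + 2 * ?u) + 2 * ?u)) \<sigma>' \<and> J m \<sigma>' \<and> na \<sigma>' (0, 3) = m"
    unfolding gram_com_def
  proof (rule ex_For)
    show "J 0 (\<sigma>\<lparr>na := (na \<sigma>)((0, 3) := 0)\<rparr>)" by (simp add: J_def A_def frame_upd_na)
    fix j \<tau> assume "j < m" "J j \<tau>" "na \<tau> (0, 3) = j"
    from mid[OF this] obtain \<sigma>' where s: "ex (For 4 cM gram_entry_com) \<tau> ((m + 2) * (T + 2 * ?u)) \<sigma>'" "J' j m \<sigma>'" by blast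
    then have "frame A B \<sigma> (\<sigma>'\<lparr>na := (na \<sigma>')((0, 3) := Suc j)\<rparr>)" by (auto simp: J_def J'_def A_def intro!: frame_upd_na)
    then have "J (Suc j) (\<sigma>'\<lparr>na := (na \<sigma>')((0, 3) := Suc j)\<rparr>)"
      using s by (auto simp: J_def J'_def less_Suc_eq)
    with s show "\<exists>\<sigma>'. ex (For 4 cM gram_entry_com) \<tau> ((m + 2) * (T + 2 * ?u)) \<sigma>' \<and> na \<sigma>' (0, 3) = j \<and> J (Suc j) (\<sigma>'\<lparr>na := (na \<sigma>')((0, 3) := Suc j)\<rparr>)"
      by (auto simp: J'_def)
  qed auto
  then obtain \<sigma>' where e: "ex gram_com \<sigma> ((m + 2) * ((m + 2) * (T + 2 * ?u) + 2 * ?u)) \<sigma>'" and J: "J m \<sigma>'" by blast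
  have "(m + 2) * ((m + 2) * (T + 2 * ?u) + 2 * ?u) \<le> 20 * ?u * (m + 2)\<^sup>2 * (d + 2)"
    unfolding T_def by (simp add: power2_eq_square algebra_simps)
  from ex_mono[OF e this] show ?thesis using J unfolding J_def A_def B_def by blast
qed

end

section \<open>Parameters: the bound on the stored vectors and the choice of mode\<close>

definition lam_exp :: rexp where
  "lam_exp = RSub (RDiv (RC 1) (RC 2)) (RMul (RLoad (NConst 0)) (RSqrt (RLoad (NConst 1))))"

definition eps_exp :: rexp where
  "eps_exp = RLoad (NConst 2)"

definition const_com :: com where
  "const_com = Seq (setrreg 0 lam_exp) (Seq (setrreg 1 (RDiv eps_exp (RC 4)))
     (Seq (setrreg 2 (RMul (rreg 1) (rreg 0)))
     (Seq (setrreg 3 (RSub (RC 1) (RMul (RSub (RC 1) eps_exp) (rreg 0)))) (setrreg 4 (RC 1)))))"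

definition power_com :: com where
  "power_com = (let x = RDiv (RC 2) (rreg 0) in
     For 5 (reg 1) (setrreg 4 (RMul (rreg 4) (RMul (RMul x x) (RMul x x)))))"

definition oct_h :: nexp where "oct_h = NAdd (quad (reg 6)) (quad (reg 6))"

text \<open>Reals cannot be converted to naturals, so a logarithm cannot be rounded; the exponent is
  counted up alongside the power of 1 + \<delta>^2. The cut at m \<le> 8 h limits the loop to at
  most \<open>m\<close> rounds.\<close>

definition cap_com :: com where
  "cap_com = While (BAnd (RLess (rreg 8) (rreg 4)) (NLess oct_h cM))
     (Seq (setrreg 8 (RMul (rreg 8) (RAdd (RC 1) (RMul (rreg 1) (rreg 1))))) (setreg 6 (NAdd (reg 6) (NConst 1))))"

definition mode_com :: com where
  "mode_com = Cond (NLess oct_h cM) (setreg 7 (NAdd cM cM))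
     (Seq (setreg 12 (NConst 1)) (Seq (setreg 7 cM) (setreg 6 cM)))"

definition params_com :: com where
  "params_com = Seq const_com (Seq power_com (Seq (setrreg 8 (RC 1)) (Seq cap_com mode_com)))"

definition main_com :: com where
  "main_com = Seq offset_com (Seq gram_com (Seq params_com enum_com))"

text \<open>A nonzero cell 0 reports a set, and this cell already holds \<open>m\<close>; after the
  search only the negative answer has to be written. For \<rho> \<le> 0 whatever the cells 1, ..., m
  contain is a correct answer.\<close>

definition ks_com :: com where
  "ks_com = Cond (RLess (RC 0) lam_exp)
     (Seq main_com (Cond (NLess (NConst 1) (reg 15)) (NStore (NConst 0) (NConst 0)) (setreg 15 (NConst 1))))
     (NStore (NConst 0) (NConst 1))"

text \<open>The first alternative is the determinant bound on the number of stored vectors. The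
  second guarantees existence and marks the change of mode: for 8 h < m the number of candidates is
  controlled by \<open>m choose (2 * h)\<close>.\<close>

definition head_cap :: "real \<Rightarrow> real \<Rightarrow> nat \<Rightarrow> nat \<Rightarrow> nat" where
  "head_cap \<delta> \<rho> d m = (LEAST h. (2 / \<rho>) ^ (4 * d) \<le> (1 + \<delta>\<^sup>2) ^ h \<or> m \<le> 8 * h)"

lemma head_cap_le: "head_cap \<delta> \<rho> d m \<le> m"
  unfolding head_cap_def by (rule Least_le) simp

context ram
begin

definition lam :: real where "lam = 1 / 2 - inp 0 * sqrt (inp 1)"
definition dl :: real where "dl = inp 2 / 4"
definition mu :: real where "mu = 1 - (1 - inp 2) * lam"
definition hcap :: nat where "hcap = head_cap dl lam d m"
definition hlim :: nat where "hlim = (if 8 * hcap < m then hcap else m)"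
definition nbits :: nat where "nbits = (if 8 * hcap < m then 2 * m else m)"
definition brute :: nat where "brute = (if 8 * hcap < m then 0 else 1)"

lemma rv_lam: "rv lam_exp \<sigma> = lam"
  using rv_input[of "NConst 0" \<sigma>] rv_input[of "NConst 1" \<sigma>] by (simp add: lam_exp_def lam_def W_def)

lemma rv_eps: "rv eps_exp \<sigma> = inp 2"
  using rv_input[of "NConst 2" \<sigma>] by (simp add: eps_exp_def W_def)

lemma const_correct:
  assumes tab: "tables \<sigma>"
  shows "ex const_com \<sigma> (5 * unit_cost)
    (\<sigma>\<lparr>wk := (wk \<sigma>)((0, 0) := lam, (0, 1) := dl, (0, 2) := dl * lam, (0, 3) := mu, (0, 4) := 1)\<rparr>)"
proof -
  let ?u = unit_cost
  have st: "ex (setrreg j x) (\<sigma>\<lparr>wk := w\<rparr>) ?u (\<sigma>\<lparr>wk := w((0, j) := y)\<rparr>)"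
    if "rv x (\<sigma>\<lparr>wk := w\<rparr>) = y" "rcost x < 15000" for j x w y
    using ex_setrreg[of "\<sigma>\<lparr>wk := w\<rparr>" x j] tables_W[OF tab] that by simp
  let ?w1 = "(wk \<sigma>)((0, 0) := lam)"
  let ?w2 = "?w1((0, 1) := dl)"
  let ?w3 = "?w2((0, 2) := dl * lam)"
  let ?w4 = "?w3((0, 3) := mu)"
  have W: "na (\<sigma>\<lparr>wk := w\<rparr>) (0, 0) = W" for w using tables_W[OF tab] by simp
  have s: "\<sigma>\<lparr>wk := wk \<sigma>\<rparr> = \<sigma>" by simp
  have 1: "ex (setrreg 0 lam_exp) (\<sigma>\<lparr>wk := wk \<sigma>\<rparr>) ?u (\<sigma>\<lparr>wk := ?w1\<rparr>)"
    by (rule st) (simp_all add: rv_lam, simp add: lam_exp_def)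
  have 2: "ex (setrreg 1 (RDiv eps_exp (RC 4))) (\<sigma>\<lparr>wk := ?w1\<rparr>) ?u (\<sigma>\<lparr>wk := ?w2\<rparr>)"
    by (rule st) (simp_all add: rv_eps dl_def, simp add: eps_exp_def)
  have 3: "ex (setrreg 2 (RMul (rreg 1) (rreg 0))) (\<sigma>\<lparr>wk := ?w2\<rparr>) ?u (\<sigma>\<lparr>wk := ?w3\<rparr>)"
    by (rule st) (use rv_rreg[OF W] in simp_all)
  have 4: "ex (setrreg 3 (RSub (RC 1) (RMul (RSub (RC 1) eps_exp) (rreg 0)))) (\<sigma>\<lparr>wk := ?w3\<rparr>) ?u (\<sigma>\<lparr>wk := ?w4\<rparr>)"
    by (rule st) (use rv_rreg[OF W] in \<open>simp_all add: rv_eps mu_def\<close>, simp add: eps_exp_def)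
  have 5: "ex (setrreg 4 (RC 1)) (\<sigma>\<lparr>wk := ?w4\<rparr>) ?u (\<sigma>\<lparr>wk := ?w4((0, 4) := 1)\<rparr>)"
    by (rule st) simp_all
  show ?thesis
    using ex_Seq[OF 1 ex_Seq[OF 2 ex_Seq[OF 3 ex_Seq[OF 4 5]]]] unfolding const_com_def s
    by (rule ex_mono) simp
qed

lemma power_correct:
  assumes tab: "tables \<sigma>" and r: "wk \<sigma> (0, 0) = lam" "wk \<sigma> (0, 4) = 1"
  shows "\<exists>\<sigma>'. ex power_com \<sigma> ((d + 2) * (3 * unit_cost)) \<sigma>' \<and> frame {(0, 5)} {(0, 4)} \<sigma> \<sigma>' \<and>
    wk \<sigma>' (0, 4) = (2 / lam) ^ (4 * d)"
proof -
  let ?u = unit_cost and ?x = "RDiv (RC 2) (rreg 0)"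
  let ?e = "RMul (rreg 4) (RMul (RMul ?x ?x) (RMul ?x ?x))"
  define I where "I n \<tau> \<longleftrightarrow> frame {(0, 5)} {(0, 4)} \<sigma> \<tau> \<and> wk \<tau> (0, 4) = (2 / lam) ^ (4 * n)" for n \<tau>
  have tt: "tables \<tau>" if "I n \<tau>" for n \<tau>
    by (rule tables_frame[OF tab, of "{(0, 5)}" "{(0, 4)}"]) (use that in \<open>auto simp: I_def\<close>)
  have "\<exists>\<sigma>'. ex power_com \<sigma> ((d + 2) * (?u + 2 * ?u)) \<sigma>' \<and> I d \<sigma>' \<and> na \<sigma>' (0, 5) = d"
    unfolding power_com_def Let_def
  proof (rule ex_For)
    show "I 0 (\<sigma>\<lparr>na := (na \<sigma>)((0, 5) := 0)\<rparr>)" using r by (simp add: I_def frame_upd_na)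
    show "nv (reg 1) \<tau> = d" if "I i \<tau>" for i \<tau> using tt[OF that] by (simp add: tables_def)
    fix i \<tau> assume I: "I i \<tau>" and c: "na \<tau> (0, 5) = i"
    note W = tables_W[OF tt[OF I]]
    have "wk \<tau> (0, 0) = lam" using I r frame_wk[of "{(0, 5)}" "{(0, 4)}" \<sigma> \<tau> "(0, 0)"] by (simp add: I_def)
    then have "rv ?e \<tau> = (2 / lam) ^ (4 * i) * (2 / lam * (2 / lam) * (2 / lam * (2 / lam)))"
      using I W by (simp add: I_def)
    also have "\<dots> = (2 / lam) ^ (4 * Suc i)"
      unfolding mult_Suc_right power_add power4_eq_xxxx by (simp only: mult_ac)
    finally have v: "rv ?e \<tau> = (2 / lam) ^ (4 * Suc i)" .
    let ?s = "\<tau>\<lparr>wk := (wk \<tau>)((0, 4) := rv ?e \<tau>)\<rparr>"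
    have e: "ex (setrreg 4 ?e) \<tau> ?u ?s" by (rule ex_setrreg[OF W]) simp
    have "I (Suc i) (?s\<lparr>na := (na ?s)((0, 5) := Suc i)\<rparr>)" unfolding v using I by (auto simp: I_def frame_def)
    with e c show "\<exists>\<sigma>'. ex (setrreg 4 ?e) \<tau> ?u \<sigma>' \<and> na \<sigma>' (0, 5) = i \<and> I (Suc i) (\<sigma>'\<lparr>na := (na \<sigma>')((0, 5) := Suc i)\<rparr>)"
      by (intro exI[of _ ?s]) simp
  qed auto
  then show ?thesis unfolding I_def by auto
qed

lemma cap_correct:
  assumes "tables \<sigma>" "wk \<sigma> (0, 1) = dl" "wk \<sigma> (0, 4) = (2 / lam) ^ (4 * d)"
    "wk \<sigma> (0, 8) = (1 + dl\<^sup>2) ^ na \<sigma> (0, 6)" "na \<sigma> (0, 6) + n = hcap"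
  shows "\<exists>\<sigma>'. ex cap_com \<sigma> (n * (3 * unit_cost) + unit_cost) \<sigma>' \<and> frame {(0, 6)} {(0, 8)} \<sigma> \<sigma>' \<and> na \<sigma>' (0, 6) = hcap"
  using assms
proof (induction n arbitrary: \<sigma>)
  let ?u = unit_cost
  let ?P = "\<lambda>h. (2 / lam) ^ (4 * d) \<le> (1 + dl\<^sup>2) ^ h \<or> m \<le> 8 * h"
  let ?b = "BAnd (RLess (rreg 8) (rreg 4)) (NLess oct_h cM)"
  have b: "bcost ?b < ?u" by (simp add: unit_cost_def oct_h_def)
  have bv: "bv ?b \<sigma> \<longleftrightarrow> \<not> ?P (na \<sigma> (0, 6))"
    if "tables \<sigma>" "wk \<sigma> (0, 4) = (2 / lam) ^ (4 * d)" "wk \<sigma> (0, 8) = (1 + dl\<^sup>2) ^ na \<sigma> (0, 6)" for \<sigma>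
    using that tables_W[OF that(1)] by (auto simp: oct_h_def)
  {
    case 0
    have "?P hcap" unfolding hcap_def head_cap_def by (rule LeastI[of ?P m]) simp
    then have "\<not> bv ?b \<sigma>" using 0 bv by simp
    from ex_While_done[OF b this] show ?case using 0 unfolding cap_com_def by (intro exI[of _ \<sigma>]) auto
  next
    case (Suc n)
    note W = tables_W[OF Suc.prems(1)]
    have "na \<sigma> (0, 6) < hcap" using Suc.prems(5) by simp
    then have "\<not> ?P (na \<sigma> (0, 6))" unfolding hcap_def head_cap_def by (rule not_less_Least)
    then have bt: "bv ?b \<sigma>" using bv Suc.prems by simp
    let ?e = "RMul (rreg 8) (RAdd (RC 1) (RMul (rreg 1) (rreg 1)))"
    let ?s1 = "\<sigma>\<lparr>wk := (wk \<sigma>)((0, 8) := rv ?e \<sigma>)\<rparr>"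
    define s2 where "s2 = \<sigma>\<lparr>wk := (wk \<sigma>)((0, 8) := rv ?e \<sigma>), na := (na \<sigma>)((0, 6) := Suc (na \<sigma> (0, 6)))\<rparr>"
    have e1: "ex (setrreg 8 ?e) \<sigma> ?u ?s1" by (rule ex_setrreg[OF W]) simp
    have e2: "ex (setreg 6 (NAdd (reg 6) (NConst 1))) ?s1 ?u s2"
      using ex_setreg[of "NAdd (reg 6) (NConst 1)" 6 ?s1] by (simp add: s2_def)
    have v: "rv ?e \<sigma> = (1 + dl\<^sup>2) ^ Suc (na \<sigma> (0, 6))"
      using W Suc.prems by (simp add: power2_eq_square mult.commute)
    have "\<exists>\<sigma>'. ex cap_com s2 (n * (3 * ?u) + ?u) \<sigma>' \<and> frame {(0, 6)} {(0, 8)} s2 \<sigma>' \<and> na \<sigma>' (0, 6) = hcap"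
      by (rule Suc.IH) (use Suc.prems v in \<open>auto simp: s2_def tables_def\<close>)
    then obtain \<sigma>' where 3: "ex cap_com s2 (n * (3 * ?u) + ?u) \<sigma>'" "frame {(0, 6)} {(0, 8)} s2 \<sigma>'" "na \<sigma>' (0, 6) = hcap"
      by blast
    have "ex cap_com \<sigma> (?u + (?u + ?u) + (n * (3 * ?u) + ?u)) \<sigma>'"
      unfolding cap_com_def by (rule ex_While_step[OF b bt ex_Seq[OF e1 e2] 3(1)[unfolded cap_com_def]])
    then have "ex cap_com \<sigma> (Suc n * (3 * ?u) + ?u) \<sigma>'" by (rule ex_mono) simp
    moreover have "frame {(0, 6)} {(0, 8)} \<sigma> \<sigma>'" using 3(2) by (auto simp: frame_def s2_def)
    ultimately show ?case using 3(3) by blast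
  }
qed

lemma mode_correct:
  assumes "na \<sigma> (0, 6) = hcap" "na \<sigma> (0, 12) = 0"
  shows "ex mode_com \<sigma> (4 * unit_cost)
    (\<sigma>\<lparr>na := (na \<sigma>)((0, 12) := brute, (0, 7) := nbits, (0, 6) := hlim)\<rparr>)"
proof -
  let ?u = unit_cost
  have b: "bcost (NLess oct_h cM) < ?u" by (simp add: unit_cost_def oct_h_def)
  have bv: "bv (NLess oct_h cM) \<sigma> \<longleftrightarrow> 8 * hcap < m" using assms by (simp add: oct_h_def)
  show ?thesis
  proof (cases "8 * hcap < m")
    case True
    have e: "ex mode_com \<sigma> (?u + ?u) (\<sigma>\<lparr>na := (na \<sigma>)((0, 7) := 2 * m)\<rparr>)"
      unfolding mode_com_def using ex_setreg[of "NAdd cM cM" 7 \<sigma>] True bv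
      by (intro ex_Cond_True[OF _ b]) (simp_all add: mult_2)
    have "(na \<sigma>)((0, 12) := brute, (0, 7) := nbits, (0, 6) := hlim) = (na \<sigma>)((0, 7) := 2 * m)"
      using True assms by (auto simp: fun_eq_iff brute_def nbits_def hlim_def)
    then show ?thesis by (intro ex_eq[OF e]) simp_all
  next
    case False
    let ?s1 = "\<sigma>\<lparr>na := (na \<sigma>)((0, 12) := 1)\<rparr>"
    let ?s2 = "\<sigma>\<lparr>na := (na \<sigma>)((0, 12) := 1, (0, 7) := m)\<rparr>"
    have 1: "ex (setreg 12 (NConst 1)) \<sigma> ?u ?s1" using ex_setreg[of "NConst 1" 12 \<sigma>] by simp
    have 2: "ex (setreg 7 cM) ?s1 ?u ?s2" using ex_setreg[of cM 7 ?s1] by simp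
    have 3: "ex (setreg 6 cM) ?s2 ?u (\<sigma>\<lparr>na := (na \<sigma>)((0, 12) := 1, (0, 7) := m, (0, 6) := m)\<rparr>)"
      using ex_setreg[of cM 6 ?s2] by simp
    have "ex mode_com \<sigma> ((?u + (?u + ?u)) + ?u) (\<sigma>\<lparr>na := (na \<sigma>)((0, 12) := 1, (0, 7) := m, (0, 6) := m)\<rparr>)"
      unfolding mode_com_def using False bv by (intro ex_Cond_False[OF _ b ex_Seq[OF 1 ex_Seq[OF 2 3]]]) simp
    then show ?thesis using False by (elim ex_eq) (simp_all add: brute_def nbits_def hlim_def)
  qed
qed

lemma params_correct:
  assumes tab: "tables \<sigma>" and z: "na \<sigma> (0, 6) = 0" "na \<sigma> (0, 12) = 0"
    and G: "\<forall>j<m. \<forall>l<m. wk \<sigma> (2, prod_encode (j, l)) = gram j l"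
  shows "\<exists>\<sigma>'. ex params_com \<sigma> (20 * unit_cost * (m + 2) * (d + 2)) \<sigma>' \<and>
    frame {(0, 5), (0, 6), (0, 7), (0, 12)} ({0} \<times> UNIV) \<sigma> \<sigma>' \<and>
    ready dl (dl * lam) mu gram hlim nbits brute \<sigma>'"
proof -
  let ?u = unit_cost and ?F = "frame {(0, 5), (0, 6), (0, 7), (0, 12)} ({0} \<times> UNIV)"
  define s1 where "s1 = \<sigma>\<lparr>wk := (wk \<sigma>)((0, 0) := lam, (0, 1) := dl, (0, 2) := dl * lam, (0, 3) := mu, (0, 4) := 1)\<rparr>"
  have e1: "ex const_com \<sigma> (5 * ?u) s1" unfolding s1_def by (rule const_correct[OF tab])
  have F1: "?F \<sigma> s1" by (auto simp: frame_def s1_def)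
  have Ft: "tables \<tau>" if "?F \<sigma> \<tau>" for \<tau> by (rule tables_frame[OF tab that]) auto
  obtain s2 where e2: "ex power_com s1 ((d + 2) * (3 * ?u)) s2" and f2: "frame {(0, 5)} {(0, 4)} s1 s2"
    and v2: "wk s2 (0, 4) = (2 / lam) ^ (4 * d)"
    using power_correct[OF Ft[OF F1]] by (auto simp: s1_def)
  have F2: "?F \<sigma> s2" by (rule frame_trans[OF F1 f2]) auto
  define s3 where "s3 = s2\<lparr>wk := (wk s2)((0, 8) := 1)\<rparr>"
  have e3: "ex (setrreg 8 (RC 1)) s2 ?u s3"
    using ex_setrreg[OF tables_W[OF Ft[OF F2]], of "RC 1" 8] by (simp add: s3_def)
  have F3: "?F \<sigma> s3" unfolding s3_def by (rule frame_upd_wk[OF F2]) auto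
  have w2: "wk s2 (0, k) = wk s1 (0, k)" if "k \<noteq> 4" for k using frame_wk[OF f2] that by simp
  have n3: "na s3 (0, 6) = 0" "na s3 (0, 12) = 0" using frame_na[OF f2] z by (auto simp: s3_def s1_def)
  have "\<exists>\<sigma>'. ex cap_com s3 (hcap * (3 * ?u) + ?u) \<sigma>' \<and> frame {(0, 6)} {(0, 8)} s3 \<sigma>' \<and> na \<sigma>' (0, 6) = hcap"
    by (rule cap_correct[OF Ft[OF F3]]) (use n3 v2 w2 in \<open>auto simp: s3_def s1_def\<close>)
  then obtain s4 where e4: "ex cap_com s3 (hcap * (3 * ?u) + ?u) s4" and f4: "frame {(0, 6)} {(0, 8)} s3 s4"
    and h4: "na s4 (0, 6) = hcap" by blast
  have F4: "?F \<sigma> s4" by (rule frame_trans[OF F3 f4]) auto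
  define s5 where "s5 = s4\<lparr>na := (na s4)((0, 12) := brute, (0, 7) := nbits, (0, 6) := hlim)\<rparr>"
  have e5: "ex mode_com s4 (4 * ?u) s5"
    unfolding s5_def by (rule mode_correct) (use h4 n3 frame_na[OF f4] in auto)
  have F5: "?F \<sigma> s5" using F4 by (auto simp: frame_def s5_def)
  have "wk s5 (0, k) = wk s1 (0, k)" if "k \<noteq> 4" "k \<noteq> 8" for k
    using w2[OF that(1)] frame_wk[OF f4, of "(0, k)"] that by (simp add: s5_def s3_def)
  then have "ready dl (dl * lam) mu gram hlim nbits brute s5"
    using Ft[OF F5] G frame_wk[OF F5] by (auto simp: ready_def s1_def) (simp_all add: s5_def)
  moreover have "ex params_com \<sigma> (20 * ?u * (m + 2) * (d + 2)) s5"
    unfolding params_com_def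
  proof (rule ex_mono[OF ex_Seq[OF e1 ex_Seq[OF e2 ex_Seq[OF e3 ex_Seq[OF e4 e5]]]]])
    have "hcap * (3 * ?u) \<le> m * (3 * ?u)" unfolding hcap_def by (intro mult_le_mono1 head_cap_le)
    moreover have "5 * ?u + ((d + 2) * (3 * ?u) + (?u + (m * (3 * ?u) + ?u + 4 * ?u))) \<le> 20 * ?u * (m + 2) * (d + 2)"
      by (simp add: algebra_simps)
    ultimately show "5 * ?u + ((d + 2) * (3 * ?u) + (?u + (hcap * (3 * ?u) + ?u + 4 * ?u))) \<le> 20 * ?u * (m + 2) * (d + 2)"
      by linarith
  qed
  ultimately show ?thesis using F5 by blast
qed

lemma main_correct:
  assumes "ra \<sigma> 0 = d" "\<And>p. na \<sigma> p = 0" "m + d = n" "3 \<le> d"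
  defines "M \<equiv> card {Z. Z \<subseteq> {..<nbits} \<and> card Z \<le> hlim}"
  shows "\<exists>\<sigma>'. ex main_com \<sigma> (300 * unit_cost * M * n ^ 3) \<sigma>' \<and>
    (na \<sigma>' (0, 15) = 1 \<and> (\<exists>Z\<subseteq>{..<nbits}. card Z \<le> hlim \<and> passes dl (dl * lam) mu gram brute Z \<and>
        (\<forall>i<m. ra \<sigma>' i = 1 - chosen_side dl (dl * lam) mu gram brute Z i)) \<or>
     na \<sigma>' (0, 15) = 2 \<and> (\<forall>Z\<subseteq>{..<nbits}. card Z \<le> hlim \<longrightarrow> \<not> passes dl (dl * lam) mu gram brute Z))"
proof -
  let ?u = unit_cost
  obtain s1 where e1: "ex offset_com \<sigma> (20 * ?u * (m + 2)) s1" and t1: "tables s1" "offsets s1"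
    and f1: "frame ({(0, 0), (0, 1), (0, 2)} \<union> {2, 3} \<times> UNIV) {} \<sigma> s1"
    using offset_correct[OF assms(1,2)] by blast
  obtain s2 where e2: "ex gram_com s1 (20 * ?u * (m + 2)\<^sup>2 * (d + 2)) s2"
    and f2: "frame {(0, 3), (0, 4), (0, 5)} ({(0, 5)} \<union> {2} \<times> UNIV) s1 s2"
    and G2: "\<forall>j<m. \<forall>l<m. wk s2 (2, prod_encode (j, l)) = gram j l"
    using gram_correct[OF t1] by blast
  have t2: "tables s2" by (rule tables_frame[OF t1(1) f2]) auto
  have z2: "na s2 p = 0" if "p \<in> {(0, 6), (0, 8), (0, 12), (0, 15)} \<union> {1} \<times> UNIV" for p
    using that frame_na[OF f2, of p] frame_na[OF f1, of p] assms(2) by auto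
  obtain s3 where e3: "ex params_com s2 (20 * ?u * (m + 2) * (d + 2)) s3"
    and f3: "frame {(0, 5), (0, 6), (0, 7), (0, 12)} ({0} \<times> UNIV) s2 s3"
    and r3: "ready dl (dl * lam) mu gram hlim nbits brute s3"
    using params_correct[OF t2 _ _ G2] z2 by auto
  have z3: "bits {} s3" "na s3 (0, 8) = card ({} :: nat set)" "na s3 (0, 15) = 0"
    using frame_na[OF f3] z2 by (auto simp: bits_def)
  let ?N = "{Z. Z \<subseteq> {..<nbits} \<and> card Z \<le> hlim \<and> {} \<lless> Z}"
  have fM: "finite {Z. Z \<subseteq> {..<nbits} \<and> card Z \<le> hlim}" by (rule finite_subset[of _ "Pow {..<nbits}"]) auto
  have "?N \<subset> {Z. Z \<subseteq> {..<nbits} \<and> card Z \<le> hlim}" using set_less_irrefl[of "{}"] by auto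
  \<comment> \<open>The search starts at the empty set, itself a candidate but not below itself,
    which accounts for the 1.\<close>
  then have NM: "card ?N + 1 \<le> M" unfolding M_def using psubset_card_mono[OF fM] by (simp add: Suc_le_eq)
  have "nbits \<le> 2 * m" by (simp add: nbits_def)
  from enum_correct[OF r3 z3(1) _ _ z3(2,3) this refl] obtain s4 where
    e4: "ex enum_com s3 ((card ?N + 1) * enum_time + ?u) s4"
    and res: "na s4 (0, 15) = 1 \<and> (\<exists>Z\<subseteq>{..<nbits}. card Z \<le> hlim \<and> passes dl (dl * lam) mu gram brute Z \<and>
        (\<forall>i<m. ra s4 i = 1 - chosen_side dl (dl * lam) mu gram brute Z i)) \<or>
     na s4 (0, 15) = 2 \<and> (\<forall>Z\<subseteq>{..<nbits}. card Z \<le> hlim \<and> (Z = {} \<or> {} \<lless> Z) \<longrightarrow> \<not> passes dl (dl * lam) mu gram brute Z)"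
    by auto
  have "Z = {} \<or> {} \<lless> Z" if "Z \<subseteq> {..<nbits}" for Z
    using set_less_total[of "{}" Z] finite_subset[OF that] by (auto simp: set_less_def)
  then have res': "na s4 (0, 15) = 1 \<and> (\<exists>Z\<subseteq>{..<nbits}. card Z \<le> hlim \<and> passes dl (dl * lam) mu gram brute Z \<and>
        (\<forall>i<m. ra s4 i = 1 - chosen_side dl (dl * lam) mu gram brute Z i)) \<or>
     na s4 (0, 15) = 2 \<and> (\<forall>Z\<subseteq>{..<nbits}. card Z \<le> hlim \<longrightarrow> \<not> passes dl (dl * lam) mu gram brute Z)"
    using res by blast
  have e: "ex main_com \<sigma> (20 * ?u * (m + 2) + (20 * ?u * (m + 2)\<^sup>2 * (d + 2) + (20 * ?u * (m + 2) * (d + 2) + ((card ?N + 1) * enum_time + ?u)))) s4"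
    unfolding main_com_def by (rule ex_Seq[OF e1 ex_Seq[OF e2 ex_Seq[OF e3 e4]]])
  have "20 * ?u * (m + 2) + (20 * ?u * (m + 2)\<^sup>2 * (d + 2) + (20 * ?u * (m + 2) * (d + 2) + ((card ?N + 1) * enum_time + ?u))) \<le> 300 * ?u * M * n ^ 3"
  proof -
    have n: "m + 2 \<le> n" "d + 2 \<le> 2 * n" "1 \<le> n" using assms(3,4) by auto
    have M1: "1 \<le> M" using NM by simp
    have p: "n \<le> n ^ 3" "n * n \<le> n ^ 3" "1 \<le> n ^ 3"
      using n(3) power_increasing[of 1 3 n] power_increasing[of 2 3 n] by (simp_all add: power2_eq_square)
    have "20 * ?u * (m + 2) \<le> 20 * ?u * n ^ 3" using n p by (intro mult_le_mono) auto
    moreover have "20 * ?u * (m + 2)\<^sup>2 * (d + 2) \<le> 20 * ?u * (n\<^sup>2) * (2 * n)"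
      using n by (intro mult_le_mono power_mono) auto
    moreover have "20 * ?u * (n\<^sup>2) * (2 * n) = 40 * ?u * n ^ 3" by (simp add: power2_eq_square power3_eq_cube)
    moreover have "20 * ?u * (m + 2) * (d + 2) \<le> 20 * ?u * n * (2 * n)" using n by (intro mult_le_mono) auto
    moreover have "20 * ?u * n * (2 * n) \<le> 40 * ?u * n ^ 3" using p(2) by simp
    moreover have "(card ?N + 1) * enum_time \<le> M * (110 * ?u * n ^ 3)"
      unfolding enum_time_def using NM n by (intro mult_le_mono power_mono) auto
    moreover have "?u \<le> ?u * n ^ 3" using p by simp
    moreover have "101 * (?u * n ^ 3) \<le> 101 * (?u * n ^ 3) * M" using M1 by simp
    moreover have "M * (110 * ?u * n ^ 3) + 101 * (?u * n ^ 3) * M \<le> 300 * ?u * M * n ^ 3" by (simp add: algebra_simps)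
    ultimately show ?thesis by linarith
  qed
  from ex_mono[OF e this] show ?thesis using res' by blast
qed

end

section \<open>Running time and correctness\<close>

lemma binomial_Suc_mult: "Suc k * (n choose Suc k) = (n - k) * (n choose k)"
  using binomial_absorption[of k n] binomial_absorb_comp[of n k] by simp

text \<open>The quotients of consecutive coefficients differ by the factor (2 m - j) / (m - j),
  which is at most 3 if 2 j \<le> m.\<close>

lemma binomial_double_le: "2 * j \<le> m \<Longrightarrow> (2 * m choose j) \<le> 3 ^ j * (m choose j)"
proof (induction j)
  case (Suc j)
  have "Suc j * (2 * m choose Suc j) = (2 * m - j) * (2 * m choose j)" by (rule binomial_Suc_mult)
  also have "\<dots> \<le> (3 * (m - j)) * (3 ^ j * (m choose j))"
    using Suc by (intro mult_le_mono) auto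
  also have "\<dots> = 3 ^ Suc j * ((m - j) * (m choose j))" by simp
  also have "\<dots> = 3 ^ Suc j * (Suc j * (m choose Suc j))" by (simp only: binomial_Suc_mult)
  also have "\<dots> = Suc j * (3 ^ Suc j * (m choose Suc j))" by (simp only: mult_ac)
  finally show ?case by (simp only: Suc_mult_le_cancel1)
qed simp

text \<open>Each step multiplies the coefficient by (m - k) / (k + 1), which is at least 3 while 4
  (k + 1) \<le> m.\<close>

lemma binomial_grow: "4 * (h + i) \<le> m \<Longrightarrow> 3 ^ i * (m choose h) \<le> (m choose (h + i))"
proof (induction i)
  case (Suc i)
  let ?k = "h + i"
  have "Suc ?k * (3 ^ Suc i * (m choose h)) = (3 * Suc ?k) * (3 ^ i * (m choose h))"
    by (simp only: power_Suc mult_ac)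
  also have "\<dots> \<le> (m - ?k) * (m choose ?k)" using Suc by (intro mult_le_mono) auto
  also have "\<dots> = Suc ?k * (m choose Suc ?k)" by (rule binomial_Suc_mult[symmetric])
  finally show ?case by (simp only: Suc_mult_le_cancel1 add_Suc_right)
qed simp

lemma card_bounded_subsets:
  assumes "2 * h \<le> n"
  shows "card {Z. Z \<subseteq> {..<n} \<and> card Z \<le> h} \<le> Suc h * (n choose h)"
proof -
  have "{Z. Z \<subseteq> {..<n} \<and> card Z \<le> h} = (\<Union>j\<in>{..h}. {Z. Z \<subseteq> {..<n} \<and> card Z = j})" by auto
  then have "card {Z. Z \<subseteq> {..<n} \<and> card Z \<le> h} \<le> (\<Sum>j\<in>{..h}. card {Z. Z \<subseteq> {..<n} \<and> card Z = j})"
    using card_UN_le[of "{..h}" "\<lambda>j. {Z. Z \<subseteq> {..<n} \<and> card Z = j}"] by simp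
  also have "\<dots> = (\<Sum>j\<le>h. n choose j)" by (simp add: n_subsets)
  also have "\<dots> \<le> (\<Sum>j\<le>h. n choose h)" using assms by (intro sum_mono binomial_mono) auto
  finally show ?thesis by simp
qed

text \<open>The \<open>n\<close> of the running time. In the sparse mode h further elements pay for
  the factor 3^h that colours and doubled positions cost; in the exhaustive mode the central
  coefficient is within a factor m + 1 of 2^m.\<close>

definition sparsity :: "nat \<Rightarrow> nat \<Rightarrow> nat" where
  "sparsity h m = (if 8 * h < m then 2 * h else m div 2)"

lemma candidates_le:
  assumes "h \<le> m"
  shows "card {Z. Z \<subseteq> {..<(if 8 * h < m then 2 * m else m)} \<and> card Z \<le> (if 8 * h < m then h else m)}
    \<le> Suc m * (m choose sparsity h m)"
proof (cases "8 * h < m")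
  case True
  have "card {Z. Z \<subseteq> {..<2 * m} \<and> card Z \<le> h} \<le> Suc h * (2 * m choose h)"
    using assms by (intro card_bounded_subsets) simp
  also have "\<dots> \<le> Suc m * (3 ^ h * (m choose h))"
    using assms True by (intro mult_le_mono binomial_double_le) auto
  also have "\<dots> \<le> Suc m * (m choose (h + h))"
    using True by (intro mult_le_mono2 binomial_grow) simp
  finally show ?thesis using True by (simp add: sparsity_def mult_2)
next
  case False
  have "card {Z. Z \<subseteq> {..<m} \<and> card Z \<le> m} \<le> card (Pow {..<m})" by (intro card_mono) auto
  also have "\<dots> = (\<Sum>k\<le>m. m choose k)" by (simp add: card_Pow choose_row_sum)
  also have "\<dots> \<le> (\<Sum>k\<le>m. m choose (m div 2))" by (intro sum_mono binomial_maximum)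
  finally show ?thesis using False by (simp add: sparsity_def)
qed

text \<open>For h > 0 minimality says that the determinant bound fails at h - 1. With ln (1 +
  \<delta>^2) \<ge> \<delta>^2 / 2 = \<epsilon>^2 / 32 and ln (2 / \<rho>) \<le> 2 ln (1 / \<rho>)
  this gives h - 1 \<le> 256 Y, and Y \<ge> 1 absorbs the 1. In both modes n \<le> 4 h, and 4 times
  257 is below 1100.\<close>

lemma head_cap_bound:
  fixes \<epsilon> \<rho> :: real
  assumes "0 < \<epsilon>" "\<epsilon> < 1" "0 < \<rho>" "\<rho> < 1 / 2" "3 \<le> d"
  shows "real (sparsity (head_cap (\<epsilon> / 4) \<rho> d m) m) \<le> 1100 * (real d / \<epsilon>\<^sup>2 * ln (1 / \<rho>))"
proof -
  let ?h = "head_cap (\<epsilon> / 4) \<rho> d m" and ?\<delta> = "\<epsilon> / 4"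
  define Y where "Y = real d / \<epsilon>\<^sup>2 * ln (1 / \<rho>)"
  have l2: "ln 2 \<le> ln (1 / \<rho>)" using assms by (subst ln_le_cancel_iff) (auto simp: field_simps)
  have "ln (2 :: real) \<ge> 1 / 2" using ln_one_minus_pos_upper_bound[of "1/2"] by (simp add: ln_div)
  then have l: "ln (1 / \<rho>) \<ge> 1 / 2" using l2 by simp
  have Y1: "Y \<ge> 1"
  proof -
    have "\<epsilon>\<^sup>2 \<le> 1" using assms by (simp add: power_le_one)
    then have "real d / \<epsilon>\<^sup>2 \<ge> 3" using assms by (simp add: field_simps)
    then have "real d / \<epsilon>\<^sup>2 * ln (1 / \<rho>) \<ge> 3 * (1 / 2)" using l by (intro mult_mono) auto
    then show ?thesis unfolding Y_def by linarith
  qed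
  have "real ?h \<le> 257 * Y"
  proof (cases "?h = 0")
    case True
    then show ?thesis using Y1 by simp
  next
    case False
    then have "?h - 1 < ?h" by simp
    then have "\<not> ((2 / \<rho>) ^ (4 * d) \<le> (1 + ?\<delta>\<^sup>2) ^ (?h - 1) \<or> m \<le> 8 * (?h - 1))"
      unfolding head_cap_def by (rule not_less_Least)
    then have "(1 + ?\<delta>\<^sup>2) ^ (?h - 1) < (2 / \<rho>) ^ (4 * d)" by simp
    then have "ln ((1 + ?\<delta>\<^sup>2) ^ (?h - 1)) < ln ((2 / \<rho>) ^ (4 * d))"
      using assms by (subst ln_less_cancel_iff) (auto intro!: zero_less_power add_pos_nonneg)
    then have 1: "real (?h - 1) * ln (1 + ?\<delta>\<^sup>2) < real (4 * d) * ln (2 / \<rho>)"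
      using assms by (simp add: ln_realpow add_pos_nonneg)
    have d1: "?\<delta>\<^sup>2 \<le> 1 / 2"
    proof -
      have "?\<delta>\<^sup>2 \<le> (1 / 4)\<^sup>2" using assms by (intro power_mono) auto
      then show ?thesis by (simp add: power2_eq_square)
    qed
    have "?\<delta>\<^sup>2 - (?\<delta>\<^sup>2)\<^sup>2 \<le> ln (1 + ?\<delta>\<^sup>2)" using d1 by (intro ln_one_plus_pos_lower_bound) auto
    moreover have "(?\<delta>\<^sup>2)\<^sup>2 \<le> ?\<delta>\<^sup>2 / 2"
      using mult_left_mono[OF d1, of "?\<delta>\<^sup>2"] by (simp add: power2_eq_square)
    ultimately have "?\<delta>\<^sup>2 / 2 \<le> ln (1 + ?\<delta>\<^sup>2)" by simp
    then have 2: "real (?h - 1) * (?\<delta>\<^sup>2 / 2) \<le> real (?h - 1) * ln (1 + ?\<delta>\<^sup>2)" by (intro mult_left_mono) auto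
    have "ln (2 / \<rho>) = ln 2 + ln (1 / \<rho>)" using assms by (simp add: ln_div)
    then have "real (4 * d) * ln (2 / \<rho>) \<le> real (4 * d) * (2 * ln (1 / \<rho>))"
      using l2 by (intro mult_left_mono) auto
    then have "real (?h - 1) * (?\<delta>\<^sup>2 / 2) \<le> 8 * real d * ln (1 / \<rho>)" using 1 2 by simp
    then have "real (?h - 1) \<le> 256 * Y"
      using assms by (simp add: Y_def field_simps power2_eq_square)
    then show ?thesis using Y1 False by simp
  qed
  moreover have "sparsity ?h m \<le> 4 * ?h" by (auto simp: sparsity_def)
  then have "real (sparsity ?h m) \<le> 4 * real ?h" by simp
  ultimately show ?thesis using Y1 by (simp add: Y_def)
qed

section \<open>Soundness and completeness of the search\<close>

context ks
begin

lemma accepted_cong: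
  assumes "\<And>i. i < m \<Longrightarrow> b i = b' i" "accepted b"
  shows "accepted b'"
  unfolding accepted_def
proof (intro allI impI)
  fix i assume i: "i < m"
  have "decode b i = decode b' i" using assms(1) i by (intro decode_cong) auto
  moreover have "side b i = side b' i" using assms(1) i by (intro side_cong) auto
  ultimately show "decode b' i (side b' i + 2) i i < 1"
    using assms(2)[unfolded accepted_def, rule_format, OF i] by simp
qed

text \<open>The slack \<epsilon> \<rho> turns the non-strict bounds of a given \<open>S\<close> into
  the strict ones of the test.\<close>

lemma mu_gt: "1 - \<rho> < \<mu>"
  using lam eps by (simp add: \<mu>_def algebra_simps)

lemma sum_sides:
  assumes "x \<in> carrier_vec d"
  shows "(\<Sum>i | i < m \<and> side b i = 0. (v i \<bullet> x)\<^sup>2) + (\<Sum>i | i < m \<and> side b i = 1. (v i \<bullet> x)\<^sup>2) = x \<bullet> x"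
proof -
  have "{..<m} = {i. i < m \<and> side b i = 0} \<union> {i. i < m \<and> side b i = 1}"
    using side_less[of b] by (auto simp: less_2_cases_iff)
  then have "(\<Sum>i<m. (v i \<bullet> x)\<^sup>2) = (\<Sum>i | i < m \<and> side b i = 0. (v i \<bullet> x)\<^sup>2) + (\<Sum>i | i < m \<and> side b i = 1. (v i \<bullet> x)\<^sup>2)"
    by (simp add: sum.union_disjoint disjoint_iff)
  then show ?thesis using tight[OF assms] by simp
qed

text \<open>The lower bound holds because the other class stays below \<mu>. The upper bound uses
  \<mu> \<le> (1 + \<epsilon>) (1 - \<rho>), which amounts to \<rho> \<le> 1/2.\<close>

lemma accepted_between:
  assumes "accepted b" "x \<in> carrier_vec d" "x \<bullet> x = 1"
  shows "(1 - \<epsilon>) * \<rho> \<le> (\<Sum>i | i < m \<and> side b i = 0. (v i \<bullet> x)\<^sup>2)"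
    and "(\<Sum>i | i < m \<and> side b i = 0. (v i \<bullet> x)\<^sup>2) \<le> (1 + \<epsilon>) * (1 - \<rho>)"
proof -
  have x: "x \<noteq> 0\<^sub>v d" using assms by auto
  have 0: "(\<Sum>i | i < m \<and> side b i = 0. (v i \<bullet> x)\<^sup>2) < \<mu>"
    and 1: "(\<Sum>i | i < m \<and> side b i = 1. (v i \<bullet> x)\<^sup>2) < \<mu>"
    using accepted_bound[OF assms(1) _ assms(2) x] assms(3) by simp_all
  show "(1 - \<epsilon>) * \<rho> \<le> (\<Sum>i | i < m \<and> side b i = 0. (v i \<bullet> x)\<^sup>2)"
    using sum_sides[OF assms(2), of b] 1 assms(3) by (simp add: \<mu>_def)
  have "\<mu> \<le> (1 + \<epsilon>) * (1 - \<rho>)"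
    using mult_left_mono[OF lam(2), of "2 * \<epsilon>"] eps by (simp add: \<mu>_def algebra_simps)
  then show "(\<Sum>i | i < m \<and> side b i = 0. (v i \<bullet> x)\<^sup>2) \<le> (1 + \<epsilon>) * (1 - \<rho>)" using 0 by simp
qed

text \<open>In exhaustive mode \<open>S\<close> itself is the bit set. Otherwise the encoder runs on
  the partition given by \<open>S\<close>, and its symbols are laid out as bits. The decoded class
  may differ from \<open>S\<close> but passes the test, and the determinant bound limits the number
  of bits to \<open>h\<close>.\<close>

lemma passing_candidate:
  assumes S: "S \<subseteq> {..<m}"
    and bd: "\<And>x. x \<in> carrier_vec d \<Longrightarrow> \<rho> * (x \<bullet> x) \<le> (\<Sum>i\<in>S. (v i \<bullet> x)\<^sup>2)"
      "\<And>x. x \<in> carrier_vec d \<Longrightarrow> (\<Sum>i\<in>S. (v i \<bullet> x)\<^sup>2) \<le> (1 - \<rho>) * (x \<bullet> x)"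
    and h: "h = head_cap \<delta> \<rho> d m"
  shows "\<exists>Z\<subseteq>{..<(if 8 * h < m then 2 * m else m)}. card Z \<le> (if 8 * h < m then h else m) \<and>
    accepted (bit_symbol m (if 8 * h < m then 0 else 1) Z)"
proof (cases "8 * h < m")
  case False
  define b where "b = bit_symbol m 1 S"
  have sd: "side b i = (if i \<in> S then 0 else 1)" for i by (simp add: b_def side_def dec_side_def bit_symbol_def)
  have "accepted b"
  proof (rule accepted_intro)
    fix a and x :: "real Matrix.vec" assume a: "a < (2 :: nat)" and x: "x \<in> carrier_vec d" "x \<noteq> 0\<^sub>v d"
    have "(\<Sum>i | i < m \<and> side b i = 0. (v i \<bullet> x)\<^sup>2) = (\<Sum>i\<in>S. (v i \<bullet> x)\<^sup>2)"
      using S by (intro sum.cong) (auto simp: sd)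
    then have "(\<Sum>i | i < m \<and> side b i = a. (v i \<bullet> x)\<^sup>2) \<le> (1 - \<rho>) * (x \<bullet> x)"
      using bd[OF x(1)] sum_sides[OF x(1), of b] a by (auto simp: less_2_cases_iff algebra_simps)
    also have "\<dots> < \<mu> * (x \<bullet> x)" using mu_gt self_pos[OF x] by simp
    finally show "(\<Sum>i | i < m \<and> side b i = a. (v i \<bullet> x)\<^sup>2) < \<mu> * (x \<bullet> x)" .
  qed
  moreover have "card S \<le> m" using card_mono[OF _ S] by simp
  ultimately show ?thesis using False S by (intro exI[of _ S]) (simp add: b_def)
next
  case True
  define t where "t i = (if i \<in> S then 0 else 1 :: nat)" for i
  have t: "t i < 2" for i by (simp add: t_def)
  obtain b e w where enc: "encodes t m b e w" using encoder_exists[of t m] t by blast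
  have sumS: "(\<Sum>i<m. of_bool (t i = a) * (v i \<bullet> x)\<^sup>2)
     = (if a = 0 then (\<Sum>i\<in>S. (v i \<bullet> x)\<^sup>2) else x \<bullet> x - (\<Sum>i\<in>S. (v i \<bullet> x)\<^sup>2))"
    if "a < 2" "x \<in> carrier_vec d" for a x
  proof -
    have "(\<Sum>i<m. of_bool (i \<in> S) * (v i \<bullet> x)\<^sup>2) = (\<Sum>i\<in>S. (v i \<bullet> x)\<^sup>2)"
      using S by (intro sum.mono_neutral_cong_right) auto
    moreover have "(\<Sum>i<m. of_bool (i \<notin> S) * (v i \<bullet> x)\<^sup>2) = (\<Sum>i<m. (v i \<bullet> x)\<^sup>2 - of_bool (i \<in> S) * (v i \<bullet> x)\<^sup>2)"
      by (intro sum.cong) auto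
    ultimately show ?thesis
      using that tight[OF that(2)] by (auto simp: t_def less_2_cases_iff sum_subtractf)
  qed
  have acc: "accepted b"
  proof (rule encodes_accepted[of t b e w, OF enc t])
    fix a and x :: "real Matrix.vec" assume ax: "a < (2 :: nat)" "x \<in> carrier_vec d"
    show "\<rho> * (x \<bullet> x) \<le> (\<Sum>i<m. of_bool (t i = a) * (v i \<bullet> x)\<^sup>2)"
      unfolding sumS[OF ax] using bd[OF ax(2)] by (simp add: algebra_simps)
  qed
  have b2: "b i \<le> 2" for i using enc by (simp add: encodes_def)
  define Z where "Z = {i. i < m \<and> b i = 1} \<union> (+) m ` {i. i < m \<and> b i = 2}"
  have "bit_symbol m 0 Z i = b i" if "i < m" for i
    using that b2[of i] by (auto simp: bit_symbol_def Z_def)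
  then have "accepted (bit_symbol m 0 Z)" using accepted_cong[OF _ acc] by simp
  moreover have "Z \<subseteq> {..<2 * m}" by (auto simp: Z_def)
  moreover have "card Z \<le> h"
  proof -
    have "card Z \<le> card {i. i < m \<and> b i = 1} + card ((+) m ` {i. i < m \<and> b i = 2})"
      unfolding Z_def by (rule card_Un_le)
    also have "\<dots> = card {i. i < m \<and> b i = 1} + card {i. i < m \<and> b i = 2}" by (simp add: card_image)
    also have "\<dots> = card ({i. i < m \<and> b i = 1} \<union> {i. i < m \<and> b i = 2})"
      by (subst card_Un_disjoint) auto
    also have "{i. i < m \<and> b i = 1} \<union> {i. i < m \<and> b i = 2} = {i. i < m \<and> b i \<noteq> 0}"
    proof -
      have "b i = 1 \<or> b i = 2 \<longleftrightarrow> b i \<noteq> 0" for i using b2[of i] by linarith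
      then show ?thesis by blast
    qed
    finally have 1: "card Z \<le> card {i. i < m \<and> b i \<noteq> 0}" .
    have "(2 / \<rho>) ^ (4 * d) \<le> (1 + \<delta>\<^sup>2) ^ h \<or> m \<le> 8 * h"
      unfolding h head_cap_def by (rule LeastI[of _ m]) simp
    then have "(1 + \<delta>\<^sup>2) ^ card {i. i < m \<and> b i \<noteq> 0} \<le> (1 + \<delta>\<^sup>2) ^ h"
      using True encodes_card[of t b e w, OF enc t] by linarith
    then have "card {i. i < m \<and> b i \<noteq> 0} \<le> h"
      using delta(1) by (subst (asm) power_increasing_iff) simp_all
    then show ?thesis using 1 by simp
  qed
  ultimately show ?thesis using True by auto
qed

end

section \<open>From the input format to the decoder\<close>

lemma unit_vecs_scale:
  assumes bd: "\<And>x. x \<in> unit_vecs d \<Longrightarrow> l \<le> (\<Sum>i\<in>S. (v i \<bullet> x)\<^sup>2) \<and> (\<Sum>i\<in>S. (v i \<bullet> x)\<^sup>2) \<le> u"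
    and v: "\<And>i. i \<in> S \<Longrightarrow> v i \<in> carrier_vec d" and x: "x \<in> carrier_vec d"
  shows "l * (x \<bullet> x) \<le> (\<Sum>i\<in>S. (v i \<bullet> x)\<^sup>2) \<and> (\<Sum>i\<in>S. (v i \<bullet> x)\<^sup>2) \<le> u * (x \<bullet> x :: real)"
proof (cases "x = 0\<^sub>v d")
  case True
  then show ?thesis using v by simp
next
  case False
  \<comment> \<open>A family without vectors, from which the positivity of
    \<open>x \<bullet> x\<close> is drawn.\<close>
  interpret vectors d 0 "\<lambda>_. 0\<^sub>v d" by unfold_locales simp
  have q: "x \<bullet> x > 0"
    using admissible_quad_form_pos[of 1 0 "\<lambda>_. 0" x] x False by (simp add: admissible_def)
  define r where "r = 1 / sqrt (x \<bullet> x)"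
  have r2: "r\<^sup>2 = 1 / (x \<bullet> x)" using q by (simp add: r_def power_divide)
  have "(r \<cdot>\<^sub>v x) \<bullet> (r \<cdot>\<^sub>v x) = r\<^sup>2 * (x \<bullet> x)"
    using x by (simp add: power2_eq_square)
  then have "r \<cdot>\<^sub>v x \<in> unit_vecs d" using x q by (simp add: unit_vecs_def r2)
  from bd[OF this] have "l \<le> (\<Sum>i\<in>S. r\<^sup>2 * (v i \<bullet> x)\<^sup>2) \<and> (\<Sum>i\<in>S. r\<^sup>2 * (v i \<bullet> x)\<^sup>2) \<le> u"
    using v x by (simp add: power_mult_distrib cong: sum.cong)
  moreover define T where "T = (\<Sum>i\<in>S. (v i \<bullet> x)\<^sup>2)"
  moreover have "(\<Sum>i\<in>S. r\<^sup>2 * (v i \<bullet> x)\<^sup>2) = T / (x \<bullet> x)"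
    unfolding T_def r2 by (simp add: sum_divide_distrib)
  ultimately have "l \<le> T / (x \<bullet> x) \<and> T / (x \<bullet> x) \<le> u" by simp
  then show ?thesis using q unfolding T_def[symmetric] by (simp add: field_simps)
qed

text \<open>Beyond the list \<open>!\<close> is unspecified. Padding with zero vectors makes the
  identities between kernels hold for all indices and agrees with the memory after the input, which
  is 0.\<close>

definition ks_vec :: "nat \<Rightarrow> real Matrix.vec list \<Rightarrow> nat \<Rightarrow> real Matrix.vec" where
  "ks_vec d vs i = (if i < length vs then vs ! i else 0\<^sub>v d)"

lemma ks_vec_carrier: "ks_instance \<alpha> d vs \<Longrightarrow> ks_vec d vs i \<in> carrier_vec d"
  by (auto simp: ks_instance_def ks_vec_def)

lemma ks_instance_tight:
  assumes "ks_instance \<alpha> d vs" "x \<in> carrier_vec d"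
  shows "(\<Sum>i<length vs. (ks_vec d vs i \<bullet> x)\<^sup>2) = x \<bullet> x"
proof -
  have "(\<Sum>i<length vs. (ks_vec d vs i \<bullet> y)\<^sup>2) = (\<Sum>i<length vs. (vs ! i \<bullet> y)\<^sup>2)" for y
    by (intro sum.cong) (auto simp: ks_vec_def)
  then have "1 * (x \<bullet> x) \<le> (\<Sum>i<length vs. (ks_vec d vs i \<bullet> x)\<^sup>2) \<and> (\<Sum>i<length vs. (ks_vec d vs i \<bullet> x)\<^sup>2) \<le> 1 * (x \<bullet> x)"
    using assms ks_vec_carrier[OF assms(1)] by (intro unit_vecs_scale) (auto simp: ks_instance_def)
  then show ?thesis by simp
qed

lemma ks_instance_nonempty:
  assumes "ks_instance \<alpha> d vs" "3 \<le> d"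
  shows "0 < length vs"
proof (rule ccontr)
  assume "\<not> 0 < length vs"
  then have "unit_vec d 0 \<bullet> (unit_vec d 0 :: real Matrix.vec) = 0"
    using ks_instance_tight[OF assms(1), of "unit_vec d 0"] by simp
  then show False using assms(2) by simp
qed

lemma ks_between_sum:
  "S \<subseteq> {..<length vs} \<Longrightarrow> (\<Sum>i\<in>S. (vs ! i \<bullet> x)\<^sup>2) = (\<Sum>i\<in>S. (ks_vec d vs i \<bullet> x)\<^sup>2)"
  by (intro sum.cong) (auto simp: ks_vec_def)

lemma ks_output_subset: "ks_output m s = Some S \<Longrightarrow> S \<subseteq> {..<m}"
  by (auto simp: ks_output_def split: if_splits)

definition ks_sparsity :: "real \<Rightarrow> real \<Rightarrow> real \<Rightarrow> nat \<Rightarrow> nat \<Rightarrow> nat" where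
  "ks_sparsity c \<alpha> \<epsilon> d m = (if 1 / 2 - c * sqrt \<alpha> \<le> 0 then 0
     else sparsity (head_cap (\<epsilon> / 4) (1 / 2 - c * sqrt \<alpha>) d m) m)"

text \<open>Natural cell 1 is both the input cell of \<open>d\<close> and the first output cell,
  hence the \<open>d\<close> in \<open>ra\<close>.\<close>

definition start :: "nat \<Rightarrow> st" where
  "start d = \<lparr>ra = (\<lambda>i. if i = 0 then d else 0), na = (\<lambda>_. 0), wk = (\<lambda>_. 0)\<rparr>"

lemma ks_input_mem:
  assumes "ks_instance \<alpha> d vs" "3 \<le> d"
  shows "ks_input c \<alpha> \<epsilon> d vs = ram.mem (length vs) d (rmem (ks_input c \<alpha> \<epsilon> d vs)) (start d) 0"
proof -
  have m: "0 < length vs" using ks_instance_nonempty[OF assms] .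
  interpret ram "length vs" d "rmem (ks_input c \<alpha> \<epsilon> d vs)" by unfold_locales (rule m)
  show ?thesis
    unfolding mem_def using m by (auto simp: ks_input_def start_def W_def fun_eq_iff Suc_le_eq)
qed

lemma ks_input_gram:
  assumes "ks_instance \<alpha> d vs" "3 \<le> d"
  shows "ram.gram d (rmem (ks_input c \<alpha> \<epsilon> d vs)) j l = ks_vec d vs j \<bullet> ks_vec d vs l"
proof -
  interpret ram "length vs" d "rmem (ks_input c \<alpha> \<epsilon> d vs)" by unfold_locales (rule ks_instance_nonempty[OF assms])
  have inp: "rmem (ks_input c \<alpha> \<epsilon> d vs) (3 + j * d + t) = ks_vec d vs j $ t" if t: "t < d" for j t
  proof (cases "j < length vs")
    case True
    have "j * d + t < Suc j * d" using t by simp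
    also have "\<dots> \<le> length vs * d" using True by (intro mult_le_mono1) simp
    finally show ?thesis using True t by (simp add: ks_input_def ks_vec_def)
  next
    case False
    then have "length vs * d \<le> j * d" by simp
    then have "\<not> j * d + t < length vs * d" by linarith
    then show ?thesis using False t by (simp add: ks_input_def ks_vec_def del: mult_le_cancel2)
  qed
  show ?thesis
    using ks_vec_carrier[OF assms(1), of l] by (auto simp: gram_def inp scalar_prod_def atLeast0LessThan carrier_vecD[of _ d])
qed

lemma ks_com_correct:
  assumes c: "0 < c" and al: "0 < \<alpha>" and d: "3 \<le> d" and eps: "0 < \<epsilon>" "\<epsilon> < 1"
    and m: "length vs = m" and inst: "ks_instance \<alpha> d vs"
  defines "l \<equiv> 1 / 2 - c * sqrt \<alpha>" and "u \<equiv> 1 / 2 + c * sqrt \<alpha>"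
  shows "\<exists>s. run ks_com (ks_input c \<alpha> \<epsilon> d vs) = return_spmf s \<and>
    clock s \<le> 304 * unit_cost * (m choose ks_sparsity c \<alpha> \<epsilon> d m) * (m + d) ^ 4 \<and>
    (\<forall>S. ks_output m s = Some S \<longrightarrow> ks_between d vs ((1 - \<epsilon>) * l) ((1 + \<epsilon>) * u) S) \<and>
    ((\<exists>S. ks_between d vs l u S) \<longrightarrow> ks_output m s \<noteq> None)"
proof -
  let ?v = "ks_vec d vs" and ?u = unit_cost
  define inp where "inp = rmem (ks_input c \<alpha> \<epsilon> d vs)"
  have mp: "0 < m" using ks_instance_nonempty[OF inst d] m by simp
  interpret R: ram m d inp by unfold_locales (rule mp)
  have in0: "ks_input c \<alpha> \<epsilon> d vs = R.mem (start d) 0"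
    using ks_input_mem[OF inst d] m unfolding inp_def by simp
  have ip: "inp 0 = c" "inp 1 = \<alpha>" "inp 2 = \<epsilon>" by (simp_all add: inp_def ks_input_def)
  have lam: "R.lam = l" unfolding R.lam_def ip l_def ..
  have tight: "(\<Sum>i<m. (?v i \<bullet> x)\<^sup>2) = x \<bullet> x" if "x \<in> carrier_vec d" for x
    using ks_instance_tight[OF inst that] m by simp
  have vc: "?v i \<in> carrier_vec d" for i by (rule ks_vec_carrier[OF inst])
  have lu: "u = 1 - l" by (simp add: l_def u_def)
  have bc: "bcost (RLess (RC 0) lam_exp) + 10 < ?u" by (simp add: lam_exp_def unit_cost_def)
  have n4: "1 \<le> (m + d) ^ 4" using mp by simp
  show ?thesis
  proof (cases "0 < l")
    \<comment> \<open>Here l \<le> 0 and u \<ge> 1, so every subset satisfies both bounds.\<close>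
    case False
    let ?s = "tick (Suc (Suc (Suc 0))) (nwrite 0 1 (R.mem (start d) (bcost (RLess (RC 0) lam_exp) + 1)))"
    have "run ks_com (ks_input c \<alpha> \<epsilon> d vs) = return_spmf ?s"
      unfolding in0 ks_com_def using False by (simp add: R.bval_mem R.rv_lam lam)
    moreover have "clock ?s \<le> 304 * ?u * (m choose ks_sparsity c \<alpha> \<epsilon> d m) * (m + d) ^ 4"
    proof -
      have "clock ?s \<le> ?u" using bc by (simp add: tick_def nwrite_def R.mem_def)
      also have "\<dots> \<le> 304 * ?u * (m + d) ^ 4" using n4 by simp
      finally show ?thesis using False by (simp add: ks_sparsity_def l_def)
    qed
    moreover have "ks_between d vs ((1 - \<epsilon>) * l) ((1 + \<epsilon>) * u) S" if S: "S \<subseteq> {..<m}" for S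
      unfolding ks_between_def m
    proof (intro conjI ballI S)
      fix x assume x: "x \<in> unit_vecs d"
      have "0 \<le> (\<Sum>i\<in>S. (vs ! i \<bullet> x)\<^sup>2)" by (rule sum_nonneg) simp
      moreover have "(1 - \<epsilon>) * l \<le> 0" using False eps by (simp add: mult_nonneg_nonpos)
      ultimately show "(1 - \<epsilon>) * l \<le> (\<Sum>i\<in>S. (vs ! i \<bullet> x)\<^sup>2)" by linarith
      have "(\<Sum>i\<in>S. (vs ! i \<bullet> x)\<^sup>2) = (\<Sum>i\<in>S. (?v i \<bullet> x)\<^sup>2)" using S m by (intro ks_between_sum) simp
      also have "\<dots> \<le> (\<Sum>i<m. (?v i \<bullet> x)\<^sup>2)" using S by (intro sum_mono2) auto
      also have "\<dots> = 1" using tight[of x] x by (simp add: unit_vecs_def)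
      also have "1 \<le> (1 + \<epsilon>) * u" using False eps mult_mono[of 1 "1 + \<epsilon>" 1 u] by (simp add: lu)
      finally show "(\<Sum>i\<in>S. (vs ! i \<bullet> x)\<^sup>2) \<le> (1 + \<epsilon>) * u" .
    qed
    then have "\<forall>S. ks_output m ?s = Some S \<longrightarrow> ks_between d vs ((1 - \<epsilon>) * l) ((1 + \<epsilon>) * u) S"
      using ks_output_subset by metis
    moreover have "ks_output m ?s \<noteq> None" by (simp add: ks_output_def tick_def nwrite_def)
    ultimately show ?thesis by blast
  next
    case True
    have l2: "l \<le> 1 / 2" using c al by (simp add: l_def)
    interpret K: ks d m ?v l \<epsilon>
      by unfold_locales (use vc tight True l2 eps in auto)
    have dl: "R.dl = K.\<delta>" unfolding R.dl_def ip K.\<delta>_def ..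
    have mu: "R.mu = K.\<mu>" unfolding R.mu_def ip K.\<mu>_def lam ..
    have gi: "(\<lambda>k j i. R.gram j i / (if k < 2 then R.dl * R.lam else R.mu)) = K.init"
      using ks_input_gram[OF inst d, of c \<epsilon>] unfolding inp_def[symmetric] by (auto simp: fun_eq_iff K.init_def dl mu lam)
    have dec: "R.decoded R.dl (R.dl * R.lam) R.mu R.gram br Z = K.decode (bit_symbol m br Z)" for br Z
      unfolding R.decoded_def gi K.decode_def by (simp add: dl)
    have side: "R.chosen_side R.dl (R.dl * R.lam) R.mu R.gram br Z i = K.side (bit_symbol m br Z) i" for br Z i
      by (simp add: R.chosen_side_def K.side_def dec)
    have pass: "R.passes R.dl (R.dl * R.lam) R.mu R.gram br Z \<longleftrightarrow> K.accepted (bit_symbol m br Z)" for br Z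
      by (simp add: R.passes_def K.accepted_def dec side)
    define h where "h = head_cap K.\<delta> l d m"
    have hc: "R.hcap = h" by (simp add: R.hcap_def h_def dl lam)
    note defs = R.hlim_def R.nbits_def R.brute_def
    define M where "M = card {Z. Z \<subseteq> {..<R.nbits} \<and> card Z \<le> R.hlim}"
    \<comment> \<open>The factor m + d covers \<open>Suc m\<close>; together with the cubic cost of
      a candidate it gives the exponent 4.\<close>
    have M_le: "M \<le> (m + d) * (m choose ks_sparsity c \<alpha> \<epsilon> d m)"
    proof -
      have "M \<le> Suc m * (m choose sparsity h m)"
        unfolding M_def defs hc by (rule candidates_le) (simp add: h_def head_cap_le)
      also have "sparsity h m = ks_sparsity c \<alpha> \<epsilon> d m"
        using True by (simp add: ks_sparsity_def h_def l_def K.\<delta>_def)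
      also have "Suc m * (m choose ks_sparsity c \<alpha> \<epsilon> d m) \<le> (m + d) * (m choose ks_sparsity c \<alpha> \<epsilon> d m)"
        using d by (intro mult_le_mono1) simp
      finally show ?thesis .
    qed
    have M1: "1 \<le> M"
    proof -
      have "finite {Z. Z \<subseteq> {..<R.nbits} \<and> card Z \<le> R.hlim}" by (rule finite_subset[of _ "Pow {..<R.nbits}"]) auto
      moreover have "{} \<in> {Z. Z \<subseteq> {..<R.nbits} \<and> card Z \<le> R.hlim}" by simp
      ultimately have "0 < M" unfolding M_def by (metis card_gt_0_iff empty_iff)
      then show ?thesis by simp
    qed
    have "\<exists>\<sigma>'. R.ex main_com (start d) (300 * ?u * M * (m + d) ^ 3) \<sigma>' \<and>
      (na \<sigma>' (0, 15) = 1 \<and> (\<exists>Z\<subseteq>{..<R.nbits}. card Z \<le> R.hlim \<and> R.passes R.dl (R.dl * R.lam) R.mu R.gram R.brute Z \<and>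
        (\<forall>i<m. ra \<sigma>' i = 1 - R.chosen_side R.dl (R.dl * R.lam) R.mu R.gram R.brute Z i)) \<or>
       na \<sigma>' (0, 15) = 2 \<and> (\<forall>Z\<subseteq>{..<R.nbits}. card Z \<le> R.hlim \<longrightarrow> \<not> R.passes R.dl (R.dl * R.lam) R.mu R.gram R.brute Z))"
      unfolding M_def by (rule R.main_correct) (simp_all add: start_def d)
    then obtain \<sigma>' where ex: "R.ex main_com (start d) (300 * ?u * M * (m + d) ^ 3) \<sigma>'"
      and res: "na \<sigma>' (0, 15) = 1 \<and> (\<exists>Z. K.accepted (bit_symbol m R.brute Z) \<and>
          (\<forall>i<m. ra \<sigma>' i = 1 - K.side (bit_symbol m R.brute Z) i)) \<or>
        na \<sigma>' (0, 15) = 2 \<and> (\<forall>Z\<subseteq>{..<R.nbits}. card Z \<le> R.hlim \<longrightarrow> \<not> K.accepted (bit_symbol m R.brute Z))"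
      unfolding pass side by blast
    let ?c0 = "bcost (RLess (RC 0) lam_exp) + 1"
    obtain c1 where c1: "c1 \<le> ?c0 + 300 * ?u * M * (m + d) ^ 3" and run1: "run main_com (R.mem (start d) ?c0) = return_spmf (R.mem \<sigma>' c1)"
      using ex unfolding R.ex_def by blast
    let ?b = "NLess (NConst 1) (reg 15)"
    have run2: "run ks_com (ks_input c \<alpha> \<epsilon> d vs) =
      run (Cond ?b (NStore (NConst 0) (NConst 0)) (setreg 15 (NConst 1))) (R.mem \<sigma>' c1)"
      unfolding in0 ks_com_def using True by (simp add: R.bval_mem R.rv_lam lam run1[simplified])
    have tm: "c1 + ?u + ?u \<le> 304 * ?u * (m choose ks_sparsity c \<alpha> \<epsilon> d m) * (m + d) ^ 4"
    proof -
      have "1 \<le> (m + d) ^ 3" using mp by simp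
      then have "1 \<le> M * (m + d) ^ 3" using M1 by (metis mult_le_mono mult_1)
      then have "?u \<le> ?u * (M * (m + d) ^ 3)" using mult_le_mono2[of 1 _ ?u] by simp
      moreover have "300 * ?u * M * (m + d) ^ 3 = 300 * (?u * (M * (m + d) ^ 3))" by simp
      ultimately have "c1 + ?u + ?u \<le> 304 * (?u * (M * (m + d) ^ 3))" using c1 bc by linarith
      also have "\<dots> = 304 * ?u * (M * (m + d) ^ 3)" by simp
      also have "\<dots> \<le> 304 * ?u * ((m + d) * (m choose ks_sparsity c \<alpha> \<epsilon> d m) * (m + d) ^ 3)"
        using M_le by (intro mult_le_mono) auto
      also have "\<dots> = 304 * ?u * (m choose ks_sparsity c \<alpha> \<epsilon> d m) * (m + d) ^ 4"
        by (simp add: power3_eq_cube power4_eq_xxxx)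
      finally show ?thesis .
    qed
    have bcu: "bcost ?b + 10 < ?u" by (simp add: unit_cost_def)
    from res show ?thesis
    proof
      assume A: "na \<sigma>' (0, 15) = 1 \<and> (\<exists>Z. K.accepted (bit_symbol m R.brute Z) \<and>
          (\<forall>i<m. ra \<sigma>' i = 1 - K.side (bit_symbol m R.brute Z) i))"
      then obtain b where acc: "K.accepted b" and ra: "\<And>i. i < m \<Longrightarrow> ra \<sigma>' i = 1 - K.side b i" by blast
      let ?\<sigma> = "\<sigma>'\<lparr>na := (na \<sigma>')((0, 15) := 1)\<rparr>"
      have "R.ex (Cond ?b (NStore (NConst 0) (NConst 0)) (setreg 15 (NConst 1))) \<sigma>' (?u + ?u) ?\<sigma>"
        using R.ex_setreg[of "NConst 1" 15 \<sigma>'] A bcu by (intro R.ex_Cond_False) simp_all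
      then obtain c2 where c2: "c2 \<le> c1 + (?u + ?u)" and run3: "run ks_com (ks_input c \<alpha> \<epsilon> d vs) = return_spmf (R.mem ?\<sigma> c2)"
        unfolding run2 R.ex_def by blast
      have out: "ks_output m (R.mem ?\<sigma> c2) = Some {i. i < m \<and> K.side b i = 0}"
      proof -
        have "{i. i < m \<and> nmem (R.mem ?\<sigma> c2) (Suc i) \<noteq> 0} = {i. i < m \<and> K.side b i = 0}"
          using ra K.side_less[of b] by (auto simp: R.mem_def less_2_cases_iff)
        then show ?thesis using mp by (simp add: ks_output_def) (simp add: R.mem_def)
      qed
      have "ks_between d vs ((1 - \<epsilon>) * l) ((1 + \<epsilon>) * u) {i. i < m \<and> K.side b i = 0}"
        unfolding ks_between_def m
      proof (intro conjI ballI)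
        show sub: "{i. i < m \<and> K.side b i = 0} \<subseteq> {..<m}" by auto
        fix x assume "x \<in> unit_vecs d"
        then have x: "x \<in> carrier_vec d" "x \<bullet> x = 1" by (auto simp: unit_vecs_def)
        have eq: "(\<Sum>i | i < m \<and> K.side b i = 0. (vs ! i \<bullet> x)\<^sup>2) = (\<Sum>i | i < m \<and> K.side b i = 0. (?v i \<bullet> x)\<^sup>2)"
          using m by (intro ks_between_sum) auto
        show "(1 - \<epsilon>) * l \<le> (\<Sum>i | i < m \<and> K.side b i = 0. (vs ! i \<bullet> x)\<^sup>2)"
          "(\<Sum>i | i < m \<and> K.side b i = 0. (vs ! i \<bullet> x)\<^sup>2) \<le> (1 + \<epsilon>) * u"
          unfolding eq lu using K.accepted_between[OF acc x] by simp_all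
      qed
      then show ?thesis
        using run3 out c2 tm by (intro exI[of _ "R.mem ?\<sigma> c2"]) (simp add: R.mem_def)
    next
      assume A: "na \<sigma>' (0, 15) = 2 \<and> (\<forall>Z\<subseteq>{..<R.nbits}. card Z \<le> R.hlim \<longrightarrow> \<not> K.accepted (bit_symbol m R.brute Z))"
      let ?s = "tick (Suc (Suc (Suc 0))) (nwrite 0 0 (R.mem \<sigma>' (c1 + (bcost ?b + 1))))"
      have run3: "run ks_com (ks_input c \<alpha> \<epsilon> d vs) = return_spmf ?s"
        unfolding run2 using A by (simp add: R.bval_mem)
      have out: "ks_output m ?s = None" by (simp add: ks_output_def tick_def nwrite_def)
      have "clock ?s \<le> c1 + ?u + ?u" using bcu by (simp add: tick_def nwrite_def R.mem_def)
      \<comment> \<open>A solution \<open>S\<close> would yield a passing candidate, and the search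
        has excluded all candidates.\<close>
      moreover have "\<not> ks_between d vs l u S" for S
      proof
        assume S: "ks_between d vs l u S"
        then have sub: "S \<subseteq> {..<m}" using m by (simp add: ks_between_def)
        have "l * (x \<bullet> x) \<le> (\<Sum>i\<in>S. (?v i \<bullet> x)\<^sup>2) \<and> (\<Sum>i\<in>S. (?v i \<bullet> x)\<^sup>2) \<le> u * (x \<bullet> x)"
          if "x \<in> carrier_vec d" for x
        proof (rule unit_vecs_scale[OF _ vc that])
          fix y assume "y \<in> unit_vecs d"
          then show "l \<le> (\<Sum>i\<in>S. (?v i \<bullet> y)\<^sup>2) \<and> (\<Sum>i\<in>S. (?v i \<bullet> y)\<^sup>2) \<le> u"
            using S ks_between_sum[of S vs y d] m sub unfolding ks_between_def by metis
        qed
        then have "\<exists>Z\<subseteq>{..<(if 8 * h < m then 2 * m else m)}. card Z \<le> (if 8 * h < m then h else m) \<and>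
            K.accepted (bit_symbol m (if 8 * h < m then 0 else 1) Z)"
          by (intro K.passing_candidate[OF sub]) (simp_all add: lu h_def)
        then show False using A unfolding defs hc by blast
      qed
      ultimately show ?thesis using run3 out tm by (intro exI[of _ ?s]) simp
    qed
  qed
qed

theorem theorem1:
  shows "\<exists>(P :: com) (n :: real \<Rightarrow> real \<Rightarrow> real \<Rightarrow> nat \<Rightarrow> nat \<Rightarrow> nat) (K :: real) (C :: real) (k :: nat).
    \<forall>(c :: real) (\<alpha> :: real) (\<epsilon> :: real) (d :: nat) (m :: nat) (vs :: real Matrix.vec list).
      0 < c \<longrightarrow> 0 < \<alpha> \<longrightarrow> 3 \<le> d \<longrightarrow> 0 < \<epsilon> \<longrightarrow> \<epsilon> < 1 \<longrightarrow> length vs = m \<longrightarrow> ks_instance \<alpha> d vs \<longrightarrow>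
      ((\<exists>S. ks_between d vs (1 / 2 - c * sqrt \<alpha>) (1 / 2 + c * sqrt \<alpha>) S) \<longrightarrow>
         measure (measure_spmf (randomised_ks P c \<alpha> \<epsilon> d vs))
           {s. \<exists>S'. ks_output m s = Some S' \<and>
                    ks_between d vs ((1 - \<epsilon>) * (1 / 2 - c * sqrt \<alpha>)) ((1 + \<epsilon>) * (1 / 2 + c * sqrt \<alpha>)) S'}
         \<ge> 1 - 2 / real d) \<and>
      ((\<nexists>S. ks_between d vs ((1 - \<epsilon>) * (1 / 2 - c * sqrt \<alpha>)) ((1 + \<epsilon>) * (1 / 2 + c * sqrt \<alpha>)) S) \<longrightarrow>
         measure (measure_spmf (randomised_ks P c \<alpha> \<epsilon> d vs)) {s. ks_output m s = None} = 1) \<and>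
      lossless_spmf (randomised_ks P c \<alpha> \<epsilon> d vs) \<and>
      (\<forall>s \<in> set_spmf (randomised_ks P c \<alpha> \<epsilon> d vs).
         real (clock s) \<le> C * real (m choose n c \<alpha> \<epsilon> d m) * real (m + d) ^ k) \<and>
      (c * sqrt \<alpha> < 1 / 2 \<longrightarrow>
         real (n c \<alpha> \<epsilon> d m) \<le> K * (real d / \<epsilon>\<^sup>2 * ln (real d) *
           max (ln (1 / (c * sqrt \<alpha>))) (ln (1 / (1 / 2 - c * sqrt \<alpha>)))))"
proof (rule exI[of _ ks_com], rule exI[of _ ks_sparsity], rule exI[of _ 1100],
    rule exI[of _ "real (304 * unit_cost)"], rule exI[of _ 4], intro allI impI)
  fix c \<alpha> \<epsilon> :: real and d m :: nat and vs :: "real Matrix.vec list"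
  assume c: "0 < c" and al: "0 < \<alpha>" and d: "3 \<le> d" and eps: "0 < \<epsilon>" "\<epsilon> < 1"
    and m: "length vs = m" and inst: "ks_instance \<alpha> d vs"
  let ?l = "1 / 2 - c * sqrt \<alpha>" and ?u = "1 / 2 + c * sqrt \<alpha>"
  let ?good = "ks_between d vs ((1 - \<epsilon>) * ?l) ((1 + \<epsilon>) * ?u)"
  obtain s where run: "randomised_ks ks_com c \<alpha> \<epsilon> d vs = return_spmf s"
    and clock: "clock s \<le> 304 * unit_cost * (m choose ks_sparsity c \<alpha> \<epsilon> d m) * (m + d) ^ 4"
    and sound: "\<And>S. ks_output m s = Some S \<Longrightarrow> ?good S"
    and compl: "(\<exists>S. ks_between d vs ?l ?u S) \<Longrightarrow> ks_output m s \<noteq> None"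
    using ks_com_correct[OF c al d eps m inst] unfolding randomised_ks_def by blast
  \<comment> \<open>The run is a point mass, so every probability in the claim is 0 or 1.\<close>
  have meas: "measure (measure_spmf (return_spmf s)) A = indicator A s" for A
    by (simp add: measure_spmf_return_spmf measure_return)
  have 1: "measure (measure_spmf (randomised_ks ks_com c \<alpha> \<epsilon> d vs)) {s. \<exists>S'. ks_output m s = Some S' \<and> ?good S'} \<ge> 1 - 2 / real d"
    if "\<exists>S. ks_between d vs ?l ?u S"
    using compl[OF that] sound unfolding run meas by (auto simp: indicator_def)
  \<comment> \<open>Soundness alone: any returned set would be good, so only the report
    remains.\<close>
  have 2: "measure (measure_spmf (randomised_ks ks_com c \<alpha> \<epsilon> d vs)) {s. ks_output m s = None} = 1"
    if "\<nexists>S. ?good S"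
    using that sound unfolding run meas by (cases "ks_output m s") auto
  have 3: "lossless_spmf (randomised_ks ks_com c \<alpha> \<epsilon> d vs)" by (simp add: run)
  have 4: "real (clock s') \<le> real (304 * unit_cost) * real (m choose ks_sparsity c \<alpha> \<epsilon> d m) * real (m + d) ^ 4"
    if "s' \<in> set_spmf (randomised_ks ks_com c \<alpha> \<epsilon> d vs)" for s'
  proof -
    have "s' = s" using that by (simp add: run)
    then show ?thesis using clock by (metis of_nat_le_iff of_nat_mult of_nat_power)
  qed
  have 5: "real (ks_sparsity c \<alpha> \<epsilon> d m) \<le> 1100 * (real d / \<epsilon>\<^sup>2 * ln (real d) *
           max (ln (1 / (c * sqrt \<alpha>))) (ln (1 / ?l)))" if t: "c * sqrt \<alpha> < 1 / 2"
  proof -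
    have l: "0 < ?l" "?l < 1 / 2" using t c al by simp_all
    \<comment> \<open>As d \<ge> 3 \<ge> e, multiplying by \<open>ln d\<close> does not lower the
      bound; the maximum is at least its second entry.\<close>
    have "ln (real d) \<ge> 1"
    proof -
      have "exp 1 \<le> (3 :: real)" using exp_le by simp
      also have "\<dots> \<le> real d" using d by simp
      finally show ?thesis using d by (subst ln_ge_iff) simp_all
    qed
    moreover have "ln (1 / ?l) \<ge> 0" using l by simp
    ultimately have "1 * ln (1 / ?l) \<le> ln (real d) * max (ln (1 / (c * sqrt \<alpha>))) (ln (1 / ?l))"
      by (intro mult_mono) auto
    then have "real d / \<epsilon>\<^sup>2 * ln (1 / ?l) \<le> real d / \<epsilon>\<^sup>2 * (ln (real d) * max (ln (1 / (c * sqrt \<alpha>))) (ln (1 / ?l)))"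
      by (intro mult_left_mono) auto
    moreover have "real (ks_sparsity c \<alpha> \<epsilon> d m) \<le> 1100 * (real d / \<epsilon>\<^sup>2 * ln (1 / ?l))"
      using head_cap_bound[OF eps l d, of m] t by (simp add: ks_sparsity_def)
    ultimately show ?thesis by (simp add: mult.assoc)
  qed
  show "((\<exists>S. ks_between d vs ?l ?u S) \<longrightarrow>
         measure (measure_spmf (randomised_ks ks_com c \<alpha> \<epsilon> d vs)) {s. \<exists>S'. ks_output m s = Some S' \<and> ?good S'} \<ge> 1 - 2 / real d) \<and>
      ((\<nexists>S. ?good S) \<longrightarrow>
         measure (measure_spmf (randomised_ks ks_com c \<alpha> \<epsilon> d vs)) {s. ks_output m s = None} = 1) \<and>
      lossless_spmf (randomised_ks ks_com c \<alpha> \<epsilon> d vs) \<and>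
      (\<forall>s \<in> set_spmf (randomised_ks ks_com c \<alpha> \<epsilon> d vs).
         real (clock s) \<le> real (304 * unit_cost) * real (m choose ks_sparsity c \<alpha> \<epsilon> d m) * real (m + d) ^ 4) \<and>
      (c * sqrt \<alpha> < 1 / 2 \<longrightarrow>
         real (ks_sparsity c \<alpha> \<epsilon> d m) \<le> 1100 * (real d / \<epsilon>\<^sup>2 * ln (real d) *
           max (ln (1 / (c * sqrt \<alpha>))) (ln (1 / ?l))))"
    using 1 2 3 4 5 by blast
qed

end
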